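(* Let $k$ be a field and let $R$ be a $k$-algebra which is oriented by three idempotents $e, e'_1, e'_2$. Put $e_i=e'_i+e$ and $A_i=e_iRe_i$ for $i=1,2$, and $C=eRe$. There exists a long exact sequence of cyclic cohomology groups $$0\to{\rm HC}^0(R)\to{\rm HC}^0(A_1)\oplus{\rm HC}^0(A_2)\to{\rm HC}^0(C)\to{\rm HC}^1(R)\to{\rm HC}^1(A_1)\oplus{\rm HC}^1(A_2)\to{\rm HC}^1(C)\to\cdots .$$
   Context: Algebras are associative unital algebras over a field $k$; $\otimes=\otimes_k$; $D={\rm Hom}_k(-,k)$. An algebra $R$ is \emph{oriented} by $e,e'_1,e'_2$ if $e,e'_1,e'_2$ are orthogonal idempotents of $R$ with $1_R=e'_1+e+e'_2$, such that $e'_1Re'_2=e'_2Re'_1=0$ and at least one of the following holds: (1) $eRe'_1=eRe'_2=0$; (2) $e'_1Re=e'_2Re=0$; (3) $e'_1Re=eRe'_2=0$. The algebras $C$, $A_1$, $A_2$ have units $e$, $e_1$, $e_2$. Cyclic cohomology of an algebra $\Lambda$: on $\Lambda^{\otimes n+1}$ let $b'(r_0\otimes\cdots\otimes r_n)=\sum_{i=0}^{n-1}(-1)^ir_0\otimes\cdots\otimes r_ir_{i+1}\otimes\cdots\otimes r_n$, $b(r_0\otimes\cdots\otimes r_n)=b'(r_0\otimes\cdots\otimes r_n)+(-1)^nr_nr_0\otimes r_1\otimes\cdots\otimes r_{n-1}$, $t(r_0\otimes\cdots\otimes r_n)=(-1)^nr_n\otimes r_0\otimes\cdots\otimes r_{n-1}$,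 $N=1+t+\cdots+t^n$. The cyclic bicomplex $CC(\Lambda)$ is the first quadrant bicomplex with $CC(\Lambda)_{p,q}=\Lambda^{\otimes q+1}$, vertical differential $b$ in even columns and $-b'$ in odd columns, horizontal differential $1-t$ from odd to even columns and $N$ from even to odd columns. Applying $D$ gives the dual bicomplex $D(CC(\Lambda))$, and ${\rm HC}^n(\Lambda)={\rm H}^n({\rm Tot}\,D(CC(\Lambda)))$. *)

theory Defs
  imports
    Complex_Main
    "HOL-Library.Poly_Mapping"
    "HOL-Library.Function_Algebras"
    "HOL-Library.Product_Plus"
    "HOL-Library.Set_Algebras"
begin

section \<open>Algebras over a field, as subsets of a type\<close>

text \<open>An algebra is a subset \<open>A\<close> of a type, with its own unit \<open>u\<close>. So an algebra and its
  corners live in the same type, and the zero algebra is allowed.\<close>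

locale unital_algebra = vector_space scale
  for scale :: "'k::field \<Rightarrow> 'a::ring \<Rightarrow> 'a" +
  fixes A :: "'a set" and u :: 'a
  assumes subspace_carrier: "subspace A"
    and mult_closed: "x \<in> A \<Longrightarrow> y \<in> A \<Longrightarrow> x * y \<in> A"
    and scale_mult_left: "x \<in> A \<Longrightarrow> y \<in> A \<Longrightarrow> scale c x * y = scale c (x * y)"
    and scale_mult_right: "x \<in> A \<Longrightarrow> y \<in> A \<Longrightarrow> x * scale c y = scale c (x * y)"
    and unit_closed: "u \<in> A"
    and unit_left: "x \<in> A \<Longrightarrow> u * x = x"
    and unit_right: "x \<in> A \<Longrightarrow> x * u = x"

definition corner :: "'a::ring set \<Rightarrow> 'a \<Rightarrow> 'a \<Rightarrow> 'a set" where
  "corner R e f = {e * x * f | x. x \<in> R}"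

definition oriented :: "'a::ring set \<Rightarrow> 'a \<Rightarrow> 'a \<Rightarrow> 'a \<Rightarrow> 'a \<Rightarrow> bool" where
  "oriented R u e e1' e2' \<longleftrightarrow>
     e \<in> R \<and> e1' \<in> R \<and> e2' \<in> R \<and>
     e * e = e \<and> e1' * e1' = e1' \<and> e2' * e2' = e2' \<and>
     e * e1' = 0 \<and> e1' * e = 0 \<and> e * e2' = 0 \<and> e2' * e = 0 \<and> e1' * e2' = 0 \<and> e2' * e1' = 0 \<and>
     u = e1' + e + e2' \<and>
     corner R e1' e2' = {0} \<and> corner R e2' e1' = {0} \<and>
     ((corner R e e1' = {0} \<and> corner R e e2' = {0}) \<or>
      (corner R e1' e = {0} \<and> corner R e2' e = {0}) \<or>
      (corner R e1' e = {0} \<and> corner R e e2' = {0}))"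

lemma (in unital_algebra) unital_algebra_corner:
  assumes e: "e \<in> A" "e * e = e"
  shows "unital_algebra scale (corner A e e) e"
proof -
  have sub: "corner A e e \<subseteq> A"
    unfolding corner_def using e mult_closed by blast
  have lu: "e * x = x" and ru: "x * e = x" if "x \<in> corner A e e" for x
    using that e(2) unfolding corner_def by (auto simp: mult.assoc) (metis mult.assoc)
  have mem: "x \<in> corner A e e" if "x \<in> A" "e * x = x" "x * e = x" for x
    unfolding corner_def using that by (metis (mono_tags, lifting) mem_Collect_eq)
  show ?thesis
  proof unfold_locales
    show "subspace (corner A e e)"
    proof (rule subspaceI)
      show "0 \<in> corner A e e"
        using subspace_0[OF subspace_carrier] by (intro mem) auto
      show "x + y \<in> corner A e e" if "x \<in> corner A e e" "y \<in> corner A e e" for x y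
        using that sub subspace_add[OF subspace_carrier]
        by (intro mem) (auto simp: distrib_left distrib_right lu ru)
      show "scale c x \<in> corner A e e" if "x \<in> corner A e e" for c x
        using that sub e subspace_scale[OF subspace_carrier]
        by (intro mem) (auto simp: subset_iff scale_mult_left scale_mult_right lu ru)
    qed
    show "x * y \<in> corner A e e" if "x \<in> corner A e e" "y \<in> corner A e e" for x y
      using that sub mult_closed by (intro mem) (auto simp: mult.assoc ru mult.assoc[symmetric] lu)
    show "e \<in> corner A e e"
      using e by (intro mem) auto
  qed (use sub scale_mult_left scale_mult_right lu ru in \<open>auto simp: subset_iff\<close>)
qed


section \<open>Linear maps, quotients and duals of spaces given by carriers\<close>

text \<open>Spaces are given by a carrier and a scalar multiplication. Their addition is the one of
  the type: addition of sets (\<open>Set_Algebras\<close>) for cosets, the pointwise one for functions, the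
  componentwise one for pairs.\<close>

definition linear_on ::
    "'v::plus set \<Rightarrow> ('k \<Rightarrow> 'v \<Rightarrow> 'v) \<Rightarrow> 'w::plus set \<Rightarrow> ('k \<Rightarrow> 'w \<Rightarrow> 'w) \<Rightarrow> ('v \<Rightarrow> 'w) \<Rightarrow> bool" where
  "linear_on V sV W sW f \<longleftrightarrow>
     (\<forall>x\<in>V. f x \<in> W) \<and>
     (\<forall>x\<in>V. \<forall>y\<in>V. f (x + y) = f x + f y) \<and>
     (\<forall>c. \<forall>x\<in>V. f (sV c x) = sW c (f x))"

definition pair_scale ::
    "('k \<Rightarrow> 'v \<Rightarrow> 'v) \<Rightarrow> ('k \<Rightarrow> 'w \<Rightarrow> 'w) \<Rightarrow> 'k \<Rightarrow> 'v \<times> 'w \<Rightarrow> 'v \<times> 'w" where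
  "pair_scale sV sW c z = (sV c (fst z), sW c (snd z))"

definition quot_space :: "'v::plus set \<Rightarrow> 'v set \<Rightarrow> 'v set set" where
  "quot_space V W = (\<lambda>v. v +o W) ` V"

text \<open>The summand \<open>W\<close> matters for \<open>c = 0\<close> only: the zero of the quotient is \<open>W\<close>, not \<open>{0}\<close>.\<close>

definition quot_scale :: "('k \<Rightarrow> 'v \<Rightarrow> 'v) \<Rightarrow> 'v::plus set \<Rightarrow> 'k \<Rightarrow> 'v set \<Rightarrow> 'v set" where
  "quot_scale s W c X = s c ` X + W"

text \<open>For a linear \<open>F\<close> mapping \<open>V\<close> to \<open>V'\<close> and \<open>W\<close> to \<open>W'\<close>, this is the induced map from
  \<open>V / W\<close> to \<open>V' / W'\<close>.\<close>

definition quot_map :: "'w::plus set \<Rightarrow> ('v \<Rightarrow> 'w) \<Rightarrow> 'v set \<Rightarrow> 'w set" where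
  "quot_map W' F X = F ` X + W'"

text \<open>Functionals vanish outside of the carrier, so that they are determined by their values
  on it.\<close>

definition dual_space :: "'v::plus set \<Rightarrow> ('k::field \<Rightarrow> 'v \<Rightarrow> 'v) \<Rightarrow> ('v \<Rightarrow> 'k) set" where
  "dual_space V sV = {\<phi>. linear_on V sV UNIV (*) \<phi> \<and> (\<forall>x. x \<notin> V \<longrightarrow> \<phi> x = 0)}"

definition dual_map :: "'v set \<Rightarrow> ('v \<Rightarrow> 'w) \<Rightarrow> ('w \<Rightarrow> 'k::field) \<Rightarrow> 'v \<Rightarrow> 'k" where
  "dual_map V F \<phi> x = (if x \<in> V then \<phi> (F x) else 0)"


section \<open>Tensor powers\<close>

text \<open>The vector space with basis the lists over \<open>'a\<close> is \<open>'a list \<Rightarrow>\<^sub>0 'k\<close>; the list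
  \<open>[r\<^sub>0, \<dots>, r\<^sub>n]\<close> stands for the tensor of \<open>r\<^sub>0, \<dots>, r\<^sub>n\<close>.\<close>

definition fscale :: "'k::field \<Rightarrow> ('x \<Rightarrow>\<^sub>0 'k) \<Rightarrow> ('x \<Rightarrow>\<^sub>0 'k)" where
  "fscale c = Poly_Mapping.map ((*) c)"

lemma lookup_fscale [simp]: "Poly_Mapping.lookup (fscale c x) i = c * Poly_Mapping.lookup x i"
  by (simp add: fscale_def map.rep_eq when_def)

global_interpretation fscale: vector_space fscale
  by unfold_locales (auto intro!: poly_mapping_eqI simp: lookup_add algebra_simps)

definition lin_ext :: "('x \<Rightarrow> ('y \<Rightarrow>\<^sub>0 'k)) \<Rightarrow> ('x \<Rightarrow>\<^sub>0 'k) \<Rightarrow> ('y \<Rightarrow>\<^sub>0 'k::field)" where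
  "lin_ext F x = (\<Sum>i\<in>Poly_Mapping.keys x. fscale (Poly_Mapping.lookup x i) (F i))"

definition free_on :: "'a set \<Rightarrow> nat \<Rightarrow> ('a list \<Rightarrow>\<^sub>0 'k::field) set" where
  "free_on A n = {x. \<forall>rs\<in>Poly_Mapping.keys x. length rs = n \<and> set rs \<subseteq> A}"

definition tensor_rels ::
    "('k::field \<Rightarrow> 'a::ring \<Rightarrow> 'a) \<Rightarrow> 'a set \<Rightarrow> nat \<Rightarrow> ('a list \<Rightarrow>\<^sub>0 'k) set" where
  "tensor_rels scale A n = fscale.span
     ({Poly_Mapping.single (xs @ (x + y) # ys) 1 - Poly_Mapping.single (xs @ x # ys) 1
         - Poly_Mapping.single (xs @ y # ys) 1 | xs x y ys.
         set xs \<subseteq> A \<and> x \<in> A \<and> y \<in> A \<and> set ys \<subseteq> A \<and> length xs + 1 + length ys = n} \<union>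
      {Poly_Mapping.single (xs @ scale c x # ys) 1 - Poly_Mapping.single (xs @ x # ys) c | xs c x ys.
         set xs \<subseteq> A \<and> x \<in> A \<and> set ys \<subseteq> A \<and> length xs + 1 + length ys = n})"

definition tensor_power ::
    "('k::field \<Rightarrow> 'a::ring \<Rightarrow> 'a) \<Rightarrow> 'a set \<Rightarrow> nat \<Rightarrow> ('a list \<Rightarrow>\<^sub>0 'k) set set" where
  "tensor_power scale A n = quot_space (free_on A n) (tensor_rels scale A n)"

definition tensor_scale ::
    "('k::field \<Rightarrow> 'a::ring \<Rightarrow> 'a) \<Rightarrow> 'a set \<Rightarrow> nat \<Rightarrow>
       'k \<Rightarrow> ('a list \<Rightarrow>\<^sub>0 'k) set \<Rightarrow> ('a list \<Rightarrow>\<^sub>0 'k) set" where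
  "tensor_scale scale A n = quot_scale fscale (tensor_rels scale A n)"


section \<open>The cyclic bicomplex\<close>

definition bprime_gen :: "'a::ring list \<Rightarrow> ('a list \<Rightarrow>\<^sub>0 'k::field)" where
  "bprime_gen rs = (\<Sum>i<length rs - 1.
     Poly_Mapping.single (take i rs @ (rs ! i * rs ! Suc i) # drop (i + 2) rs) ((- 1) ^ i))"

text \<open>Only meaningful, and only used, for lists of length at least 2.\<close>

definition b_gen :: "'a::ring list \<Rightarrow> ('a list \<Rightarrow>\<^sub>0 'k::field)" where
  "b_gen rs = bprime_gen rs +
     Poly_Mapping.single ((last rs * hd rs) # butlast (tl rs)) ((- 1) ^ (length rs - 1))"

definition t_gen :: "'a list \<Rightarrow> ('a list \<Rightarrow>\<^sub>0 'k::field)" where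
  "t_gen rs = Poly_Mapping.single (last rs # butlast rs) ((- 1) ^ (length rs - 1))"

definition CC :: "('k::field \<Rightarrow> 'a::ring \<Rightarrow> 'a) \<Rightarrow> 'a set \<Rightarrow> nat \<Rightarrow> nat \<Rightarrow> ('a list \<Rightarrow>\<^sub>0 'k) set set" where
  "CC scale A p q = tensor_power scale A (q + 1)"

text \<open>The differential from position \<open>(p, q)\<close> to \<open>(p, q - 1)\<close>, for \<open>q \<ge> 1\<close>.\<close>

definition CC_vert ::
    "('k::field \<Rightarrow> 'a::ring \<Rightarrow> 'a) \<Rightarrow> 'a set \<Rightarrow> nat \<Rightarrow> nat \<Rightarrow>
       ('a list \<Rightarrow>\<^sub>0 'k) set \<Rightarrow> ('a list \<Rightarrow>\<^sub>0 'k) set" where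
  "CC_vert scale A p q = quot_map (tensor_rels scale A q)
     (if even p then lin_ext b_gen else (\<lambda>x. - lin_ext bprime_gen x))"

text \<open>The differential from position \<open>(p, q)\<close> to \<open>(p - 1, q)\<close>, for \<open>p \<ge> 1\<close>.\<close>

definition CC_hor ::
    "('k::field \<Rightarrow> 'a::ring \<Rightarrow> 'a) \<Rightarrow> 'a set \<Rightarrow> nat \<Rightarrow> nat \<Rightarrow>
       ('a list \<Rightarrow>\<^sub>0 'k) set \<Rightarrow> ('a list \<Rightarrow>\<^sub>0 'k) set" where
  "CC_hor scale A p q = quot_map (tensor_rels scale A (q + 1))
     (if odd p then (\<lambda>x. x - lin_ext t_gen x) else (\<lambda>x. \<Sum>i\<le>q. (lin_ext t_gen ^^ i) x))"


section \<open>Cyclic cohomology\<close>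

definition DCC ::
    "('k::field \<Rightarrow> 'a::ring \<Rightarrow> 'a) \<Rightarrow> 'a set \<Rightarrow> nat \<Rightarrow> nat \<Rightarrow> (('a list \<Rightarrow>\<^sub>0 'k) set \<Rightarrow> 'k) set" where
  "DCC scale A p q = dual_space (CC scale A p q) (tensor_scale scale A (q + 1))"

definition DCC_vert ::
    "('k::field \<Rightarrow> 'a::ring \<Rightarrow> 'a) \<Rightarrow> 'a set \<Rightarrow> nat \<Rightarrow> nat \<Rightarrow>
       (('a list \<Rightarrow>\<^sub>0 'k) set \<Rightarrow> 'k) \<Rightarrow> ('a list \<Rightarrow>\<^sub>0 'k) set \<Rightarrow> 'k" where
  "DCC_vert scale A p q = dual_map (CC scale A p (q + 1)) (CC_vert scale A p (q + 1))"

definition DCC_hor ::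
    "('k::field \<Rightarrow> 'a::ring \<Rightarrow> 'a) \<Rightarrow> 'a set \<Rightarrow> nat \<Rightarrow> nat \<Rightarrow>
       (('a list \<Rightarrow>\<^sub>0 'k) set \<Rightarrow> 'k) \<Rightarrow> ('a list \<Rightarrow>\<^sub>0 'k) set \<Rightarrow> 'k" where
  "DCC_hor scale A p q = dual_map (CC scale A (p + 1) q) (CC_hor scale A (p + 1) q)"

text \<open>The component of an \<open>n\<close>-cochain \<open>c\<close> at position \<open>(p, n - p)\<close> is \<open>c p\<close>.\<close>

definition Tot ::
    "('k::field \<Rightarrow> 'a::ring \<Rightarrow> 'a) \<Rightarrow> 'a set \<Rightarrow> nat \<Rightarrow> (nat \<Rightarrow> ('a list \<Rightarrow>\<^sub>0 'k) set \<Rightarrow> 'k) set" where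
  "Tot scale A n = {c. (\<forall>p\<le>n. c p \<in> DCC scale A p (n - p)) \<and> (\<forall>p>n. c p = 0)}"

text \<open>No further signs: the squares of the cyclic bicomplex anticommute, because of the sign
  in \<open>-b'\<close>.\<close>

definition Tot_diff ::
    "('k::field \<Rightarrow> 'a::ring \<Rightarrow> 'a) \<Rightarrow> 'a set \<Rightarrow> nat \<Rightarrow>
       (nat \<Rightarrow> ('a list \<Rightarrow>\<^sub>0 'k) set \<Rightarrow> 'k) \<Rightarrow> nat \<Rightarrow> ('a list \<Rightarrow>\<^sub>0 'k) set \<Rightarrow> 'k" where
  "Tot_diff scale A n c p =
     (if p \<le> n then DCC_vert scale A p (n - p) (c p) else 0) +
     (if 1 \<le> p \<and> p \<le> n + 1 then DCC_hor scale A (p - 1) (n - (p - 1)) (c (p - 1)) else 0)"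

definition Tot_scale ::
    "'k::field \<Rightarrow> (nat \<Rightarrow> ('a list \<Rightarrow>\<^sub>0 'k) set \<Rightarrow> 'k) \<Rightarrow> nat \<Rightarrow> ('a list \<Rightarrow>\<^sub>0 'k) set \<Rightarrow> 'k" where
  "Tot_scale a c p X = a * c p X"

definition cocycles ::
    "('k::field \<Rightarrow> 'a::ring \<Rightarrow> 'a) \<Rightarrow> 'a set \<Rightarrow> nat \<Rightarrow> (nat \<Rightarrow> ('a list \<Rightarrow>\<^sub>0 'k) set \<Rightarrow> 'k) set" where
  "cocycles scale A n = {c \<in> Tot scale A n. Tot_diff scale A n c = 0}"

fun coboundaries ::
    "('k::field \<Rightarrow> 'a::ring \<Rightarrow> 'a) \<Rightarrow> 'a set \<Rightarrow> nat \<Rightarrow> (nat \<Rightarrow> ('a list \<Rightarrow>\<^sub>0 'k) set \<Rightarrow> 'k) set" where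
  "coboundaries scale A 0 = {0}"
| "coboundaries scale A (Suc n) = Tot_diff scale A n ` Tot scale A n"

definition HC ::
    "('k::field \<Rightarrow> 'a::ring \<Rightarrow> 'a) \<Rightarrow> 'a set \<Rightarrow> nat \<Rightarrow> (nat \<Rightarrow> ('a list \<Rightarrow>\<^sub>0 'k) set \<Rightarrow> 'k) set set" where
  "HC scale A n = quot_space (cocycles scale A n) (coboundaries scale A n)"

definition HC_scale ::
    "('k::field \<Rightarrow> 'a::ring \<Rightarrow> 'a) \<Rightarrow> 'a set \<Rightarrow> nat \<Rightarrow> 'k \<Rightarrow>
       (nat \<Rightarrow> ('a list \<Rightarrow>\<^sub>0 'k) set \<Rightarrow> 'k) set \<Rightarrow> (nat \<Rightarrow> ('a list \<Rightarrow>\<^sub>0 'k) set \<Rightarrow> 'k) set" where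
  "HC_scale scale A n = quot_scale Tot_scale (coboundaries scale A n)"

definition HC_zero ::
    "('k::field \<Rightarrow> 'a::ring \<Rightarrow> 'a) \<Rightarrow> 'a set \<Rightarrow> nat \<Rightarrow> (nat \<Rightarrow> ('a list \<Rightarrow>\<^sub>0 'k) set \<Rightarrow> 'k) set" where
  "HC_zero scale A n = coboundaries scale A n"

end

(* A triangular algebra A, i.e. one with u = p + q and p A q = 0, has the cyclic cohomology of
   p A p times q A q. The projections x -> p x and x -> x q are algebra maps onto the two corners,
   so it is enough to show that the subcomplex K of cochains vanishing on words in p A p and on
   words in q A q is acyclic. Its rows and columns stay inside K, the columns of K are exact by
   explicit homotopies that insert p or q into a word, and a staircase argument does the rest.
   An oriented algebra R is triangular for the pair e1', e2 and A1 is triangular for e1', e. With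
   P = e1' R e1' this gives HC(R) = HC(P) + HC(A2) and HC(A1) = HC(P) + HC(C), compatibly with
   restriction. Hence the restriction maps form short exact sequences and the connecting maps
   vanish. *)

theory Submission
  imports Defs
begin

section \<open>Quotients\<close>

text \<open>Exactness of the rows, even away from column 0, would in general need the word lengths
  to be invertible in k; this is why the acyclicity of K has to come from its columns. The usual
  contraction of the b' column inserts the unit in front of a word, but the unit lies in neither
  corner and this leaves K. Replacing \<open>1 \<otimes> x\<close> by
  \<open>p \<otimes> p x + q \<otimes> q x\<close> repairs it. The b column is a Hochschild complex
  whose coefficient is the first letter. Since \<open>p A q = 0\<close>, the left ideal
  \<open>A p\<close> is two-sided, so the coefficients split into \<open>A p\<close> and
  \<open>A / A p\<close>, and each of the two gets its own homotopy. Cochains are handled as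
  multilinear maps on lists, where every operator is a sum of faces and rotations. That the
  operators respect the tensor relations is deduced by duality: an element outside the relations is
  detected by a functional vanishing on them, and such a functional is multilinear. The bicomplex
  never uses units, so every multiplicative linear map acts on it. Hence cochains can be restricted
  to corners and also pulled back along projections onto corners; the pullbacks provide the lifts
  that make restriction to C surjective.\<close>

lemma linear_on_diff:
  fixes r :: "'b::ab_group_add \<Rightarrow> 'c::ab_group_add"
  assumes "linear_on Z s W s' r" "x \<in> Z" "y \<in> Z" "x - y \<in> Z"
  shows "r (x - y) = r x - r y"
proof -
  have "r (x - y + y) = r (x - y) + r y"
    using assms unfolding linear_on_def by blast
  then show ?thesis
    by (simp add: algebra_simps)
qed

context vector_space begin

lemma coset_self: "subspace W \<Longrightarrow> v \<in> v +o W"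
  using subspace_0 by (force simp: elt_set_plus_def)

lemma coset_eq_iff:
  assumes W: "subspace W"
  shows "v +o W = w +o W \<longleftrightarrow> v - w \<in> W"
proof
  assume "v +o W = w +o W"
  then show "v - w \<in> W"
    using coset_self[OF W, of v] by (auto simp: elt_set_plus_def)
next
  assume *: "v - w \<in> W"
  have "\<exists>b\<in>W. v + x = w + b" if "x \<in> W" for x
    using that * subspace_add[OF W] by (intro bexI[of _ "(v - w) + x"]) auto
  moreover have "\<exists>b\<in>W. w + x = v + b" if "x \<in> W" for x
    using that * subspace_diff[OF W] by (intro bexI[of _ "x - (v - w)"]) auto
  ultimately show "v +o W = w +o W"
    by (auto simp: elt_set_plus_def)
qed

lemma coset_eq_self_iff: "subspace W \<Longrightarrow> v +o W = W \<longleftrightarrow> v \<in> W"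
  using coset_eq_iff[of W v 0] by simp

lemma subspace_plus_self:
  assumes W: "subspace W"
  shows "W + W = W"
proof
  show "W + W \<subseteq> W"
    using subspace_add[OF W] by (auto elim!: set_plus_elim)
  show "W \<subseteq> W + W"
    using set_plus_intro[OF _ subspace_0[OF W]] by (metis add.right_neutral subsetI)
qed

lemma coset_plus: "subspace W \<Longrightarrow> (v +o W) + (w +o W) = (v + w) +o W"
  using set_plus_rearrange[of v W w W] subspace_plus_self by simp

lemma quot_scale_coset:
  assumes W: "subspace W"
  shows "quot_scale scale W c (v +o W) = scale c v +o W"
proof -
  have "\<exists>b\<in>W. x = c *s v + b" if x: "x \<in> (*s) c ` (v +o W) + W" for x
  proof -
    obtain w w' where w: "w \<in> W" "w' \<in> W" "x = c *s (v + w) + w'"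
      using x by (auto simp: set_plus_def elt_set_plus_def)
    then show ?thesis
      using subspace_add[OF W] subspace_scale[OF W]
      by (intro bexI[of _ "c *s w + w'"]) (auto simp: scale_right_distrib)
  qed
  moreover have "c *s v + b \<in> (*s) c ` (v +o W) + W" if "b \<in> W" for b
    using that coset_self[OF W, of v] by (intro set_plus_intro) auto
  ultimately show ?thesis
    unfolding quot_scale_def elt_set_plus_def by auto
qed

text \<open>Additivity is asked only along one coset: some of the maps it is applied to are built
  from a chosen inverse and are controlled on actual cochains only.\<close>

lemma quot_map_coset:
  assumes W: "subspace W" and W': "subspace W'"
    and add: "\<And>w. w \<in> W \<Longrightarrow> F (v + w) = F v + F w" and FW: "F ` W \<subseteq> W'"
  shows "quot_map W' F (v +o W) = F v +o W'"
proof -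
  have "\<exists>b\<in>W'. x = F v + b" if x: "x \<in> F ` (v +o W) + W'" for x
  proof -
    obtain w w' where w: "w \<in> W" "w' \<in> W'" "x = F (v + w) + w'"
      using x by (auto simp: set_plus_def elt_set_plus_def)
    then show ?thesis
      using subspace_add[OF W', of "F w" w'] FW add by (intro bexI[of _ "F w + w'"]) (auto simp: add.assoc)
  qed
  moreover have "F v + b \<in> F ` (v +o W) + W'" if "b \<in> W'" for b
    using that coset_self[OF W, of v] by (intro set_plus_intro) auto
  ultimately show ?thesis
    unfolding quot_map_def elt_set_plus_def by auto
qed

lemma linear_on_zero:
  assumes W: "subspace W" and Z: "subspace Z"
    and add: "\<And>x y. x \<in> V \<Longrightarrow> y \<in> V \<Longrightarrow> x + y \<in> V"
  shows "linear_on V sV (quot_space Z W) (quot_scale scale W) (\<lambda>x. W)"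
proof -
  have "W \<in> quot_space Z W"
    unfolding quot_space_def using subspace_0[OF Z] by (metis image_eqI set_zero_plus)
  moreover have "quot_scale scale W c W = W" for c
    using quot_scale_coset[OF W, of c 0] by simp
  ultimately show ?thesis
    using subspace_plus_self[OF W] by (auto simp: linear_on_def)
qed

text \<open>The maps \<open>r1\<close>, \<open>r2\<close>, \<open>s1\<close>, \<open>s2\<close> act
  on cocycles. Read modulo coboundaries, \<open>inj\<close>, \<open>glue\<close> and
  \<open>surj\<close> say that 0 -> HR -> H1 + H2 -> HC' -> 0 is exact in each degree, the second
  map being the difference of \<open>s1\<close> and \<open>s2\<close>. Such sequences are spliced by
  zero maps.\<close>

lemma exact_sequence_of_lifts:
  fixes ZR BR Z1 B1 Z2 B2 ZC BC :: "nat \<Rightarrow> 'b set"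
  assumes ZR: "\<And>n. subspace (ZR n)" and BR: "\<And>n. subspace (BR n)"
    and Z1: "\<And>n. subspace (Z1 n)" and B1: "\<And>n. subspace (B1 n)"
    and Z2: "\<And>n. subspace (Z2 n)" and B2: "\<And>n. subspace (B2 n)"
    and ZC: "\<And>n. subspace (ZC n)" and BC: "\<And>n. subspace (BC n)"
    and r1_add: "\<And>n z w. z \<in> ZR n \<Longrightarrow> w \<in> BR n \<Longrightarrow> r1 n (z + w) = r1 n z + r1 n w"
    and r2_add: "\<And>n z w. z \<in> ZR n \<Longrightarrow> w \<in> BR n \<Longrightarrow> r2 n (z + w) = r2 n z + r2 n w"
    and s1_add: "\<And>n z w. z \<in> Z1 n \<Longrightarrow> w \<in> B1 n \<Longrightarrow> s1 n (z + w) = s1 n z + s1 n w"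
    and s2_add: "\<And>n z w. z \<in> Z2 n \<Longrightarrow> w \<in> B2 n \<Longrightarrow> s2 n (z + w) = s2 n z + s2 n w"
    and r1: "\<And>n. linear_on (ZR n) scale (Z1 n) scale (r1 n)" "\<And>n. r1 n ` BR n \<subseteq> B1 n"
    and r2: "\<And>n. linear_on (ZR n) scale (Z2 n) scale (r2 n)" "\<And>n. r2 n ` BR n \<subseteq> B2 n"
    and s1: "\<And>n. linear_on (Z1 n) scale (ZC n) scale (s1 n)" "\<And>n. s1 n ` B1 n \<subseteq> BC n"
    and s2: "\<And>n. linear_on (Z2 n) scale (ZC n) scale (s2 n)" "\<And>n. s2 n ` B2 n \<subseteq> BC n"
    and comm: "\<And>n z. z \<in> ZR n \<Longrightarrow> s1 n (r1 n z) = s2 n (r2 n z)"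
    and inj: "\<And>n z. z \<in> ZR n \<Longrightarrow> r1 n z \<in> B1 n \<Longrightarrow> r2 n z \<in> B2 n \<Longrightarrow> z \<in> BR n"
    and glue: "\<And>n y w. y \<in> Z1 n \<Longrightarrow> w \<in> Z2 n \<Longrightarrow> s1 n y - s2 n w \<in> BC n \<Longrightarrow>
                 \<exists>z\<in>ZR n. r1 n z - y \<in> B1 n \<and> r2 n z - w \<in> B2 n"
    and surj: "\<And>n x. x \<in> ZC n \<Longrightarrow> \<exists>y\<in>Z1 n. s1 n y - x \<in> BC n"
  defines "HR n \<equiv> quot_space (ZR n) (BR n)" and "H1 n \<equiv> quot_space (Z1 n) (B1 n)"
    and "H2 n \<equiv> quot_space (Z2 n) (B2 n)" and "HC' n \<equiv> quot_space (ZC n) (BC n)"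
  defines "tR n \<equiv> quot_scale scale (BR n)" and "t1 n \<equiv> quot_scale scale (B1 n)"
    and "t2 n \<equiv> quot_scale scale (B2 n)" and "tC n \<equiv> quot_scale scale (BC n)"
  shows "\<exists>f g \<delta>.
    (\<forall>n. linear_on (HR n) (tR n) (H1 n \<times> H2 n) (pair_scale (t1 n) (t2 n)) (f n)) \<and>
    (\<forall>n. linear_on (H1 n \<times> H2 n) (pair_scale (t1 n) (t2 n)) (HC' n) (tC n) (g n)) \<and>
    (\<forall>n. linear_on (HC' n) (tC n) (HR (n + 1)) (tR (n + 1)) (\<delta> n)) \<and>
    inj_on (f 0) (HR 0) \<and>
    (\<forall>n. f n ` HR n = {z \<in> H1 n \<times> H2 n. g n z = BC n}) \<and>
    (\<forall>n. g n ` (H1 n \<times> H2 n) = {z \<in> HC' n. \<delta> n z = BR (n + 1)}) \<and>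
    (\<forall>n. \<delta> n ` HC' n = {z \<in> HR (n + 1). f (n + 1) z = (B1 (n + 1), B2 (n + 1))})"
proof -
  note H_defs = HR_def H1_def H2_def HC'_def tR_def t1_def t2_def tC_def quot_space_def
  define f where "f n X = (quot_map (B1 n) (r1 n) X, quot_map (B2 n) (r2 n) X)" for n X
  define g where "g n Y = quot_map (BC n) (s1 n) (fst Y) + quot_scale scale (BC n) (- 1) (quot_map (BC n) (s2 n) (snd Y))"
    for n and Y :: "'b set \<times> 'b set"
  \<comment> \<open>\<open>BR (n + 1)\<close> is the zero element of the quotient, so the connecting
    map is the zero map.\<close>
  define \<delta> where "\<delta> n X = BR (n + 1)" for n :: nat and X :: "'b set"
  have fc: "f n (z +o BR n) = (r1 n z +o B1 n, r2 n z +o B2 n)" if "z \<in> ZR n" for n z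
    unfolding f_def using that
    by (simp add: quot_map_coset[OF BR B1 r1_add r1(2)] quot_map_coset[OF BR B2 r2_add r2(2)])
  have gc: "g n (y +o B1 n, w +o B2 n) = (s1 n y - s2 n w) +o BC n" if "y \<in> Z1 n" "w \<in> Z2 n" for n y w
  proof -
    have "quot_map (BC n) (s1 n) (y +o B1 n) = s1 n y +o BC n"
      using that by (intro quot_map_coset[OF B1 BC s1_add s1(2)])
    moreover have "quot_map (BC n) (s2 n) (w +o B2 n) = s2 n w +o BC n"
      using that by (intro quot_map_coset[OF B2 BC s2_add s2(2)])
    ultimately show ?thesis
      by (simp add: g_def quot_scale_coset[OF BC] coset_plus[OF BC])
  qed
  have linf: "linear_on (HR n) (tR n) (H1 n \<times> H2 n) (pair_scale (t1 n) (t2 n)) (f n)" for n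
  proof -
    have 1: "r1 n z \<in> Z1 n" "r2 n z \<in> Z2 n" if "z \<in> ZR n" for z
      using r1 r2 that by (auto simp: linear_on_def)
    have 2: "r1 n (z + z') = r1 n z + r1 n z'" "r2 n (z + z') = r2 n z + r2 n z'" "z + z' \<in> ZR n"
      if "z \<in> ZR n" "z' \<in> ZR n" for z z'
      using r1 r2 that subspace_add[OF ZR] by (auto simp: linear_on_def)
    have 3: "r1 n (c *s z) = c *s r1 n z" "r2 n (c *s z) = c *s r2 n z" "c *s z \<in> ZR n"
      if "z \<in> ZR n" for z c
      using r1 r2 that subspace_scale[OF ZR] by (auto simp: linear_on_def)
    show ?thesis
      by (auto simp: linear_on_def H_defs pair_scale_def fc 1 2 3 coset_plus BR B1 B2 quot_scale_coset)
  qed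
  have ling: "linear_on (H1 n \<times> H2 n) (pair_scale (t1 n) (t2 n)) (HC' n) (tC n) (g n)" for n
  proof -
    have 1: "s1 n y - s2 n w \<in> ZC n" if "y \<in> Z1 n" "w \<in> Z2 n" for y w
      using s1 s2 that subspace_diff[OF ZC] by (auto simp: linear_on_def)
    have 2: "s1 n (y + y') = s1 n y + s1 n y'" "y + y' \<in> Z1 n"
      if "y \<in> Z1 n" "y' \<in> Z1 n" for y y'
      using s1 that subspace_add[OF Z1] by (auto simp: linear_on_def)
    have 4: "s2 n (y + y') = s2 n y + s2 n y'" "y + y' \<in> Z2 n"
      if "y \<in> Z2 n" "y' \<in> Z2 n" for y y'
      using s2 that subspace_add[OF Z2] by (auto simp: linear_on_def)
    have 3: "s1 n (c *s z) = c *s s1 n z" "c *s z \<in> Z1 n" if "z \<in> Z1 n" for z c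
      using s1 that subspace_scale[OF Z1] by (auto simp: linear_on_def)
    have 5: "s2 n (c *s z) = c *s s2 n z" "c *s z \<in> Z2 n" if "z \<in> Z2 n" for z c
      using s2 that subspace_scale[OF Z2] by (auto simp: linear_on_def)
    show ?thesis
      by (auto simp: linear_on_def H_defs pair_scale_def gc 1 2 3 4 5 coset_plus BC B1 B2
          quot_scale_coset scale_right_diff_distrib algebra_simps)
  qed
  have lind: "linear_on (HC' n) (tC n) (HR (n + 1)) (tR (n + 1)) (\<delta> n)" for n
    unfolding \<delta>_def HR_def tR_def
  proof (rule linear_on_zero[OF BR ZR])
    show "x + y \<in> HC' n" if "x \<in> HC' n" "y \<in> HC' n" for x y
      using that subspace_add[OF ZC] by (auto simp: H_defs coset_plus[OF BC])
  qed
  have zero: "B \<in> quot_space Z B" if "subspace Z" for Z B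
    unfolding quot_space_def using subspace_0[OF that] by (metis image_eqI set_zero_plus)
  have ker: "X = BR n" if "X \<in> HR n" "f n X = (B1 n, B2 n)" for n X
  proof -
    obtain z where z: "z \<in> ZR n" "X = z +o BR n"
      using \<open>X \<in> HR n\<close> by (auto simp: H_defs)
    then have "r1 n z \<in> B1 n" "r2 n z \<in> B2 n"
      using that(2) by (auto simp: fc coset_eq_self_iff B1 B2)
    then show ?thesis
      using inj z coset_eq_self_iff[OF BR] by blast
  qed
  have f0: "f n (BR n) = (B1 n, B2 n)" for n
  proof -
    have "r1 n 0 \<in> B1 n" "r2 n 0 \<in> B2 n"
      using r1(2)[of n] r2(2)[of n] subspace_0[OF BR, of n] by blast+
    then show ?thesis
      using fc[OF subspace_0[OF ZR], of n] by (simp add: coset_eq_self_iff B1 B2)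
  qed
  have injf: "inj_on (f n) (HR n)" for n
  proof (rule inj_onI)
    fix X Y assume *: "X \<in> HR n" "Y \<in> HR n" "f n X = f n Y"
    obtain z z' where z: "z \<in> ZR n" "X = z +o BR n" "z' \<in> ZR n" "Y = z' +o BR n"
      using * by (auto simp: H_defs)
    have d: "z - z' \<in> ZR n"
      using z subspace_diff[OF ZR] by blast
    have r: "r1 n (z - z') = r1 n z - r1 n z'" "r2 n (z - z') = r2 n z - r2 n z'"
      using linear_on_diff[OF r1(1)] linear_on_diff[OF r2(1)] z d by blast+
    have "r1 n z - r1 n z' \<in> B1 n" "r2 n z - r2 n z' \<in> B2 n"
      using *(3) z by (auto simp: fc coset_eq_iff B1 B2)
    then have "z - z' \<in> BR n"
      using inj[OF d] r by simp
    then show "X = Y"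
      using z coset_eq_iff[OF BR] by simp
  qed
  have imf: "f n ` HR n = {z \<in> H1 n \<times> H2 n. g n z = BC n}" for n
  proof (intro equalityI subsetI)
    fix Y assume "Y \<in> f n ` HR n"
    then obtain z where z: "z \<in> ZR n" "Y = f n (z +o BR n)"
      by (auto simp: H_defs)
    have r: "r1 n z \<in> Z1 n" "r2 n z \<in> Z2 n"
      using r1 r2 z by (auto simp: linear_on_def)
    then show "Y \<in> {z \<in> H1 n \<times> H2 n. g n z = BC n}"
      using z comm[of z n] by (auto simp: fc gc H_defs)
  next
    fix Y assume "Y \<in> {z \<in> H1 n \<times> H2 n. g n z = BC n}"
    then obtain y w where y: "y \<in> Z1 n" "w \<in> Z2 n" "Y = (y +o B1 n, w +o B2 n)" "g n Y = BC n"
      by (auto simp: H_defs)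
    then have "s1 n y - s2 n w \<in> BC n"
      by (auto simp: gc coset_eq_self_iff BC)
    then obtain z where "z \<in> ZR n" "r1 n z - y \<in> B1 n" "r2 n z - w \<in> B2 n"
      using glue y by blast
    then have "f n (z +o BR n) = Y" "z +o BR n \<in> HR n"
      using y by (auto simp: fc coset_eq_iff B1 B2 H_defs)
    then show "Y \<in> f n ` HR n"
      by blast
  qed
  have img: "g n ` (H1 n \<times> H2 n) = HC' n" for n
  proof
    show "g n ` (H1 n \<times> H2 n) \<subseteq> HC' n"
      using ling[of n] by (auto simp: linear_on_def)
    show "HC' n \<subseteq> g n ` (H1 n \<times> H2 n)"
    proof
      fix X assume "X \<in> HC' n"
      then obtain x where x: "x \<in> ZC n" "X = x +o BC n"
        by (auto simp: H_defs)
      obtain y where y: "y \<in> Z1 n" "s1 n y - x \<in> BC n"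
        using surj x by blast
      have "s2 n 0 \<in> BC n"
        using s2(2)[of n] subspace_0[OF B2, of n] by blast
      then have "(s1 n y - s2 n 0) - x \<in> BC n"
        using subspace_diff[OF BC, OF y(2), of "s2 n 0"] by (simp add: algebra_simps)
      then have "g n (y +o B1 n, 0 +o B2 n) = X"
        using y x subspace_0[OF Z2] by (simp only: gc coset_eq_iff[OF BC])
      moreover have "(y +o B1 n, 0 +o B2 n) \<in> H1 n \<times> H2 n"
        using y subspace_0[OF Z2] unfolding H_defs by blast
      ultimately show "X \<in> g n ` (H1 n \<times> H2 n)"
        by blast
    qed
  qed
  have HCne: "HC' n \<noteq> {}" for n
    using zero[OF ZC] by (auto simp: HC'_def)
  have "\<delta> n ` HC' n = {BR (n + 1)}" for n
    using HCne by (auto simp: \<delta>_def)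
  moreover have "{z \<in> HR (n + 1). f (n + 1) z = (B1 (n + 1), B2 (n + 1))} = {BR (n + 1)}" for n
    using ker f0 zero[OF ZR] by (auto simp: HR_def)
  ultimately show ?thesis
    using linf ling lind injf imf img
    by (intro exI[of _ f] exI[of _ g] exI[of _ \<delta>]) (simp add: \<delta>_def)
qed

end

section \<open>The identities of a cyclic module, on words\<close>

section \<open>Faces and rotations of words\<close>

definition words :: "'a set \<Rightarrow> nat \<Rightarrow> 'a list set" where
  "words A m = {rs. length rs = m \<and> set rs \<subseteq> A}"

lemma words_nth: "rs \<in> words A m \<longleftrightarrow> length rs = m \<and> (\<forall>k<m. rs ! k \<in> A)"
  by (auto simp: words_def set_conv_nth)

lemma length_words: "rs \<in> words A m \<Longrightarrow> length rs = m"
  by (simp add: words_def)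

lemma list_update_words: "rs \<in> words A m \<Longrightarrow> x \<in> A \<Longrightarrow> rs[k := x] \<in> words A m"
  by (auto simp: words_def dest!: set_update_subset_insert[THEN subsetD])

lemma map_words: "rs \<in> words A m \<Longrightarrow> (\<And>x. x \<in> A \<Longrightarrow> f x \<in> B) \<Longrightarrow> map f rs \<in> words B m"
  by (auto simp: words_def)

text \<open>The last face, the one with \<open>Suc j = length rs\<close>, is the cyclic one.\<close>

definition face :: "nat \<Rightarrow> 'a::times list \<Rightarrow> 'a list" where
  "face j rs = map (\<lambda>k.
     if Suc j = length rs then (if k = 0 then rs ! j * rs ! 0 else rs ! k)
     else if k < j then rs ! k else if k = j then rs ! j * rs ! Suc j else rs ! Suc k) [0..<length rs - 1]"

definition rot :: "'a list \<Rightarrow> 'a list" where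
  "rot rs = last rs # butlast rs"

lemma length_face [simp]: "length (face j rs) = length rs - 1"
  by (simp add: face_def)

lemma length_rot: "rs \<noteq> [] \<Longrightarrow> length (rot rs) = length rs"
  by (simp add: rot_def)

lemma rot_nth:
  assumes "k < length rs"
  shows "rot rs ! k = (if k = 0 then rs ! (length rs - 1) else rs ! (k - 1))"
  using assms unfolding rot_def
  by (cases "rs = []") (auto simp: nth_Cons' last_conv_nth nth_butlast)

lemma inner_face_eq:
  assumes "Suc j < length rs"
  shows "take j rs @ (rs ! j * rs ! Suc j) # drop (j + 2) rs = face j rs"
  using assms by (intro nth_equalityI) (auto simp: face_def nth_append nth_Cons')

lemma cyclic_face_eq:
  assumes "2 \<le> length rs"
  shows "(last rs * hd rs) # butlast (tl rs) = face (length rs - 1) rs"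
proof (rule nth_equalityI)
  show "((last rs * hd rs) # butlast (tl rs)) ! k = face (length rs - 1) rs ! k"
    if "k < length ((last rs * hd rs) # butlast (tl rs))" for k
    using assms that by (cases rs) (auto simp: face_def nth_Cons' nth_butlast last_conv_nth)
qed (use assms in \<open>auto simp: face_def\<close>)

lemma face_nth:
  "k < length rs - 1 \<Longrightarrow> face j rs ! k =
     (if Suc j = length rs then (if k = 0 then rs ! j * rs ! 0 else rs ! k)
      else if k < j then rs ! k else if k = j then rs ! j * rs ! Suc j else rs ! Suc k)"
  unfolding face_def by (subst nth_map) (auto simp del: upt_Suc)

text \<open>The presimplicial identity, with the cyclic face included. Associativity enters exactly
  where both faces touch a common letter.\<close>

lemma face_face:
  fixes rs :: "'a::semigroup_mult list"
  assumes "i < j" "j < length rs"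
  shows "face i (face j rs) = face (j - 1) (face i rs)"
proof (rule nth_equalityI)
  fix k assume k: "k < length (face i (face j rs))"
  obtain j' where j: "j = Suc j'"
    using assms by (cases j) auto
  show "face i (face j rs) ! k = face (j - 1) (face i rs) ! k"
  proof (cases "Suc j = length rs")
    case True
    then have "length rs = Suc (Suc j')"
      using j by simp
    moreover from this k have "k < j'"
      by simp
    ultimately show ?thesis
      using assms j by (cases "i = j'"; cases "k = 0"; cases "i = 0"; simp add: face_nth mult.assoc)
  next
    case False
    then obtain l where "length rs = Suc (Suc (Suc (j' + l)))"
      using assms j by (metis Suc_lessI add_Suc less_iff_Suc_add)
    moreover from this k have "k < Suc (j' + l)"
      by simp
    ultimately show ?thesis
      using assms j
      by (cases k i rule: linorder_cases; cases k j' rule: linorder_cases; cases "i = j'"; simp add: face_nth mult.assoc)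
  qed
qed simp

text \<open>Together with \<open>face_0_rot\<close> these are the cyclic identities, still without
  signs.\<close>

lemma face_rot:
  assumes "1 \<le> j" "j < length rs"
  shows "face j (rot rs) = rot (face (j - 1) rs)"
proof (rule nth_equalityI)
  obtain i where i: "j = Suc i"
    using assms by (cases j) auto
  obtain l where l: "length rs = Suc (Suc (i + l))"
    using assms i by (metis add_Suc less_iff_Suc_add)
  have lens: "length (rot rs) = length rs" "length (rot (face i rs)) = Suc (i + l)"
    using l by (auto simp: length_rot simp flip: length_greater_0_conv)
  show "length (face j (rot rs)) = length (rot (face (j - 1) rs))"
    using lens l i by simp
  fix k assume "k < length (face j (rot rs))"
  then have k: "k < Suc (i + l)"
    using lens l by simp
  show "face j (rot rs) ! k = rot (face (j - 1) rs) ! k"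
    using k l lens i
    by (cases k; cases "l = 0"; cases k j rule: linorder_cases; simp add: face_nth rot_nth)
qed

lemma face_0_rot:
  assumes "2 \<le> length rs"
  shows "face 0 (rot rs) = face (length rs - 1) rs"
proof (rule nth_equalityI)
  obtain l where l: "length rs = Suc (Suc l)"
    using assms by (metis add_2_eq_Suc le_Suc_ex)
  have lens: "length (rot rs) = length rs"
    using l by (auto simp: length_rot simp flip: length_greater_0_conv)
  show "length (face 0 (rot rs)) = length (face (length rs - 1) rs)"
    using lens by simp
  fix k assume "k < length (face 0 (rot rs))"
  then have "k < Suc l"
    using lens l by simp
  then show "face 0 (rot rs) ! k = face (length rs - 1) rs ! k"
    using l lens by (cases k; simp add: face_nth rot_nth)
qed

lemma length_funpow_rot: "rs \<noteq> [] \<Longrightarrow> length ((rot ^^ i) rs) = length rs"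
proof (induction i)
  case (Suc i)
  then have "(rot ^^ i) rs \<noteq> []"
    by auto
  then show ?case
    using Suc by (simp add: length_rot)
qed simp

text \<open>\<open>rot\<close> moves the last letter to the front and so inverts
  \<open>rotate1\<close>; this transfers the known period of \<open>rotate\<close> to
  \<open>rot\<close>.\<close>

lemma rotate_funpow_rot: "rs \<noteq> [] \<Longrightarrow> rotate i ((rot ^^ i) rs) = rs"
proof (induction i arbitrary: rs)
  case (Suc i)
  have "rotate (Suc i) ((rot ^^ Suc i) rs) = rotate1 (rotate i ((rot ^^ i) (rot rs)))"
    by (simp only: rotate_Suc funpow_Suc_right o_apply)
  also have "\<dots> = rotate1 (rot rs)"
    using Suc.IH[of "rot rs"] by (metis list.distinct(1) rot_def)
  also have "\<dots> = rs"
    using Suc.prems by (simp add: rot_def)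
  finally show ?case .
qed simp

lemma funpow_rot_length: "rs \<noteq> [] \<Longrightarrow> (rot ^^ length rs) rs = rs"
  using rotate_funpow_rot[of rs "length rs"] length_funpow_rot[of rs "length rs"] rotate_id by fastforce

lemma face_words:
  assumes "rs \<in> words A (Suc m)" and "\<And>x y. x \<in> A \<Longrightarrow> y \<in> A \<Longrightarrow> x * y \<in> A" and "j < Suc m"
  shows "face j rs \<in> words A m"
  using assms by (auto simp: words_nth face_nth)

lemma rot_words: "rs \<in> words A m \<Longrightarrow> 0 < m \<Longrightarrow> rot rs \<in> words A m"
  by (cases rs rule: rev_cases) (auto simp: words_def rot_def)

lemma map_face:
  assumes "rs \<in> words A m" "\<And>x y. x \<in> A \<Longrightarrow> y \<in> A \<Longrightarrow> f (x * y) = f x * f y" "j < m" "2 \<le> m"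
  shows "map f (face j rs) = face j (map f rs)"
proof (rule nth_equalityI)
  fix k assume "k < length (map f (face j rs))"
  then show "map f (face j rs) ! k = face j (map f rs) ! k"
    using assms by (simp add: face_nth words_nth)
qed simp

lemma map_rot: "rs \<noteq> [] \<Longrightarrow> map f (rot rs) = rot (map f rs)"
  by (simp add: rot_def last_map map_butlast)

section \<open>The cyclic operators on cochains\<close>

definition bprime_dual :: "('a::times list \<Rightarrow> 'k::comm_ring_1) \<Rightarrow> 'a list \<Rightarrow> 'k" where
  "bprime_dual \<phi> rs = (\<Sum>j<length rs - 1. (- 1) ^ j * \<phi> (face j rs))"

definition b_dual :: "('a::times list \<Rightarrow> 'k::comm_ring_1) \<Rightarrow> 'a list \<Rightarrow> 'k" where
  "b_dual \<phi> rs = (\<Sum>j<length rs. (- 1) ^ j * \<phi> (face j rs))"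

definition t_dual :: "('a list \<Rightarrow> 'k::comm_ring_1) \<Rightarrow> 'a list \<Rightarrow> 'k" where
  "t_dual \<phi> rs = (- 1) ^ (length rs - 1) * \<phi> (rot rs)"

definition N_dual :: "('a list \<Rightarrow> 'k::comm_ring_1) \<Rightarrow> 'a list \<Rightarrow> 'k" where
  "N_dual \<phi> rs = (\<Sum>i<length rs. (t_dual ^^ i) \<phi> rs)"

text \<open>With the sign absorbed, the faces become conjugates of the zeroth one under powers of
  \<open>t_dual\<close>, and no further signs appear.\<close>

definition signed_face :: "nat \<Rightarrow> ('a::times list \<Rightarrow> 'k::comm_ring_1) \<Rightarrow> 'a list \<Rightarrow> 'k" where
  "signed_face j \<phi> rs = (- 1) ^ j * \<phi> (face j rs)"

lemma funpow_t_dual: "rs \<noteq> [] \<Longrightarrow> (t_dual ^^ i) \<phi> rs = (- 1) ^ ((length rs - 1) * i) * \<phi> ((rot ^^ i) rs)"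
proof (induction i arbitrary: rs)
  case (Suc i)
  have "rot rs \<noteq> []"
    by (simp add: rot_def)
  then have "(t_dual ^^ Suc i) \<phi> rs
      = (- 1) ^ (length rs - 1) * ((- 1) ^ ((length rs - 1) * i) * \<phi> ((rot ^^ i) (rot rs)))"
    using Suc.IH[of "rot rs"] unfolding funpow.simps(2) o_apply t_dual_def[of "(t_dual ^^ i) \<phi>"]
    by (simp add: length_rot[OF Suc.prems])
  then show ?case
    unfolding funpow_Suc_right o_apply by (simp add: power_add mult.assoc)
qed simp

lemma funpow_t_dual_length: "rs \<noteq> [] \<Longrightarrow> (t_dual ^^ length rs) \<phi> rs = \<phi> rs"
proof -
  have "even ((n - 1) * n)" for n :: nat
    by (cases n) auto
  then show "rs \<noteq> [] \<Longrightarrow> (t_dual ^^ length rs) \<phi> rs = \<phi> rs"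
    by (simp add: funpow_t_dual funpow_rot_length)
qed

text \<open>Lowering \<open>j\<close> by one changes the sign. On the right \<open>t_dual\<close>
  acts on the face, which is one letter shorter, and this changes the sign back.\<close>

lemma t_dual_signed_face:
  assumes "1 \<le> j" "j < length rs"
  shows "t_dual (signed_face j \<phi>) rs = signed_face (j - 1) (t_dual \<phi>) rs"
proof -
  obtain n where "length rs = n + 2"
    using assms by (metis add.commute le_Suc_ex less_eq_Suc_le one_add_one order_le_less_trans plus_1_eq_Suc)
  then show ?thesis
    using assms by (cases j) (auto simp: t_dual_def signed_face_def face_rot)
qed

lemma t_dual_signed_face_0:
  assumes "2 \<le> length rs"
  shows "t_dual (signed_face 0 \<phi>) rs = signed_face (length rs - 1) \<phi> rs"
  using assms by (simp add: t_dual_def signed_face_def face_0_rot)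

text \<open>This is (1 - t) b = b' (1 - t) for cochains. Applying t turns d_0 into the cyclic face,
  which is b - b', and every other d_j into d_{j-1} t.\<close>

lemma t_dual_b_dual:
  assumes "2 \<le> length rs"
  shows "t_dual (b_dual \<phi>) rs = b_dual \<phi> rs - bprime_dual \<phi> rs + bprime_dual (t_dual \<phi>) rs"
proof -
  obtain n where n: "length rs = Suc (Suc n)"
    using assms by (metis add_2_eq_Suc le_Suc_ex)
  then have "rs \<noteq> []"
    by auto
  then have "t_dual (b_dual \<phi>) rs = (\<Sum>j<Suc (Suc n). t_dual (signed_face j \<phi>) rs)"
    unfolding t_dual_def b_dual_def signed_face_def length_rot[OF \<open>rs \<noteq> []\<close>] n
    by (simp only: sum_distrib_left)
  also have "\<dots> = signed_face (Suc n) \<phi> rs + (\<Sum>j<Suc n. signed_face j (t_dual \<phi>) rs)"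
    unfolding sum.lessThan_Suc_shift[of _ "Suc n"]
    using n assms by (simp add: t_dual_signed_face_0 t_dual_signed_face del: sum.lessThan_Suc)
  finally show ?thesis
    by (simp add: b_dual_def bprime_dual_def signed_face_def n)
qed

lemma sum_periodic_shift:
  fixes f :: "nat \<Rightarrow> 'b::ab_group_add"
  assumes "\<And>i. f (i + n) = f i"
  shows "(\<Sum>i<n. f (i + s)) = (\<Sum>i<n. f i)"
proof (induction s)
  case (Suc s)
  have "(\<Sum>i<n. f (i + Suc s)) + f s = (\<Sum>i<Suc n. f (i + s))"
    unfolding sum.lessThan_Suc_shift by (simp add: add.commute)
  also have "\<dots> = (\<Sum>i<n. f (i + s)) + f s"
    using assms[of s] by (simp add: add.commute)
  finally show ?case
    using Suc by simp
qed simp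

lemma funpow_t_dual_cong:
  assumes "rs \<noteq> []" and "\<And>ss. length ss = length rs \<Longrightarrow> \<phi> ss = \<psi> ss"
  shows "(t_dual ^^ i) \<phi> rs = (t_dual ^^ i) \<psi> rs"
  using assms by (simp add: funpow_t_dual length_funpow_rot)

lemma funpow_t_dual_signed_face:
  assumes "i \<le> j" "j < length rs"
  shows "(t_dual ^^ i) (signed_face j \<phi>) rs = signed_face (j - i) ((t_dual ^^ i) \<phi>) rs"
  using assms
proof (induction i arbitrary: rs)
  case (Suc i)
  have ne: "rs \<noteq> []"
    using Suc.prems by auto
  have "(t_dual ^^ Suc i) (signed_face j \<phi>) rs = t_dual (signed_face (j - i) ((t_dual ^^ i) \<phi>)) rs"
    using Suc.prems Suc.IH[of "rot rs"] length_rot[OF ne] by (simp add: t_dual_def[of _ rs])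
  also have "1 \<le> j - i" and "j - i < length rs"
    using Suc.prems by auto
  then have "t_dual (signed_face (j - i) ((t_dual ^^ i) \<phi>)) rs = signed_face (j - i - 1) ((t_dual ^^ Suc i) \<phi>) rs"
    by (simp add: t_dual_signed_face)
  finally show ?case
    by simp
qed simp

text \<open>Both sides equal \<open>N \<circ> d\<^sub>0 \<circ> N\<close>, because the signed faces are the conjugates of \<open>d\<^sub>0\<close>
  by the powers of \<open>t\<close>.\<close>

lemma b_dual_N_dual:
  assumes "2 \<le> length rs"
  shows "b_dual (N_dual \<phi>) rs = N_dual (bprime_dual \<phi>) rs"
proof -
  obtain n where n: "length rs = Suc n" "0 < n"
    using assms by (cases "length rs") auto
  have ne: "rs \<noteq> []"
    using n by auto
  \<comment> \<open>\<open>X a c\<close> is t^a d_0 t^c. It has period n + 1 in a, where t acts on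
    words of length n + 1, and period n in c, where t acts on their faces. Both sides of the claim
    are the sum of X over a full period in each variable; what follows shifts and reflects the
    indices.\<close>
  define X where "X a c = (t_dual ^^ a) (signed_face 0 ((t_dual ^^ c) \<phi>)) rs" for a c
  have signed_face_X: "signed_face j \<psi> rs = (t_dual ^^ (Suc n - j)) (signed_face 0 ((t_dual ^^ j) \<psi>)) rs"
    if "j < Suc n" for j and \<psi> :: "'a list \<Rightarrow> 'b"
  proof -
    have "(t_dual ^^ (Suc n - j)) (signed_face 0 ((t_dual ^^ j) \<psi>)) rs
        = (t_dual ^^ (Suc n - j)) ((t_dual ^^ j) (signed_face j \<psi>)) rs"
      using that n by (intro funpow_t_dual_cong[OF ne]) (simp add: funpow_t_dual_signed_face)
    also have "\<dots> = (t_dual ^^ length rs) (signed_face j \<psi>) rs"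
      using that n by (simp only: funpow_add[THEN fun_cong, unfolded o_apply, symmetric]) simp
    finally show ?thesis
      using funpow_t_dual_length[OF ne] by metis
  qed
  have periodic1: "X (a + Suc n) c = X a c" for a c
    using funpow_t_dual_length[OF ne] n by (simp only: X_def add.commute[of a] funpow_add o_apply) simp
  have periodic2: "X a (c + n) = X a c" for a c
    unfolding X_def
  proof (rule funpow_t_dual_cong[OF ne])
    fix ss :: "'a list" assume ss: "length ss = length rs"
    then have "face 0 ss \<noteq> []" "length (face 0 ss) = n"
      using n by (auto simp flip: length_greater_0_conv)
    then show "signed_face 0 ((t_dual ^^ (c + n)) \<phi>) ss = signed_face 0 ((t_dual ^^ c) \<phi>) ss"
      using funpow_t_dual_length[of "face 0 ss"]
      by (simp only: signed_face_def add.commute[of c] funpow_add o_apply) simp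
  qed
  have face_ne: "length (face j rs) = n" for j
    using n by simp
  have "b_dual (N_dual \<phi>) rs = (\<Sum>j<Suc n. \<Sum>i<n. signed_face j ((t_dual ^^ i) \<phi>) rs)"
    by (simp only: b_dual_def N_dual_def face_ne signed_face_def sum_distrib_left n)
  also have "\<dots> = (\<Sum>j<Suc n. \<Sum>i<n. X (Suc n - j) (i + j))"
    using signed_face_X by (intro sum.cong) (auto simp: X_def funpow_add add.commute[of _ j for j])
  also have "\<dots> = (\<Sum>j<Suc n. \<Sum>i<n. X (Suc n - j) i)"
    using sum_periodic_shift[where n = n and f = "X a" for a, OF periodic2] by simp
  also have "\<dots> = (\<Sum>j<Suc n. \<Sum>i<n. X (j + 1) i)"
    by (subst sum.nat_diff_reindex[symmetric]) (auto intro!: sum.cong)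
  also have "\<dots> = (\<Sum>i<n. \<Sum>j<Suc n. X (j + 1) i)"
    by (rule sum.swap)
  also have "\<dots> = (\<Sum>i<n. \<Sum>j<Suc n. X j i)"
    using sum_periodic_shift[where n = "Suc n" and s = 1 and f = "\<lambda>a. X a c" for c, OF periodic1] by simp
  also have "\<dots> = (\<Sum>i<n. \<Sum>j<Suc n. X (j + (Suc n - i)) i)"
    by (simp only: sum_periodic_shift[where n = "Suc n" and f = "\<lambda>a. X a c" for c, OF periodic1])
  also have "\<dots> = (\<Sum>i<n. \<Sum>j<Suc n. (t_dual ^^ j) (signed_face i \<phi>) rs)"
  proof (intro sum.cong refl)
    fix i j assume "i \<in> {..<n}"
    then have i: "i < Suc n"
      by simp
    have "(t_dual ^^ j) (signed_face i \<phi>) rs = (t_dual ^^ (Suc n + j)) (signed_face i \<phi>) rs"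
      by (simp only: funpow_add o_apply n(1)[symmetric] funpow_t_dual_length[OF ne])
    also have "\<dots> = (t_dual ^^ (j + (Suc n - i) + i)) (signed_face i \<phi>) rs"
      using i by (simp add: add.commute)
    also have "\<dots> = (t_dual ^^ (j + (Suc n - i))) ((t_dual ^^ i) (signed_face i \<phi>)) rs"
      by (simp only: funpow_add o_apply)
    also have "\<dots> = X (j + (Suc n - i)) i"
      unfolding X_def using i n
      by (intro funpow_t_dual_cong[OF ne]) (simp add: funpow_t_dual_signed_face)
    finally show "X (j + (Suc n - i)) i = (t_dual ^^ j) (signed_face i \<phi>) rs" ..
  qed
  also have "\<dots> = (\<Sum>j<Suc n. \<Sum>i<n. (t_dual ^^ j) (signed_face i \<phi>) rs)"
    by (rule sum.swap)
  also have "\<dots> = N_dual (bprime_dual \<phi>) rs"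
    unfolding N_dual_def n
    by (intro sum.cong refl)
      (simp add: funpow_t_dual[OF ne] bprime_dual_def length_funpow_rot[OF ne] n sum_distrib_left signed_face_def)
  finally show ?thesis .
qed

text \<open>The power of t by the word length is 1, so another t merely permutes the summands of N.
  Together with \<open>t_dual_N_dual\<close> this gives N (1 - t) = 0 = (1 - t) N.\<close>

lemma N_dual_t_dual:
  assumes "rs \<noteq> []"
  shows "N_dual (t_dual \<phi>) rs = N_dual \<phi> rs"
proof -
  have "(t_dual ^^ (i + length rs)) \<phi> rs = (t_dual ^^ i) \<phi> rs" for i
    using funpow_t_dual_length[OF assms] by (simp only: add.commute[of i] funpow_add o_apply)
  from sum_periodic_shift[where f = "\<lambda>i. (t_dual ^^ i) \<phi> rs", OF this, of 1] show ?thesis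
    by (simp add: N_dual_def funpow_swap1)
qed

lemma t_dual_N_dual:
  assumes "rs \<noteq> []"
  shows "t_dual (N_dual \<phi>) rs = N_dual \<phi> rs"
proof -
  have "(t_dual ^^ (i + length rs)) \<phi> rs = (t_dual ^^ i) \<phi> rs" for i
    using funpow_t_dual_length[OF assms] by (simp only: add.commute[of i] funpow_add o_apply)
  from sum_periodic_shift[where f = "\<lambda>i. (t_dual ^^ i) \<phi> rs", OF this, of 1] show ?thesis
    by (simp add: N_dual_def t_dual_def length_rot[OF assms] sum_distrib_left)
qed

section \<open>Cancellation in sums over faces: b b = 0 and simplicial homotopies\<close>

section \<open>Alternating double sums\<close>

text \<open>The pair (j, i) with j \<le> i is matched with (i + 1, j), which carries the same value
  with the opposite sign.\<close>

lemma alternating_faces_cancel: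
  fixes T :: "nat \<Rightarrow> nat \<Rightarrow> 'b::comm_ring_1"
  assumes "\<And>i j. i < j \<Longrightarrow> j \<le> m \<Longrightarrow> T i j = T (j - 1) i"
  shows "(\<Sum>j<Suc m. \<Sum>i<m. (- 1) ^ (i + j) * T i j) = 0"
proof -
  let ?f = "\<lambda>(j, i). (- 1) ^ (i + j) * T i j"
  let ?U = "{(j, i). i < j \<and> j < Suc m}" and ?L = "{(j, i). j \<le> i \<and> i < m}"
  have fin: "finite ?U" "finite ?L"
    by (rule finite_subset[of _ "{..<Suc m} \<times> {..<Suc m}"]; auto)+
  have "(\<Sum>j<Suc m. \<Sum>i<m. (- 1) ^ (i + j) * T i j) = sum ?f ({..<Suc m} \<times> {..<m})"
    by (simp only: sum.cartesian_product)
  also have "{..<Suc m} \<times> {..<m} = ?U \<union> ?L"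
    by auto
  also have "sum ?f (?U \<union> ?L) = sum ?f ?U + sum ?f ?L"
    using fin by (intro sum.union_disjoint) auto
  also have "?U = (\<lambda>(j, i). (Suc i, j)) ` ?L"
    by (auto simp: image_iff less_Suc_eq_le elim!: less_natE)
  also have "sum ?f \<dots> = sum (\<lambda>(j, i). - ((- 1) ^ (i + j) * T i j)) ?L"
    using assms by (subst sum.reindex) (auto simp: inj_on_def add.commute intro!: sum.cong)
  also have "\<dots> = - sum ?f ?L"
    unfolding sum_negf[symmetric] by (intro sum.cong) auto
  finally show ?thesis
    by simp
qed

text \<open>The cancellation behind a simplicial homotopy, with \<open>F j i\<close> in the role of \<open>d\<^sub>j h\<^sub>i\<close> and
  \<open>G i j\<close> in that of \<open>h\<^sub>i d\<^sub>j\<close>.\<close>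

lemma simplicial_homotopy_sum:
  fixes F G :: "nat \<Rightarrow> nat \<Rightarrow> 'b::comm_ring_1"
  assumes lower: "\<And>i j. j < i \<Longrightarrow> i \<le> n \<Longrightarrow> F j i = G (i - 1) j"
    and diag: "\<And>i. 1 \<le> i \<Longrightarrow> i \<le> n \<Longrightarrow> F i i = F i (i - 1)"
    and upper: "\<And>i j. Suc i < j \<Longrightarrow> j \<le> Suc n \<Longrightarrow> F j i = G i (j - 1)"
  shows "(\<Sum>i<Suc n. (- 1) ^ i * (\<Sum>j<Suc (Suc n). (- 1) ^ j * F j i))
       + (\<Sum>j<Suc n. (- 1) ^ j * (\<Sum>i<n. (- 1) ^ i * G i j)) = F 0 0 - F (Suc n) n"
proof -
  let ?f = "\<lambda>(i, j). (- 1) ^ i * ((- 1) ^ j * F j i)" and ?g = "\<lambda>(j, i). (- 1) ^ j * ((- 1) ^ i * G i j)"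
  \<comment> \<open>\<open>?L\<close> and \<open>?U\<close> cancel against the two halves
    \<open>?L'\<close> and \<open>?U'\<close> of the second sum. On the diagonal \<open>?D\<close>
    the sign is +, on the superdiagonal \<open>?E\<close> it is -, and there \<open>diag\<close>
    makes the sum telescope to its two end terms.\<close>
  let ?L = "{(i, j). j < i \<and> i < Suc n}" and ?D = "(\<lambda>i. (i, i)) ` {..<Suc n}"
    and ?E = "(\<lambda>i. (i, Suc i)) ` {..<Suc n}" and ?U = "{(i, j). Suc i < j \<and> j < Suc (Suc n)}"
  let ?L' = "{(j, i). j \<le> i \<and> i < n}" and ?U' = "{(j, i). i < j \<and> j < Suc n}"
  have fin: "finite ?L" "finite ?U" "finite ?L'" "finite ?U'"
    by (rule finite_subset[of _ "{..<Suc (Suc n)} \<times> {..<Suc (Suc n)}"]; auto)+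
  have telescope: "m \<le> n \<Longrightarrow> (\<Sum>i<Suc m. F i i - F (Suc i) i) = F 0 0 - F (Suc m) m" for m
    by (induction m) (auto simp: diag)
  have "(\<Sum>i<Suc n. (- 1) ^ i * (\<Sum>j<Suc (Suc n). (- 1) ^ j * F j i)) = sum ?f ({..<Suc n} \<times> {..<Suc (Suc n)})"
    by (simp only: sum_distrib_left sum.cartesian_product)
  also have "{..<Suc n} \<times> {..<Suc (Suc n)} = (?L \<union> ?U) \<union> (?D \<union> ?E)"
  proof (intro equalityI subsetI)
    fix z assume "z \<in> {..<Suc n} \<times> {..<Suc (Suc n)}"
    then show "z \<in> (?L \<union> ?U) \<union> (?D \<union> ?E)"
      by (cases z; cases "snd z < fst z"; cases "snd z = fst z"; cases "snd z = Suc (fst z)") auto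
  qed auto
  also have "sum ?f ((?L \<union> ?U) \<union> (?D \<union> ?E)) = sum ?f (?L \<union> ?U) + sum ?f (?D \<union> ?E)"
    using fin by (intro sum.union_disjoint) auto
  also have "sum ?f (?L \<union> ?U) = sum ?f ?L + sum ?f ?U"
    using fin by (intro sum.union_disjoint) auto
  also have "sum ?f (?D \<union> ?E) = sum ?f ?D + sum ?f ?E"
    by (intro sum.union_disjoint) auto
  also have "sum ?f ?D + sum ?f ?E = (\<Sum>i<Suc n. F i i - F (Suc i) i)"
    by (simp add: sum.reindex inj_on_def sum_subtractf sum_negf power_add[symmetric] mult.assoc[symmetric] del: sum.lessThan_Suc)
  also have "\<dots> = F 0 0 - F (Suc n) n"
    by (rule telescope) simp
  also have "?L = (\<lambda>(j, i). (Suc i, j)) ` ?L'"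
    by (auto simp: image_iff less_Suc_eq_le elim!: less_natE)
  also have "sum ?f \<dots> = sum (\<lambda>(j, i). - ((- 1) ^ j * ((- 1) ^ i * G i j))) ?L'"
    using lower by (subst sum.reindex) (auto simp: inj_on_def mult.left_commute intro!: sum.cong)
  also have "\<dots> = - sum ?g ?L'"
    unfolding sum_negf[symmetric] by (intro sum.cong) auto
  also have "?U = (\<lambda>(j, i). (i, Suc j)) ` ?U'"
    by (auto simp: image_iff less_Suc_eq_le elim!: less_natE)
  also have "sum ?f \<dots> = sum (\<lambda>(j, i). - ((- 1) ^ j * ((- 1) ^ i * G i j))) ?U'"
    using upper by (subst sum.reindex) (auto simp: inj_on_def mult.left_commute intro!: sum.cong)
  also have "\<dots> = - sum ?g ?U'"
    unfolding sum_negf[symmetric] by (intro sum.cong) auto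
  finally have 1: "(\<Sum>i<Suc n. (- 1) ^ i * (\<Sum>j<Suc (Suc n). (- 1) ^ j * F j i))
      = - sum ?g ?L' + - sum ?g ?U' + (F 0 0 - F (Suc n) n)" .
  have "(\<Sum>j<Suc n. (- 1) ^ j * (\<Sum>i<n. (- 1) ^ i * G i j)) = sum ?g ({..<Suc n} \<times> {..<n})"
    by (simp only: sum_distrib_left sum.cartesian_product)
  also have "{..<Suc n} \<times> {..<n} = ?L' \<union> ?U'"
    by auto
  also have "sum ?g (?L' \<union> ?U') = sum ?g ?L' + sum ?g ?U'"
    using fin by (intro sum.union_disjoint) auto
  finally show ?thesis
    using 1 by (simp add: algebra_simps)
qed

lemma b_dual_b_dual:
  fixes rs :: "'a::semigroup_mult list"
  shows "b_dual (b_dual \<phi>) rs = 0"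
proof (cases "length rs")
  case (Suc m)
  have "(\<Sum>j<Suc m. \<Sum>i<m. (- 1) ^ (i + j) * \<phi> (face i (face j rs))) = 0"
    using Suc by (intro alternating_faces_cancel) (auto simp: face_face)
  then show ?thesis
    using Suc by (simp add: b_dual_def sum_distrib_left power_add mult_ac)
qed (simp add: b_dual_def)

section \<open>Multilinear cochains\<close>

definition multilinear_on ::
    "('k::field \<Rightarrow> 'a::ring \<Rightarrow> 'a) \<Rightarrow> 'a set \<Rightarrow> nat \<Rightarrow> ('a list \<Rightarrow> 'k) \<Rightarrow> bool" where
  "multilinear_on scale A m \<phi> \<longleftrightarrow> (\<forall>rs\<in>words A m. \<forall>k<m.
     (\<forall>x\<in>A. \<forall>y\<in>A. \<phi> (rs[k := x + y]) = \<phi> (rs[k := x]) + \<phi> (rs[k := y])) \<and>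
     (\<forall>c. \<forall>x\<in>A. \<phi> (rs[k := scale c x]) = c * \<phi> (rs[k := x])))"

text \<open>Values off the words are normalised to 0, just as in \<open>dual_space\<close>, so that
  the passage to functionals on the tensor power is a bijection.\<close>

definition multilinear_maps ::
    "('k::field \<Rightarrow> 'a::ring \<Rightarrow> 'a) \<Rightarrow> 'a set \<Rightarrow> nat \<Rightarrow> ('a list \<Rightarrow> 'k) set" where
  "multilinear_maps scale A m = {\<phi>. multilinear_on scale A m \<phi> \<and> (\<forall>rs. rs \<notin> words A m \<longrightarrow> \<phi> rs = 0)}"

definition on_words :: "'a set \<Rightarrow> nat \<Rightarrow> ('a list \<Rightarrow> 'k::zero) \<Rightarrow> 'a list \<Rightarrow> 'k" where
  "on_words A m \<phi> rs = (if rs \<in> words A m then \<phi> rs else 0)"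

lemma on_words_apply [simp]: "rs \<in> words A m \<Longrightarrow> on_words A m \<phi> rs = \<phi> rs"
  by (simp add: on_words_def)

lemma multilinear_on_cong:
  assumes "\<And>rs. rs \<in> words A m \<Longrightarrow> \<phi> rs = \<psi> rs" "\<And>x y. x \<in> A \<Longrightarrow> y \<in> A \<Longrightarrow> x + y \<in> A"
    "\<And>c x. x \<in> A \<Longrightarrow> scale c x \<in> A"
  shows "multilinear_on scale A m \<phi> \<longleftrightarrow> multilinear_on scale A m \<psi>"
  unfolding multilinear_on_def using assms by (simp add: list_update_words cong: ball_cong)

lemma multilinear_on_cmult: "multilinear_on scale A m \<phi> \<Longrightarrow> multilinear_on scale A m (\<lambda>rs. a * \<phi> rs)"
  by (simp add: multilinear_on_def distrib_left mult.left_commute)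

lemma multilinear_on_add:
  "multilinear_on scale A m \<phi> \<Longrightarrow> multilinear_on scale A m \<psi> \<Longrightarrow> multilinear_on scale A m (\<lambda>rs. \<phi> rs + \<psi> rs)"
  by (simp add: multilinear_on_def algebra_simps)

lemma multilinear_on_uminus:
  "multilinear_on scale A m \<phi> \<Longrightarrow> multilinear_on scale A m (\<lambda>rs. - \<phi> rs)"
  using multilinear_on_cmult[of scale A m \<phi> "- 1"] by simp

lemma multilinear_on_diff:
  "multilinear_on scale A m \<phi> \<Longrightarrow> multilinear_on scale A m \<psi> \<Longrightarrow> multilinear_on scale A m (\<lambda>rs. \<phi> rs - \<psi> rs)"
  by (simp add: multilinear_on_def algebra_simps)

lemma multilinear_on_sum:
  "(\<And>i. i \<in> I \<Longrightarrow> multilinear_on scale A m (\<phi> i)) \<Longrightarrow> multilinear_on scale A m (\<lambda>rs. \<Sum>i\<in>I. \<phi> i rs)"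
  unfolding multilinear_on_def by (simp add: sum.distrib sum_distrib_left)

text \<open>Changing one letter of the input changes a single letter of the output, through a linear
  map that may depend on the other letters. Faces, rotations, letterwise maps and the insertions
  below are all of this kind, and precomposition with such an operation preserves
  multilinearity.\<close>

definition slotwise_linear ::
    "('k \<Rightarrow> 'a::plus \<Rightarrow> 'a) \<Rightarrow> 'a set \<Rightarrow> nat \<Rightarrow> 'a set \<Rightarrow> nat \<Rightarrow> ('a list \<Rightarrow> 'a list) \<Rightarrow> bool" where
  "slotwise_linear scale A m B m' W \<longleftrightarrow>
     (\<forall>rs\<in>words A m. W rs \<in> words B m') \<and>
     (\<forall>rs\<in>words A m. \<forall>k<m. \<exists>l<m'. \<exists>g. linear_on A scale B scale g \<and> (\<forall>x\<in>A. W (rs[k := x]) = (W rs)[l := g x]))"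

lemma slotwise_linearI:
  assumes "\<And>rs. rs \<in> words A m \<Longrightarrow> W rs \<in> words B m'"
    and "\<And>rs k. rs \<in> words A m \<Longrightarrow> k < m \<Longrightarrow>
      \<exists>l<m'. \<exists>g. linear_on A scale B scale g \<and> (\<forall>x\<in>A. W (rs[k := x]) = (W rs)[l := g x])"
  shows "slotwise_linear scale A m B m' W"
  using assms by (auto simp: slotwise_linear_def)

lemma multilinear_on_comp:
  assumes \<phi>: "multilinear_on scale B m' \<phi>" and W: "slotwise_linear scale A m B m' W"
    and add: "\<And>x y. x \<in> A \<Longrightarrow> y \<in> A \<Longrightarrow> x + y \<in> A" and scal: "\<And>c x. x \<in> A \<Longrightarrow> scale c x \<in> A"
  shows "multilinear_on scale A m (\<lambda>rs. \<phi> (W rs))"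
  unfolding multilinear_on_def
proof (intro ballI allI impI)
  fix rs k assume rs: "rs \<in> words A m" "k < m"
  then obtain l g where lg: "l < m'" "linear_on A scale B scale g" "\<forall>x\<in>A. W (rs[k := x]) = (W rs)[l := g x]"
    using W unfolding slotwise_linear_def by blast
  have "W rs \<in> words B m'"
    using W rs by (simp add: slotwise_linear_def)
  then show "(\<forall>x\<in>A. \<forall>y\<in>A. \<phi> (W (rs[k := x + y])) = \<phi> (W (rs[k := x])) + \<phi> (W (rs[k := y]))) \<and>
      (\<forall>c. \<forall>x\<in>A. \<phi> (W (rs[k := scale c x])) = c * \<phi> (W (rs[k := x])))"
    using \<phi> lg add scal by (simp add: multilinear_on_def linear_on_def)
qed

context unital_algebra begin

lemma carrier_add: "x \<in> A \<Longrightarrow> y \<in> A \<Longrightarrow> x + y \<in> A"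
  by (rule subspace_add[OF subspace_carrier])

lemma carrier_scale: "x \<in> A \<Longrightarrow> scale c x \<in> A"
  by (rule subspace_scale[OF subspace_carrier])

lemma linear_on_id: "linear_on A scale A scale (\<lambda>x. x)"
  by (simp add: linear_on_def)

lemma linear_on_mult_left: "a \<in> A \<Longrightarrow> linear_on A scale A scale (\<lambda>x. a * x)"
  by (simp add: linear_on_def mult_closed distrib_left scale_mult_right)

lemma linear_on_mult_right: "a \<in> A \<Longrightarrow> linear_on A scale A scale (\<lambda>x. x * a)"
  by (simp add: linear_on_def mult_closed distrib_right scale_mult_left)

lemmas multilinear_on_compI = multilinear_on_comp[OF _ _ carrier_add carrier_scale]

text \<open>Each letter ends up in exactly one letter of the face; if it is merged there,
  \<open>g\<close> is multiplication by its neighbour. The empty word is excluded as a target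
  because it has no slot to receive anything.\<close>

lemma slotwise_linear_face:
  assumes "j < Suc m" "0 < m"
  shows "slotwise_linear scale A (Suc m) A m (face j)"
proof (rule slotwise_linearI)
  fix rs assume rs: "rs \<in> words A (Suc m)"
  then show "face j rs \<in> words A m"
    using assms mult_closed by (intro face_words)
  fix k assume k: "k < Suc m"
  have len: "length rs = Suc m" and mem: "\<And>i. i < Suc m \<Longrightarrow> rs ! i \<in> A"
    using rs by (auto simp: words_nth)
  show "\<exists>l<m. \<exists>g. linear_on A scale A scale g \<and> (\<forall>x\<in>A. face j (rs[k := x]) = (face j rs)[l := g x])"
  proof (cases "j = m")
    case True
    consider "k = 0" | "k = m" "0 < k" | "0 < k" "k < m"
      using k by linarith
    then show ?thesis
    proof cases
      case 1
      show ?thesis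
        using 1 True assms len
        by (intro exI[of _ 0] exI[of _ "\<lambda>x. rs ! j * x"] conjI linear_on_mult_left mem ballI nth_equalityI)
          (simp_all add: face_nth nth_list_update)
    next
      case 2
      show ?thesis
        using 2 True assms len
        by (intro exI[of _ 0] exI[of _ "\<lambda>x. x * rs ! 0"] conjI linear_on_mult_right mem ballI nth_equalityI)
          (simp_all add: face_nth nth_list_update)
    next
      case 3
      show ?thesis
        using 3 True assms len
        by (intro exI[of _ k] exI[of _ "\<lambda>x. x"] conjI linear_on_id ballI nth_equalityI)
          (simp_all add: face_nth nth_list_update)
    qed
  next
    case False
    then have j: "j < m"
      using assms by simp
    consider "k < j" | "k = j" | "k = Suc j" | "Suc j < k"
      by linarith
    then show ?thesis
    proof cases
      case 1
      show ?thesis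
        using 1 j len
        by (intro exI[of _ k] exI[of _ "\<lambda>x. x"] conjI linear_on_id ballI nth_equalityI)
          (simp_all add: face_nth nth_list_update)
    next
      case 2
      show ?thesis
        using 2 j len
        by (intro exI[of _ j] exI[of _ "\<lambda>x. x * rs ! Suc j"] conjI linear_on_mult_right mem ballI nth_equalityI)
          (simp_all add: face_nth nth_list_update)
    next
      case 3
      show ?thesis
        using 3 j len
        by (intro exI[of _ j] exI[of _ "\<lambda>x. rs ! j * x"] conjI linear_on_mult_left mem ballI nth_equalityI)
          (simp_all add: face_nth nth_list_update)
    next
      case 4
      then obtain i where "k = Suc i"
        by (cases k) auto
      then show ?thesis
        using 4 j len k
        by (intro exI[of _ i] exI[of _ "\<lambda>x. x"] conjI linear_on_id ballI nth_equalityI)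
          (auto simp: face_nth nth_list_update)
    qed
  qed
qed

lemma slotwise_linear_rot:
  assumes "0 < m"
  shows "slotwise_linear scale A m A m rot"
proof (rule slotwise_linearI)
  fix rs assume rs: "rs \<in> words A m"
  then show "rot rs \<in> words A m"
    using assms by (rule rot_words)
  fix k assume k: "k < m"
  have len: "length rs = m" "rs \<noteq> []"
    using rs assms by (auto simp: words_nth)
  have len': "length (rot rs) = m" "length (rot (rs[k := x])) = m" for x
    using len by (simp_all add: length_rot)
  show "\<exists>l<m. \<exists>g. linear_on A scale A scale g \<and> (\<forall>x\<in>A. rot (rs[k := x]) = (rot rs)[l := g x])"
  proof (cases "Suc k = m")
    case True
    then show ?thesis
      using len len'
      by (intro exI[of _ 0] exI[of _ "\<lambda>x. x"] conjI linear_on_id ballI nth_equalityI)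
        (auto simp: rot_nth nth_list_update)
  next
    case False
    then show ?thesis
      using len len' k
      by (intro exI[of _ "Suc k"] exI[of _ "\<lambda>x. x"] conjI linear_on_id ballI nth_equalityI)
        (auto simp: rot_nth nth_list_update)
  qed
qed

lemma slotwise_linear_map:
  assumes "linear_on A scale B scale f"
  shows "slotwise_linear scale A m B m (map f)"
proof (rule slotwise_linearI)
  show "map f rs \<in> words B m" if "rs \<in> words A m" for rs
    using that assms by (auto simp: linear_on_def intro: map_words)
  show "\<exists>l<m. \<exists>g. linear_on A scale B scale g \<and> (\<forall>x\<in>A. map f (rs[k := x]) = (map f rs)[l := g x])"
    if "k < m" for rs k
    using that assms by (intro exI[of _ k] exI[of _ f] conjI) (simp_all add: map_update)
qed

lemma multilinear_on_bprime_dual: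
  assumes "multilinear_on scale A m \<phi>" "0 < m"
  shows "multilinear_on scale A (Suc m) (bprime_dual \<phi>)"
proof -
  have "multilinear_on scale A (Suc m) (\<lambda>rs. \<Sum>j<m. (- 1) ^ j * \<phi> (face j rs))"
    using assms
    by (intro multilinear_on_sum multilinear_on_cmult multilinear_on_compI[OF assms(1)] slotwise_linear_face) auto
  then show ?thesis
    by (rule multilinear_on_cong[THEN iffD1, rotated -1])
      (auto simp: bprime_dual_def length_words carrier_add carrier_scale)
qed

lemma multilinear_on_b_dual:
  assumes "multilinear_on scale A m \<phi>" "0 < m"
  shows "multilinear_on scale A (Suc m) (b_dual \<phi>)"
proof -
  have "multilinear_on scale A (Suc m) (\<lambda>rs. \<Sum>j<Suc m. (- 1) ^ j * \<phi> (face j rs))"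
    using assms
    by (intro multilinear_on_sum multilinear_on_cmult multilinear_on_compI[OF assms(1)] slotwise_linear_face) auto
  then show ?thesis
    by (rule multilinear_on_cong[THEN iffD1, rotated -1])
      (auto simp: b_dual_def length_words carrier_add carrier_scale)
qed

lemma multilinear_on_t_dual:
  assumes "multilinear_on scale A m \<phi>" "0 < m"
  shows "multilinear_on scale A m (t_dual \<phi>)"
proof -
  have "multilinear_on scale A m (\<lambda>rs. (- 1) ^ (m - 1) * \<phi> (rot rs))"
    using assms by (intro multilinear_on_cmult multilinear_on_compI[OF assms(1)] slotwise_linear_rot) auto
  then show ?thesis
    by (rule multilinear_on_cong[THEN iffD1, rotated -1])
      (auto simp: t_dual_def length_words carrier_add carrier_scale)
qed

lemma multilinear_on_N_dual:
  assumes "multilinear_on scale A m \<phi>" "0 < m"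
  shows "multilinear_on scale A m (N_dual \<phi>)"
proof -
  have "multilinear_on scale A m ((t_dual ^^ i) \<phi>)" for i
    using assms by (induction i) (auto intro: multilinear_on_t_dual)
  then have "multilinear_on scale A m (\<lambda>rs. \<Sum>i<m. (t_dual ^^ i) \<phi> rs)"
    by (intro multilinear_on_sum) auto
  then show ?thesis
    by (rule multilinear_on_cong[THEN iffD1, rotated -1])
      (auto simp: N_dual_def length_words carrier_add carrier_scale)
qed

lemma on_words_multilinear:
  assumes "multilinear_on scale A m \<phi>"
  shows "on_words A m \<phi> \<in> multilinear_maps scale A m"
proof -
  have "multilinear_on scale A m (on_words A m \<phi>)"
    using assms by (rule multilinear_on_cong[THEN iffD1, rotated -1]) (auto simp: carrier_add carrier_scale)
  then show ?thesis
    by (simp add: multilinear_maps_def on_words_def)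
qed

text \<open>This disposes of mixed words, in which a projection has annihilated some letter.\<close>

lemma multilinear_zero_entry:
  assumes \<phi>: "multilinear_on scale A m \<phi>" and rs: "rs \<in> words A m" and k: "k < m" "rs ! k = 0"
  shows "\<phi> rs = 0"
proof -
  have "0 \<in> A"
    using rs k by (auto simp: words_nth)
  then have "\<phi> (rs[k := scale 0 0]) = 0 * \<phi> (rs[k := 0])"
    using \<phi> rs k unfolding multilinear_on_def by blast
  moreover have "rs[k := scale 0 0] = rs"
    using k by (metis list_update_id scale_zero_right)
  ultimately show ?thesis
    by simp
qed

end

section \<open>The dual bicomplex\<close>

definition vert_dual :: "nat \<Rightarrow> ('a::times list \<Rightarrow> 'k::comm_ring_1) \<Rightarrow> 'a list \<Rightarrow> 'k" where
  "vert_dual p \<phi> rs = (if even p then b_dual \<phi> rs else - bprime_dual \<phi> rs)"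

text \<open>The index is that of the column from which the dual map starts. It dualises the row map
  out of column p + 1, which is why 1 - t sits at even p here.\<close>

definition hor_dual :: "nat \<Rightarrow> ('a::times list \<Rightarrow> 'k::comm_ring_1) \<Rightarrow> 'a list \<Rightarrow> 'k" where
  "hor_dual p \<phi> rs = (if even p then \<phi> rs - t_dual \<phi> rs else N_dual \<phi> rs)"

definition cochains ::
    "('k::field \<Rightarrow> 'a::ring \<Rightarrow> 'a) \<Rightarrow> 'a set \<Rightarrow> nat \<Rightarrow> (nat \<Rightarrow> 'a list \<Rightarrow> 'k) set" where
  "cochains scale A n = {c. (\<forall>p\<le>n. c p \<in> multilinear_maps scale A (Suc (n - p))) \<and> (\<forall>p>n. c p = 0)}"

text \<open>\<open>n\<close> is the degree of the argument, so component p of the result lives on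
  words of length n + 2 - p. The inner conditions drop the neighbour missing at either end of the
  antidiagonal.\<close>

definition total_diff ::
    "'a::ring set \<Rightarrow> nat \<Rightarrow> (nat \<Rightarrow> 'a list \<Rightarrow> 'k::field) \<Rightarrow> nat \<Rightarrow> 'a list \<Rightarrow> 'k" where
  "total_diff A n c p rs = (if p \<le> Suc n \<and> rs \<in> words A (Suc (Suc n - p))
     then (if p \<le> n then vert_dual p (c p) rs else 0) + (if 1 \<le> p then hor_dual (p - 1) (c (p - 1)) rs else 0)
     else 0)"

text \<open>For even p this is (1 - t) b = b' (1 - t), for odd p it is b N = N b'; the sign of -b'
  turns both commutations into anticommutations.\<close>

lemma hor_vert_dual:
  assumes "2 \<le> length rs"
  shows "vert_dual (Suc p) (hor_dual p \<phi>) rs = - hor_dual p (vert_dual p \<phi>) rs"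
proof (cases "even p")
  case True
  have "bprime_dual (hor_dual p \<phi>) rs = bprime_dual \<phi> rs - bprime_dual (t_dual \<phi>) rs"
    using True by (simp add: bprime_dual_def hor_dual_def right_diff_distrib sum_subtractf)
  moreover have "hor_dual p (vert_dual p \<phi>) rs = b_dual \<phi> rs - t_dual (b_dual \<phi>) rs"
    using True by (simp add: hor_dual_def vert_dual_def t_dual_def)
  ultimately show ?thesis
    using True t_dual_b_dual[OF assms, of \<phi>] by (simp add: vert_dual_def)
next
  case False
  have ne: "rs \<noteq> []"
    using assms by auto
  have "hor_dual p \<phi> = N_dual \<phi>" "vert_dual p \<phi> = (\<lambda>rs. - bprime_dual \<phi> rs)"
    using False by (auto simp: hor_dual_def vert_dual_def fun_eq_iff)
  moreover have "N_dual (\<lambda>rs. - bprime_dual \<phi> rs) rs = - N_dual (bprime_dual \<phi>) rs"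
    by (simp add: N_dual_def funpow_t_dual[OF ne] sum_negf)
  ultimately show ?thesis
    using False b_dual_N_dual[OF assms, of \<phi>] by (simp add: vert_dual_def hor_dual_def)
qed

lemma hor_hor_dual:
  assumes "rs \<noteq> []"
  shows "hor_dual (Suc p) (hor_dual p \<phi>) rs = 0"
proof (cases "even p")
  case True
  have "N_dual (hor_dual p \<phi>) rs = N_dual \<phi> rs - N_dual (t_dual \<phi>) rs"
    using True assms
    by (simp add: N_dual_def funpow_t_dual hor_dual_def right_diff_distrib sum_subtractf)
  then show ?thesis
    using True by (simp add: hor_dual_def N_dual_t_dual[OF assms])
next
  case False
  then have "hor_dual p \<phi> = N_dual \<phi>"
    by (auto simp: hor_dual_def fun_eq_iff)
  then show ?thesis
    using False by (simp add: hor_dual_def t_dual_N_dual[OF assms])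
qed

lemma funpow_rot_words: "rs \<in> words A m \<Longrightarrow> 0 < m \<Longrightarrow> (rot ^^ i) rs \<in> words A m"
  by (induction i) (auto intro: rot_words)

context unital_algebra begin

lemma vert_dual_cong:
  assumes "rs \<in> words A (Suc m)" "0 < m" "\<And>ss. ss \<in> words A m \<Longrightarrow> \<phi> ss = \<psi> ss"
  shows "vert_dual p \<phi> rs = vert_dual p \<psi> rs"
  using assms face_words[OF assms(1) mult_closed]
  by (simp add: vert_dual_def b_dual_def bprime_dual_def length_words[OF assms(1)])

end

lemma hor_dual_cong:
  assumes "rs \<in> words A m" "0 < m" "\<And>ss. ss \<in> words A m \<Longrightarrow> \<phi> ss = \<psi> ss"
  shows "hor_dual p \<phi> rs = hor_dual p \<psi> rs"
proof -
  have "rs \<noteq> []"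
    using assms by (auto simp: words_def)
  then show ?thesis
    using assms rot_words[OF assms(1,2)] funpow_rot_words[OF assms(1,2)]
    by (simp add: hor_dual_def t_dual_def N_dual_def funpow_t_dual)
qed

lemma vert_dual_add: "vert_dual p (\<lambda>rs. \<phi> rs + \<psi> rs) rs = vert_dual p \<phi> rs + vert_dual p \<psi> rs"
  by (simp add: vert_dual_def b_dual_def bprime_dual_def distrib_left sum.distrib)

lemma vert_dual_cmult: "vert_dual p (\<lambda>rs. a * \<phi> rs) rs = a * vert_dual p \<phi> rs"
  by (simp add: vert_dual_def b_dual_def bprime_dual_def sum_distrib_left mult.left_commute)

lemma hor_dual_add:
  "rs \<noteq> [] \<Longrightarrow> hor_dual p (\<lambda>rs. \<phi> rs + \<psi> rs) rs = hor_dual p \<phi> rs + hor_dual p \<psi> rs"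
  by (simp add: hor_dual_def t_dual_def N_dual_def funpow_t_dual distrib_left sum.distrib)

lemma hor_dual_cmult: "rs \<noteq> [] \<Longrightarrow> hor_dual p (\<lambda>rs. a * \<phi> rs) rs = a * hor_dual p \<phi> rs"
  by (simp add: hor_dual_def t_dual_def N_dual_def funpow_t_dual sum_distrib_left mult.left_commute
      right_diff_distrib)

section \<open>Triangular algebras\<close>

text \<open>In matrix form only \<open>p A p\<close>, \<open>q A p\<close> and \<open>q A q\<close>
  survive. Thus \<open>A p\<close> is a two-sided ideal, and right multiplication by q identifies
  \<open>A / A p\<close> with \<open>q A q\<close>.\<close>

locale triangular_algebra = unital_algebra scale A u
  for scale :: "'k::field \<Rightarrow> 'a::ring \<Rightarrow> 'a" and A u +
  fixes p q :: 'a
  assumes p_in: "p \<in> A" and q_in: "q \<in> A"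
    and pp: "p * p = p" and qq: "q * q = q" and pq: "p * q = 0" and qp: "q * p = 0"
    and unit_sum: "u = p + q"
    and triangular: "x \<in> A \<Longrightarrow> p * x * q = 0"
begin

lemma p_mult_p: "x \<in> A \<Longrightarrow> p * (x * p) = p * x"
proof -
  assume x: "x \<in> A"
  have "p * x = p * (x * u)"
    using unit_right[OF x] by simp
  also have "\<dots> = p * (x * p)"
    using triangular[OF x] by (simp add: unit_sum distrib_left mult.assoc)
  finally show ?thesis ..
qed

lemma q_mult_q: "x \<in> A \<Longrightarrow> q * (x * q) = x * q"
proof -
  assume x: "x \<in> A"
  have "x * q = u * (x * q)"
    using unit_left[OF mult_closed[OF x q_in]] by simp
  also have "\<dots> = q * (x * q)"
    using triangular[OF x] by (simp add: unit_sum distrib_right mult.assoc)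
  finally show ?thesis ..
qed

lemma p_mult_q: "x \<in> A \<Longrightarrow> p * (x * q) = 0"
  using triangular by (simp add: mult.assoc)

lemma p_mult_p_mult: "x \<in> A \<Longrightarrow> p * (x * (p * y)) = p * (x * y)"
  using p_mult_p[of x] by (metis mult.assoc)

lemma idem_mult: "p * (p * y) = p * y" "q * (q * y) = q * y" "p * (q * y) = 0" "q * (p * y) = 0"
  by (simp_all add: pp qq pq qp flip: mult.assoc)

lemma p_plus_q: "x \<in> A \<Longrightarrow> p * x + q * x = x"
  using unit_left[of x] by (simp add: unit_sum distrib_right)

lemma right_p_plus_q: "x \<in> A \<Longrightarrow> x * p + x * q = x"
  using unit_right[of x] by (simp add: unit_sum distrib_left)

lemmas idem_simps = pp qq pq qp idem_mult p_mult_p q_mult_q p_mult_q p_mult_p_mult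
  p_in q_in mult_closed mult.assoc

text \<open>Since \<open>p A q = 0\<close>, the maps \<open>x \<mapsto> p x\<close> and \<open>x \<mapsto> x q\<close> are the projections \<open>x \<mapsto> p x p\<close> and
  \<open>x \<mapsto> q x q\<close>, and they are multiplicative.\<close>

definition relative_maps :: "nat \<Rightarrow> ('a list \<Rightarrow> 'k) set" where
  "relative_maps m = {\<phi> \<in> multilinear_maps scale A m.
     \<forall>rs\<in>words A m. \<phi> (map ((*) p) rs) = 0 \<and> \<phi> (map (\<lambda>x. x * q) rs) = 0}"

lemma map_p_words: "rs \<in> words A m \<Longrightarrow> map ((*) p) rs \<in> words A m"
  by (auto intro: map_words mult_closed p_in)

lemma map_q_words: "rs \<in> words A m \<Longrightarrow> map (\<lambda>x. x * q) rs \<in> words A m"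
  by (auto intro: map_words mult_closed q_in)

lemma on_words_relative:
  assumes "multilinear_on scale A m \<phi>"
    and "\<And>rs. rs \<in> words A m \<Longrightarrow> \<phi> (map ((*) p) rs) = 0"
    and "\<And>rs. rs \<in> words A m \<Longrightarrow> \<phi> (map (\<lambda>x. x * q) rs) = 0"
  shows "on_words A m \<phi> \<in> relative_maps m"
  using assms on_words_multilinear[OF assms(1)] map_p_words map_q_words by (simp add: relative_maps_def)

lemma relative_mapsD:
  assumes "\<phi> \<in> relative_maps m"
  shows "multilinear_on scale A m \<phi>" "rs \<notin> words A m \<Longrightarrow> \<phi> rs = 0"
    "rs \<in> words A m \<Longrightarrow> \<phi> (map ((*) p) rs) = 0" "rs \<in> words A m \<Longrightarrow> \<phi> (map (\<lambda>x. x * q) rs) = 0"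
  using assms by (auto simp: relative_maps_def multilinear_maps_def)

text \<open>The empty word counts as a word in both corners. So exactness of a column, stated with
  maps of length 0, also covers its end: there it says that a closed map is zero.\<close>

lemma relative_maps_0: "\<phi> \<in> relative_maps 0 \<Longrightarrow> \<phi> rs = 0"
  using relative_mapsD[of \<phi> 0] by (cases "rs \<in> words A 0") (auto simp: words_def)

lemma p_mult_hom: "x \<in> A \<Longrightarrow> y \<in> A \<Longrightarrow> p * (x * y) = p * x * (p * y)"
  by (simp add: idem_simps)

lemma q_mult_hom: "x \<in> A \<Longrightarrow> y \<in> A \<Longrightarrow> x * y * q = x * q * (y * q)"
  by (simp add: idem_simps)

text \<open>Projecting all letters commutes with rotation, so rotated corner words are corner
  words.\<close>

lemma hor_relative:
  assumes \<phi>: "\<phi> \<in> relative_maps m" and "0 < m"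
  shows "on_words A m (hor_dual i \<phi>) \<in> relative_maps m"
proof (rule on_words_relative)
  show "multilinear_on scale A m (hor_dual i \<phi>)"
    using assms unfolding hor_dual_def
    by (cases "even i") (auto intro: multilinear_on_diff multilinear_on_t_dual multilinear_on_N_dual relative_mapsD)
  fix rs assume rs: "rs \<in> words A m"
  then have ne: "rs \<noteq> []" "length rs = m"
    using assms by (auto simp: words_def)
  have rot_map: "(rot ^^ k) (map f rs) = map f ((rot ^^ k) rs)" for f :: "'a \<Rightarrow> 'a" and k
  proof (induction k)
    case (Suc k)
    have "(rot ^^ k) rs \<noteq> []"
      using ne length_funpow_rot by (metis length_0_conv)
    then show ?case
      using Suc by (simp add: map_rot)
  qed simp
  show "hor_dual i \<phi> (map ((*) p) rs) = 0"
    using rot_map[of 1] rot_map ne relative_mapsD(3)[OF \<phi>] rs funpow_rot_words[OF rs assms(2)] rot_words[OF rs assms(2)]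
    by (simp add: hor_dual_def t_dual_def N_dual_def funpow_t_dual)
  show "hor_dual i \<phi> (map (\<lambda>x. x * q) rs) = 0"
    using rot_map[of 1] rot_map ne relative_mapsD(4)[OF \<phi>] rs funpow_rot_words[OF rs assms(2)] rot_words[OF rs assms(2)]
    by (simp add: hor_dual_def t_dual_def N_dual_def funpow_t_dual)
qed

text \<open>The projections are multiplicative, hence commute with all faces, the cyclic one
  included.\<close>

lemma b_dual_relative:
  assumes \<phi>: "\<phi> \<in> relative_maps m" and "0 < m"
  shows "on_words A (Suc m) (b_dual \<phi>) \<in> relative_maps (Suc m)"
proof (rule on_words_relative)
  show "multilinear_on scale A (Suc m) (b_dual \<phi>)"
    using assms by (intro multilinear_on_b_dual relative_mapsD)
  fix rs assume rs: "rs \<in> words A (Suc m)"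
  have "face j (map ((*) p) rs) = map ((*) p) (face j rs)" "face j rs \<in> words A m" if "j < Suc m" for j
    using that assms rs mult_closed p_mult_hom by (auto simp: map_face intro!: face_words)
  then show "b_dual \<phi> (map ((*) p) rs) = 0"
    using relative_mapsD(3)[OF \<phi>] by (simp add: b_dual_def length_words[OF rs])
  have "face j (map (\<lambda>x. x * q) rs) = map (\<lambda>x. x * q) (face j rs)" "face j rs \<in> words A m" if "j < Suc m" for j
    using that assms rs mult_closed q_mult_hom by (auto simp: map_face intro!: face_words)
  then show "b_dual \<phi> (map (\<lambda>x. x * q) rs) = 0"
    using relative_mapsD(4)[OF \<phi>] by (simp add: b_dual_def length_words[OF rs])
qed

subsection \<open>Exactness of the columns\<close>

text \<open>The word f, f r0, r1, ..., rn. The sum over f = p and f = q is a corner-preserving form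
  of the extra degeneracy that puts the unit in front: on a word of one corner, the term of the
  other idempotent contains f r0 = 0.\<close>

definition insert_front :: "'a \<Rightarrow> 'a list \<Rightarrow> 'a list" where
  "insert_front f rs = map (\<lambda>k. if k = 0 then f else if k = 1 then f * rs ! 0 else rs ! (k - 1)) [0..<Suc (length rs)]"

text \<open>The word r0 p, p r1, ..., p ri, p, r(i+1), ..., rn: a degeneracy that inserts p and
  projects the letters before it.\<close>

definition insert_left :: "nat \<Rightarrow> 'a list \<Rightarrow> 'a list" where
  "insert_left i rs = map (\<lambda>k. if k = 0 then rs ! 0 * p else if k \<le> i then p * rs ! k
     else if k = Suc i then p else rs ! (k - 1)) [0..<Suc (length rs)]"

text \<open>The word r0, ..., ri, q, r(i+1) q, ..., rn q: the mirror image, projecting the letters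
  after the inserted q.\<close>

definition insert_right :: "nat \<Rightarrow> 'a list \<Rightarrow> 'a list" where
  "insert_right i rs = map (\<lambda>k. if k \<le> i then rs ! k else if k = Suc i then q else rs ! (k - 1) * q) [0..<Suc (length rs)]"

lemma length_insert [simp]:
  "length (insert_front f rs) = Suc (length rs)" "length (insert_left i rs) = Suc (length rs)"
  "length (insert_right i rs) = Suc (length rs)"
  by (simp_all add: insert_front_def insert_left_def insert_right_def del: upt_Suc)

lemma insert_nth:
  "k < Suc (length rs) \<Longrightarrow> insert_front f rs ! k = (if k = 0 then f else if k = 1 then f * rs ! 0 else rs ! (k - 1))"
  "k < Suc (length rs) \<Longrightarrow> insert_left i rs ! k = (if k = 0 then rs ! 0 * p else if k \<le> i then p * rs ! k
     else if k = Suc i then p else rs ! (k - 1))"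
  "k < Suc (length rs) \<Longrightarrow> insert_right i rs ! k = (if k \<le> i then rs ! k else if k = Suc i then q else rs ! (k - 1) * q)"
  unfolding insert_front_def insert_left_def insert_right_def
  by (subst nth_map; simp del: upt_Suc)+

lemma slotwise_linear_insert_front:
  assumes "f \<in> A"
  shows "slotwise_linear scale A m A (Suc m) (insert_front f)"
proof (rule slotwise_linearI)
  fix rs assume rs: "rs \<in> words A m"
  then show "insert_front f rs \<in> words A (Suc m)"
    using assms by (auto simp: words_nth insert_nth mult_closed)
  fix k assume k: "k < m"
  have len: "length rs = m"
    using rs by (simp add: words_def)
  show "\<exists>l<Suc m. \<exists>g. linear_on A scale A scale g \<and> (\<forall>x\<in>A. insert_front f (rs[k := x]) = (insert_front f rs)[l := g x])"
  proof (cases "k = 0")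
    case True
    then show ?thesis
      using len k assms
      by (intro exI[of _ 1] exI[of _ "\<lambda>x. f * x"] conjI linear_on_mult_left ballI nth_equalityI)
        (auto simp: insert_nth nth_list_update)
  next
    case False
    then show ?thesis
      using len k
      by (intro exI[of _ "Suc k"] exI[of _ "\<lambda>x. x"] conjI linear_on_id ballI nth_equalityI)
        (auto simp: insert_nth nth_list_update)
  qed
qed

lemma slotwise_linear_insert_left:
  assumes "i < m"
  shows "slotwise_linear scale A m A (Suc m) (insert_left i)"
proof (rule slotwise_linearI)
  fix rs assume rs: "rs \<in> words A m"
  then show "insert_left i rs \<in> words A (Suc m)"
    using assms by (auto simp: words_nth insert_nth mult_closed p_in)
  fix k assume k: "k < m"
  have len: "length rs = m"
    using rs by (simp add: words_def)
  consider "k = 0" | "0 < k" "k \<le> i" | "i < k"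
    by linarith
  then show "\<exists>l<Suc m. \<exists>g. linear_on A scale A scale g \<and> (\<forall>x\<in>A. insert_left i (rs[k := x]) = (insert_left i rs)[l := g x])"
  proof cases
    case 1
    then show ?thesis
      using len k p_in assms
      by (intro exI[of _ 0] exI[of _ "\<lambda>x. x * p"] conjI linear_on_mult_right ballI nth_equalityI)
        (auto simp: insert_nth nth_list_update)
  next
    case 2
    then show ?thesis
      using len k p_in assms
      by (intro exI[of _ k] exI[of _ "\<lambda>x. p * x"] conjI linear_on_mult_left ballI nth_equalityI)
        (auto simp: insert_nth nth_list_update)
  next
    case 3
    then show ?thesis
      using len k
      by (intro exI[of _ "Suc k"] exI[of _ "\<lambda>x. x"] conjI linear_on_id ballI nth_equalityI)
        (auto simp: insert_nth nth_list_update)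
  qed
qed

lemma slotwise_linear_insert_right:
  assumes "i < m"
  shows "slotwise_linear scale A m A (Suc m) (insert_right i)"
proof (rule slotwise_linearI)
  fix rs assume rs: "rs \<in> words A m"
  then show "insert_right i rs \<in> words A (Suc m)"
    using assms by (auto simp: words_nth insert_nth mult_closed q_in)
  fix k assume k: "k < m"
  have len: "length rs = m"
    using rs by (simp add: words_def)
  show "\<exists>l<Suc m. \<exists>g. linear_on A scale A scale g \<and> (\<forall>x\<in>A. insert_right i (rs[k := x]) = (insert_right i rs)[l := g x])"
  proof (cases "k \<le> i")
    case True
    then show ?thesis
      using len k
      by (intro exI[of _ k] exI[of _ "\<lambda>x. x"] conjI linear_on_id ballI nth_equalityI)
        (auto simp: insert_nth nth_list_update)
  next
    case False
    then show ?thesis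
      using len k q_in
      by (intro exI[of _ "Suc k"] exI[of _ "\<lambda>x. x * q"] conjI linear_on_mult_right ballI nth_equalityI)
        (auto simp: insert_nth nth_list_update)
  qed
qed

lemma slotwise_linear_words: "slotwise_linear scale A m B m' W \<Longrightarrow> rs \<in> words A m \<Longrightarrow> W rs \<in> words B m'"
  by (simp add: slotwise_linear_def)

lemma map_insert_front_p: "rs \<in> words A m \<Longrightarrow> insert_front p (map ((*) p) rs) = map ((*) p) (insert_front p rs)"
  by (rule nth_equalityI) (auto simp: insert_nth words_nth idem_simps nth_Cons')

lemma map_insert_front_q: "rs \<in> words A m \<Longrightarrow> insert_front q (map (\<lambda>x. x * q) rs) = map (\<lambda>x. x * q) (insert_front q rs)"
  by (rule nth_equalityI) (auto simp: insert_nth words_nth idem_simps nth_Cons')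

text \<open>The zeroth face undoes the insertion up to the factor f on the first letter. The others
  commute with the insertion after a shift of index by one, whence the minus sign. No cyclic face
  occurs in b', so there is no other term.\<close>

lemma bprime_dual_insert_front:
  assumes rs: "rs \<in> words A (Suc m)" and f: "f * f = f"
  shows "bprime_dual \<phi> (insert_front f rs) = \<phi> (rs[0 := f * rs ! 0]) - (\<Sum>j<m. (- 1) ^ j * \<phi> (insert_front f (face j rs)))"
proof -
  have len: "length rs = Suc m"
    using rs by (simp add: words_def)
  have 0: "face 0 (insert_front f rs) = rs[0 := f * rs ! 0]"
  proof (rule nth_equalityI)
    fix k assume "k < length (face 0 (insert_front f rs))"
    then show "face 0 (insert_front f rs) ! k = rs[0 := f * rs ! 0] ! k"
      using len f by (cases k) (simp_all add: face_nth insert_nth mult.assoc[symmetric])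
  qed (simp add: len)
  have Suc: "face (Suc j) (insert_front f rs) = insert_front f (face j rs)" if "j < m" for j
  proof (rule nth_equalityI)
    fix k assume "k < length (face (Suc j) (insert_front f rs))"
    then have "k < Suc m"
      using len by simp
    then show "face (Suc j) (insert_front f rs) ! k = insert_front f (face j rs) ! k"
      using len that
      by (cases k; cases "k = 1"; cases "j = 0"; cases k "Suc j" rule: linorder_cases)
        (auto simp: face_nth insert_nth mult.assoc gr0_conv_Suc)
  qed (simp add: len)
  show ?thesis
    unfolding bprime_dual_def length_insert len
    by (simp add: sum.lessThan_Suc_shift 0 Suc sum_negf del: sum.lessThan_Suc)
qed

text \<open>Adding the identities of \<open>bprime_dual_insert_front\<close> for p and q restores
  the first letter, as \<open>p + q\<close> is the unit.\<close>

lemma bprime_column_exact: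
  assumes \<phi>: "\<phi> \<in> relative_maps (Suc m)"
    and closed: "\<And>rs. rs \<in> words A (Suc (Suc m)) \<Longrightarrow> bprime_dual \<phi> rs = 0"
  shows "\<exists>\<psi>\<in>relative_maps m. \<forall>rs\<in>words A (Suc m). bprime_dual \<psi> rs = \<phi> rs"
proof -
  note \<phi>D = relative_mapsD[OF \<phi>]
  define \<psi> where "\<psi> rs = \<phi> (insert_front p rs) + \<phi> (insert_front q rs)" for rs
  note words_p = slotwise_linear_words[OF slotwise_linear_insert_front[OF p_in]]
  note words_q = slotwise_linear_words[OF slotwise_linear_insert_front[OF q_in]]
  have rel: "on_words A m \<psi> \<in> relative_maps m"
  proof (rule on_words_relative)
    show "multilinear_on scale A m \<psi>"
      unfolding \<psi>_def
      by (intro multilinear_on_add multilinear_on_compI[OF \<phi>D(1)] slotwise_linear_insert_front p_in q_in)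
    fix rs assume rs: "rs \<in> words A m"
    have "\<phi> (insert_front q (map ((*) p) rs)) = 0"
    \<comment> \<open>Without letters there is nothing to annihilate, but the inserted q alone is a
      word in \<open>q A q\<close>, on which \<phi> vanishes.\<close>
    proof (cases "m = 0")
      case True
      then have "insert_front q (map ((*) p) rs) = map (\<lambda>x. x * q) [q]"
        using rs by (simp add: words_def insert_front_def qq)
      then show ?thesis
        using True \<phi>D(4)[of "[q]"] q_in by (simp add: words_def)
    next
      case False
      then have "insert_front q (map ((*) p) rs) ! 1 = 0"
        using rs by (simp add: insert_nth words_def idem_simps)
      then show ?thesis
        using False multilinear_zero_entry[OF \<phi>D(1) words_q[OF map_p_words[OF rs]], of 1] by simp
    qed
    then show "\<psi> (map ((*) p) rs) = 0"
      using \<phi>D(3)[OF words_p[OF rs]] map_insert_front_p[OF rs] by (simp add: \<psi>_def)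
    have "\<phi> (insert_front p (map (\<lambda>x. x * q) rs)) = 0"
    proof (cases "m = 0")
      case True
      then have "insert_front p (map (\<lambda>x. x * q) rs) = map ((*) p) [p]"
        using rs by (simp add: words_def insert_front_def pp)
      then show ?thesis
        using True \<phi>D(3)[of "[p]"] p_in by (simp add: words_def)
    next
      case False
      then have "insert_front p (map (\<lambda>x. x * q) rs) ! 1 = 0"
        using rs by (simp add: insert_nth words_nth idem_simps)
      then show ?thesis
        using False multilinear_zero_entry[OF \<phi>D(1) words_p[OF map_q_words[OF rs]], of 1] by simp
    qed
    then show "\<psi> (map (\<lambda>x. x * q) rs) = 0"
      using \<phi>D(4)[OF words_q[OF rs]] map_insert_front_q[OF rs] by (simp add: \<psi>_def)
  qed
  have "bprime_dual (on_words A m \<psi>) rs = \<phi> rs" if rs: "rs \<in> words A (Suc m)" for rs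
  proof -
    have hd: "rs ! 0 \<in> A"
      using rs by (simp add: words_nth)
    have "bprime_dual (on_words A m \<psi>) rs = (\<Sum>j<m. (- 1) ^ j * \<psi> (face j rs))"
      unfolding bprime_dual_def length_words[OF rs]
      using face_words[OF rs mult_closed] by (intro sum.cong) auto
    also have "\<dots> = (\<Sum>j<m. (- 1) ^ j * \<phi> (insert_front p (face j rs))) + (\<Sum>j<m. (- 1) ^ j * \<phi> (insert_front q (face j rs)))"
      by (simp add: \<psi>_def distrib_left sum.distrib)
    also have "\<dots> = \<phi> (rs[0 := p * rs ! 0]) + \<phi> (rs[0 := q * rs ! 0])"
      using bprime_dual_insert_front[OF rs pp, of \<phi>] bprime_dual_insert_front[OF rs qq, of \<phi>]
        closed[OF words_p[OF rs]] closed[OF words_q[OF rs]] by simp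
    also have "\<dots> = \<phi> (rs[0 := p * rs ! 0 + q * rs ! 0])"
      using \<phi>D(1) rs mult_closed[OF p_in hd] mult_closed[OF q_in hd] by (simp add: multilinear_on_def)
    finally show ?thesis
      using p_plus_q[OF hd] by simp
  qed
  then show ?thesis
    using rel by blast
qed

end

section \<open>The Hochschild columns: coefficients in \<open>A p\<close> and in
  \<open>A / A p\<close>\<close>

context triangular_algebra begin

text \<open>The identities that \<open>simplicial_homotopy_sum\<close> asks for, with the values of
  its two end terms. The condition on the first letter places it in \<open>A p\<close>.\<close>

lemma face_insert_left:
  assumes rs: "rs \<in> words A (Suc n)" and hd: "rs ! 0 * p = rs ! 0"
  shows "j < i \<Longrightarrow> i \<le> n \<Longrightarrow> face j (insert_left i rs) = insert_left (i - 1) (face j rs)"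
    and "1 \<le> i \<Longrightarrow> i \<le> n \<Longrightarrow> face i (insert_left i rs) = face i (insert_left (i - 1) rs)"
    and "Suc i < j \<Longrightarrow> j \<le> Suc n \<Longrightarrow> face j (insert_left i rs) = insert_left i (face (j - 1) rs)"
    and "face 0 (insert_left 0 rs) = rs"
    and "face (Suc n) (insert_left n rs) = map ((*) p) rs"
proof -
  have len: "length rs = Suc n" and mem: "\<And>k. k < Suc n \<Longrightarrow> rs ! k \<in> A"
    using rs by (auto simp: words_nth)
  have hd': "rs ! 0 * (p * x) = rs ! 0 * x" for x
    using hd by (metis mult.assoc)
  show "face j (insert_left i rs) = insert_left (i - 1) (face j rs)" if "j < i" "i \<le> n"
  proof (rule nth_equalityI)
    from that obtain i' where i': "i = Suc i'"
      by (cases i) auto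
    fix k assume "k < length (face j (insert_left i rs))"
    then have k: "k < Suc n"
      using len by simp
    show "face j (insert_left i rs) ! k = insert_left (i - 1) (face j rs) ! k"
    proof (cases k)
      case 0
      \<comment> \<open>When the zeroth face merges r1 into the first letter, the product must again
        lie in \<open>A p\<close>. It does because r0 = r0 p and p r1 = p r1 p.\<close>
      have "rs ! 0 * (rs ! 1 * p) = rs ! 0 * rs ! 1"
        using that hd'[of "rs ! 1 * p"] hd'[of "rs ! 1"] p_mult_p[OF mem[of 1]] by simp
      then show ?thesis
        using 0 that len i' by (simp add: face_nth insert_nth mult.assoc hd' hd)
    next
      case (Suc k')
      then show ?thesis
        using that len i' k p_mult_p_mult[OF mem[of k]]
        by (cases k j rule: linorder_cases; cases k i rule: linorder_cases)
          (auto simp: face_nth insert_nth mult.assoc)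
    qed
  qed (simp add: len)
  show "face i (insert_left i rs) = face i (insert_left (i - 1) rs)" if "1 \<le> i" "i \<le> n"
  proof (rule nth_equalityI)
    from that obtain i' where i': "i = Suc i'"
      by (cases i) auto
    fix k assume "k < length (face i (insert_left i rs))"
    then have k: "k < Suc n"
      using len by simp
    show "face i (insert_left i rs) ! k = face i (insert_left (i - 1) rs) ! k"
      using that len i' k p_mult_p[OF mem[of i]]
      by (cases k i rule: linorder_cases) (auto simp: face_nth insert_nth mult.assoc)
  qed (simp add: len)
  show "face j (insert_left i rs) = insert_left i (face (j - 1) rs)" if "Suc i < j" "j \<le> Suc n"
  proof (rule nth_equalityI)
    from that obtain j' where j': "j = Suc j'"
      by (cases j) auto
    fix k assume "k < length (face j (insert_left i rs))"
    then have k: "k < Suc n"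
      using len by simp
    show "face j (insert_left i rs) ! k = insert_left i (face (j - 1) rs) ! k"
    proof (cases k)
      case 0
      then show ?thesis
        using that len j' by (auto simp: face_nth insert_nth mult.assoc)
    next
      case (Suc k')
      then show ?thesis
        using that len j' k
        by (cases "j' = n"; cases k j rule: linorder_cases; cases k "Suc i" rule: linorder_cases)
          (auto simp: face_nth insert_nth mult.assoc)
    qed
  qed (simp add: len)
  show "face 0 (insert_left 0 rs) = rs"
  proof (rule nth_equalityI)
    fix k assume "k < length (face 0 (insert_left 0 rs))"
    then show "face 0 (insert_left 0 rs) ! k = rs ! k"
      using len hd by (cases k) (simp_all add: face_nth insert_nth mult.assoc pp)
  qed (simp add: len)
  show "face (Suc n) (insert_left n rs) = map ((*) p) rs"
  proof (rule nth_equalityI)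
    fix k assume "k < length (face (Suc n) (insert_left n rs))"
    then show "face (Suc n) (insert_left n rs) ! k = map ((*) p) rs ! k"
      using len hd by (cases k) (simp_all add: face_nth insert_nth)
  qed (simp add: len)
qed

text \<open>Two of these identities are not simplicial: the cyclic face leaves a q between rn and
  r0, and the last end term has q r0 in place of r0. Both defects vanish once the first letter is
  multiplied by q on the right, that is, modulo \<open>A p\<close>.\<close>

lemma face_insert_right:
  assumes rs: "rs \<in> words A (Suc n)"
  shows "j < i \<Longrightarrow> i \<le> n \<Longrightarrow> face j (insert_right i rs) = insert_right (i - 1) (face j rs)"
    and "1 \<le> i \<Longrightarrow> i \<le> n \<Longrightarrow> face i (insert_right i rs) = face i (insert_right (i - 1) rs)"
    and "Suc i < j \<Longrightarrow> j \<le> n \<Longrightarrow> face j (insert_right i rs) = insert_right i (face (j - 1) rs)"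
    and "i < n \<Longrightarrow> face (Suc n) (insert_right i rs) = (insert_right i (face n rs))[0 := rs ! n * q * rs ! 0]"
    and "face 0 (insert_right 0 rs) = map (\<lambda>x. x * q) rs"
    and "face (Suc n) (insert_right n rs) = rs[0 := q * rs ! 0]"
proof -
  have len: "length rs = Suc n" and mem: "\<And>k. k < Suc n \<Longrightarrow> rs ! k \<in> A"
    using rs by (auto simp: words_nth)
  show "face j (insert_right i rs) = insert_right (i - 1) (face j rs)" if "j < i" "i \<le> n"
  proof (rule nth_equalityI)
    from that obtain i' where i': "i = Suc i'"
      by (cases i) auto
    fix k assume "k < length (face j (insert_right i rs))"
    then have k: "k < Suc n"
      using len by simp
    show "face j (insert_right i rs) ! k = insert_right (i - 1) (face j rs) ! k"
      using that len i' k
      by (cases k; cases k j rule: linorder_cases; cases k i rule: linorder_cases)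
        (auto simp: face_nth insert_nth mult.assoc)
  qed (simp add: len)
  show "face i (insert_right i rs) = face i (insert_right (i - 1) rs)" if "1 \<le> i" "i \<le> n"
  proof (rule nth_equalityI)
    from that obtain i' where i': "i = Suc i'"
      by (cases i) auto
    fix k assume "k < length (face i (insert_right i rs))"
    then have k: "k < Suc n"
      using len by simp
    show "face i (insert_right i rs) ! k = face i (insert_right (i - 1) rs) ! k"
      using that len i' k q_mult_q[OF mem[of i]]
      by (cases k i rule: linorder_cases) (auto simp: face_nth insert_nth mult.assoc)
  qed (simp add: len)
  show "face j (insert_right i rs) = insert_right i (face (j - 1) rs)" if "Suc i < j" "j \<le> n"
  proof (rule nth_equalityI)
    from that obtain j' where j': "j = Suc j'"
      by (cases j) auto
    fix k assume "k < length (face j (insert_right i rs))"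
    then have k: "k < Suc n"
      using len by simp
    show "face j (insert_right i rs) ! k = insert_right i (face (j - 1) rs) ! k"
      using that len j' k q_mult_q[OF mem[of j]]
      by (cases k; cases k j rule: linorder_cases; cases k "Suc i" rule: linorder_cases)
        (auto simp: face_nth insert_nth mult.assoc)
  qed (simp add: len)
  show "face (Suc n) (insert_right i rs) = (insert_right i (face n rs))[0 := rs ! n * q * rs ! 0]" if "i < n"
  proof (rule nth_equalityI)
    fix k assume "k < length (face (Suc n) (insert_right i rs))"
    then have k: "k < Suc n"
      using len by simp
    show "face (Suc n) (insert_right i rs) ! k = (insert_right i (face n rs))[0 := rs ! n * q * rs ! 0] ! k"
      using that len k
      by (cases k; cases k "Suc i" rule: linorder_cases) (auto simp: face_nth insert_nth)
  qed (use that len in simp)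
  show "face 0 (insert_right 0 rs) = map (\<lambda>x. x * q) rs"
  proof (rule nth_equalityI)
    fix k assume "k < length (face 0 (insert_right 0 rs))"
    then show "face 0 (insert_right 0 rs) ! k = map (\<lambda>x. x * q) rs ! k"
      using len by (cases k) (simp_all add: face_nth insert_nth)
  qed (simp add: len)
  show "face (Suc n) (insert_right n rs) = rs[0 := q * rs ! 0]"
  proof (rule nth_equalityI)
    fix k assume "k < length (face (Suc n) (insert_right n rs))"
    then show "face (Suc n) (insert_right n rs) ! k = rs[0 := q * rs ! 0] ! k"
      using len by (cases k) (simp_all add: face_nth insert_nth)
  qed (simp add: len)
qed

lemma b_dual_on_words:
  assumes "rs \<in> words A (Suc n)"
  shows "b_dual (on_words A n \<psi>) rs = b_dual \<psi> rs"
  unfolding b_dual_def length_words[OF assms]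
  using face_words[OF assms mult_closed] by (intro sum.cong) auto

text \<open>On words with first letter in the ideal \<open>A p\<close>, \<open>insert_left\<close> is a simplicial homotopy
  from the identity to the projection of all letters to \<open>p A p\<close>.\<close>

lemma b_column_exact_left:
  assumes \<phi>: "\<phi> \<in> relative_maps (Suc n)"
    and closed: "\<And>rs. rs \<in> words A (Suc (Suc n)) \<Longrightarrow> b_dual \<phi> rs = 0"
  shows "\<exists>\<psi>\<in>relative_maps n. \<forall>rs\<in>words A (Suc n). rs ! 0 * p = rs ! 0 \<longrightarrow> b_dual \<psi> rs = \<phi> rs"
proof -
  note \<phi>D = relative_mapsD[OF \<phi>]
  define \<psi> where "\<psi> rs = (\<Sum>i<length rs. (- 1) ^ i * \<phi> (insert_left i rs))" for rs
  note words_left = slotwise_linear_words[OF slotwise_linear_insert_left]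
  have "on_words A n \<psi> \<in> relative_maps n"
  proof (rule on_words_relative)
    have "multilinear_on scale A n (\<lambda>rs. \<Sum>i<n. (- 1) ^ i * \<phi> (insert_left i rs))"
      by (intro multilinear_on_sum multilinear_on_cmult multilinear_on_compI[OF \<phi>D(1)] slotwise_linear_insert_left) auto
    then show "multilinear_on scale A n \<psi>"
      by (rule multilinear_on_cong[THEN iffD1, rotated -1])
        (auto simp: \<psi>_def length_words carrier_add carrier_scale)
    fix rs assume rs: "rs \<in> words A n"
    have "insert_left i (map ((*) p) rs) = map ((*) p) (insert_left i rs)" if "i < n" for i
      using that rs by (intro nth_equalityI) (auto simp: insert_nth words_nth idem_simps)
    then show "\<psi> (map ((*) p) rs) = 0"
      using \<phi>D(3) words_left rs by (auto simp: \<psi>_def length_words intro!: sum.neutral)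
    have "\<phi> (insert_left i (map (\<lambda>x. x * q) rs)) = 0" if i: "i < n" for i
    proof (rule multilinear_zero_entry[OF \<phi>D(1) words_left[OF i map_q_words[OF rs]]])
      show "insert_left i (map (\<lambda>x. x * q) rs) ! 0 = 0"
        using i rs by (simp add: insert_nth words_nth mult.assoc qp)
    qed simp
    then show "\<psi> (map (\<lambda>x. x * q) rs) = 0"
      using rs by (auto simp: \<psi>_def length_words intro!: sum.neutral)
  qed
  moreover have "b_dual (on_words A n \<psi>) rs = \<phi> rs" if rs: "rs \<in> words A (Suc n)" and hd: "rs ! 0 * p = rs ! 0" for rs
  proof -
    have "(\<Sum>i<Suc n. (- 1) ^ i * (\<Sum>j<Suc (Suc n). (- 1) ^ j * \<phi> (face j (insert_left i rs))))
        + (\<Sum>j<Suc n. (- 1) ^ j * (\<Sum>i<n. (- 1) ^ i * \<phi> (insert_left i (face j rs))))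
        = \<phi> (face 0 (insert_left 0 rs)) - \<phi> (face (Suc n) (insert_left n rs))"
      by (rule simplicial_homotopy_sum) (simp_all add: face_insert_left[OF rs hd])
    moreover have "(\<Sum>j<Suc (Suc n). (- 1) ^ j * \<phi> (face j (insert_left i rs))) = 0" if "i < Suc n" for i
      using closed[OF words_left[OF that rs]] length_words[OF rs] by (simp add: b_dual_def del: sum.lessThan_Suc)
    moreover have "b_dual \<psi> rs = (\<Sum>j<Suc n. (- 1) ^ j * (\<Sum>i<n. (- 1) ^ i * \<phi> (insert_left i (face j rs))))"
      using length_words[OF rs] by (simp add: b_dual_def \<psi>_def del: sum.lessThan_Suc)
    ultimately show ?thesis
      using \<phi>D(3)[OF rs] by (simp add: b_dual_on_words[OF rs] face_insert_left[OF rs hd] del: sum.lessThan_Suc)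
  qed
  ultimately show ?thesis
    by blast
qed

text \<open>When the first letter is taken modulo \<open>A p\<close>, \<open>insert_right\<close> is a simplicial homotopy from
  the projection of all letters to \<open>q A q\<close> to the identity.\<close>

lemma b_column_exact_right:
  assumes \<phi>: "\<phi> \<in> relative_maps (Suc n)"
    and closed: "\<And>rs. rs \<in> words A (Suc (Suc n)) \<Longrightarrow> b_dual \<phi> rs = 0"
    and ideal: "\<And>rs. rs \<in> words A (Suc n) \<Longrightarrow> rs ! 0 * p = rs ! 0 \<Longrightarrow> \<phi> rs = 0"
  shows "\<exists>\<psi>\<in>relative_maps n. \<forall>rs\<in>words A (Suc n). b_dual \<psi> rs = \<phi> rs"
proof -
  note \<phi>D = relative_mapsD[OF \<phi>]
  \<comment> \<open>The sign is opposite to that of the left homotopy: here the zeroth end is the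
    projection and the last end is the identity.\<close>
  define \<psi> where "\<psi> rs = - (\<Sum>i<length rs. (- 1) ^ i * \<phi> (insert_right i rs))" for rs
  note words_right = slotwise_linear_words[OF slotwise_linear_insert_right]
  \<comment> \<open>By \<open>ideal\<close> the part r0 p contributes nothing, so \<phi> depends on
    the first letter only through r0 q, its class modulo \<open>A p\<close>.\<close>
  have normal: "\<phi> rs = \<phi> (rs[0 := rs ! 0 * q])" if rs: "rs \<in> words A (Suc n)" for rs
  proof -
    have hd: "rs ! 0 \<in> A"
      using rs by (simp add: words_nth)
    have "\<phi> rs = \<phi> (rs[0 := rs ! 0 * p + rs ! 0 * q])"
      by (simp add: right_p_plus_q[OF hd])
    also have "\<dots> = \<phi> (rs[0 := rs ! 0 * p]) + \<phi> (rs[0 := rs ! 0 * q])"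
      using \<phi>D(1) rs mult_closed[OF hd p_in] mult_closed[OF hd q_in] by (simp add: multilinear_on_def)
    also have "\<phi> (rs[0 := rs ! 0 * p]) = 0"
      using ideal[OF list_update_words[OF rs mult_closed[OF hd p_in], of 0]] rs
      by (simp add: length_words mult.assoc pp)
    finally show ?thesis
      by simp
  qed
  have normal_cong: "\<phi> (rs[0 := x]) = \<phi> (rs[0 := y])"
    if "rs \<in> words A (Suc n)" "x \<in> A" "y \<in> A" "x * q = y * q" for rs x y
    using that normal[OF list_update_words[OF that(1,2), of 0]] normal[OF list_update_words[OF that(1,3), of 0]]
    by (simp add: length_words)
  have "on_words A n \<psi> \<in> relative_maps n"
  proof (rule on_words_relative)
    have "multilinear_on scale A n (\<lambda>rs. - (\<Sum>i<n. (- 1) ^ i * \<phi> (insert_right i rs)))"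
      by (intro multilinear_on_uminus multilinear_on_sum multilinear_on_cmult
          multilinear_on_compI[OF \<phi>D(1)] slotwise_linear_insert_right) auto
    then show "multilinear_on scale A n \<psi>"
      by (rule multilinear_on_cong[THEN iffD1, rotated -1])
        (auto simp: \<psi>_def length_words carrier_add carrier_scale)
    fix rs assume rs: "rs \<in> words A n"
    have "insert_right i (map (\<lambda>x. x * q) rs) = map (\<lambda>x. x * q) (insert_right i rs)" if "i < n" for i
      using that rs by (intro nth_equalityI) (auto simp: insert_nth words_nth idem_simps)
    then show "\<psi> (map (\<lambda>x. x * q) rs) = 0"
      using \<phi>D(4) words_right rs by (auto simp: \<psi>_def length_words intro!: sum.neutral)
    have "\<phi> (insert_right i (map ((*) p) rs)) = 0" if i: "i < n" for i
    \<comment> \<open>The insertion leaves the first letter alone, and for a word in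
      \<open>p A p\<close> that letter lies in \<open>A p\<close>.\<close>
    proof (rule ideal[OF words_right[OF i map_p_words[OF rs]]])
      show "insert_right i (map ((*) p) rs) ! 0 * p = insert_right i (map ((*) p) rs) ! 0"
        using i rs by (simp add: insert_nth words_nth idem_simps)
    qed
    then show "\<psi> (map ((*) p) rs) = 0"
      using rs by (auto simp: \<psi>_def length_words intro!: sum.neutral)
  qed
  moreover have "b_dual (on_words A n \<psi>) rs = \<phi> rs" if rs: "rs \<in> words A (Suc n)" for rs
  proof -
    have len: "length rs = Suc n" and mem: "\<And>k. k < Suc n \<Longrightarrow> rs ! k \<in> A"
      using rs by (auto simp: words_nth)
    \<comment> \<open>The letters rn q r0 and rn r0 agree modulo \<open>A p\<close>, since q r0 q =
      r0 q. This supplies the missing case j = n + 1 of the simplicial identities.\<close>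
    have cyclic: "\<phi> (face (Suc n) (insert_right i rs)) = \<phi> (insert_right i (face n rs))" if i: "i < n" for i
    proof -
      have w: "insert_right i (face n rs) \<in> words A (Suc n)"
        using words_right[OF i face_words[OF rs mult_closed]] by simp
      have "\<phi> (face (Suc n) (insert_right i rs)) = \<phi> ((insert_right i (face n rs))[0 := rs ! n * rs ! 0])"
        unfolding face_insert_right(4)[OF rs i] using mem[of n] mem[of 0] q_in q_mult_q[OF mem[of 0]]
        by (intro normal_cong[OF w]) (simp_all add: mult_closed mult.assoc)
      moreover have "insert_right i (face n rs) ! 0 = rs ! n * rs ! 0"
        using len i by (simp add: insert_nth face_nth)
      ultimately show ?thesis
        by (metis list_update_id)
    qed
    have "(\<Sum>i<Suc n. (- 1) ^ i * (\<Sum>j<Suc (Suc n). (- 1) ^ j * \<phi> (face j (insert_right i rs))))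
        + (\<Sum>j<Suc n. (- 1) ^ j * (\<Sum>i<n. (- 1) ^ i * \<phi> (insert_right i (face j rs))))
        = \<phi> (face 0 (insert_right 0 rs)) - \<phi> (face (Suc n) (insert_right n rs))"
    proof (rule simplicial_homotopy_sum)
      show "\<phi> (face j (insert_right i rs)) = \<phi> (insert_right i (face (j - 1) rs))" if "Suc i < j" "j \<le> Suc n" for i j
        using that cyclic[of i] face_insert_right(3)[OF rs that(1)] by (cases "j = Suc n") auto
    qed (simp_all add: face_insert_right[OF rs])
    moreover have "(\<Sum>j<Suc (Suc n). (- 1) ^ j * \<phi> (face j (insert_right i rs))) = 0" if "i < Suc n" for i
      using closed[OF words_right[OF that rs]] len by (simp add: b_dual_def del: sum.lessThan_Suc)
    moreover have "b_dual \<psi> rs = - (\<Sum>j<Suc n. (- 1) ^ j * (\<Sum>i<n. (- 1) ^ i * \<phi> (insert_right i (face j rs))))"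
      using len by (simp add: b_dual_def \<psi>_def sum_negf del: sum.lessThan_Suc)
    moreover have "\<phi> (rs[0 := q * rs ! 0]) = \<phi> (rs[0 := rs ! 0])"
      using mem[of 0] q_in by (intro normal_cong[OF rs]) (simp_all add: mult_closed mult.assoc q_mult_q)
    ultimately show ?thesis
      using \<phi>D(4)[OF rs] by (simp add: b_dual_on_words[OF rs] face_insert_right[OF rs] del: sum.lessThan_Suc)
  qed
  ultimately show ?thesis
    by blast
qed

lemma relative_add: "\<phi> \<in> relative_maps m \<Longrightarrow> \<psi> \<in> relative_maps m \<Longrightarrow> (\<lambda>rs. \<phi> rs + \<psi> rs) \<in> relative_maps m"
  by (simp add: relative_maps_def multilinear_maps_def multilinear_on_add)

lemma relative_diff: "\<phi> \<in> relative_maps m \<Longrightarrow> \<psi> \<in> relative_maps m \<Longrightarrow> (\<lambda>rs. \<phi> rs - \<psi> rs) \<in> relative_maps m"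
  by (simp add: relative_maps_def multilinear_maps_def multilinear_on_diff)

lemma relative_uminus: "\<phi> \<in> relative_maps m \<Longrightarrow> (\<lambda>rs. - \<phi> rs) \<in> relative_maps m"
  by (simp add: relative_maps_def multilinear_maps_def multilinear_on_uminus)

lemma relative_zero: "(\<lambda>rs. 0) \<in> relative_maps m"
  by (simp add: relative_maps_def multilinear_maps_def multilinear_on_def)

text \<open>Subtracting the coboundary of \<psi>1 makes the cocycle vanish when the first letter
  lies in \<open>A p\<close>. The remainder then has coefficients in \<open>A / A p\<close>, where
  the right homotopy applies.\<close>

lemma b_column_exact:
  assumes \<phi>: "\<phi> \<in> relative_maps (Suc n)"
    and closed: "\<And>rs. rs \<in> words A (Suc (Suc n)) \<Longrightarrow> b_dual \<phi> rs = 0"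
  shows "\<exists>\<psi>\<in>relative_maps n. \<forall>rs\<in>words A (Suc n). b_dual \<psi> rs = \<phi> rs"
proof -
  obtain \<psi>1 where \<psi>1: "\<psi>1 \<in> relative_maps n"
      "\<And>rs. rs \<in> words A (Suc n) \<Longrightarrow> rs ! 0 * p = rs ! 0 \<Longrightarrow> b_dual \<psi>1 rs = \<phi> rs"
    using b_column_exact_left[OF assms] by blast
  define \<phi>1 where "\<phi>1 rs = \<phi> rs - on_words A (Suc n) (b_dual \<psi>1) rs" for rs
  have "on_words A (Suc n) (b_dual \<psi>1) \<in> relative_maps (Suc n)"
  \<comment> \<open>\<open>b_dual_relative\<close> starts at length 1; below that, \<psi>1 itself is
    zero.\<close>
  proof (cases "n = 0")
    case True
    then have "on_words A (Suc n) (b_dual \<psi>1) = (\<lambda>rs. 0)"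
      using relative_maps_0[of \<psi>1] \<psi>1(1) by (intro ext) (simp add: on_words_def b_dual_def)
    then show ?thesis
      using relative_zero by simp
  qed (use b_dual_relative[OF \<psi>1(1)] in simp)
  then have "\<phi>1 \<in> relative_maps (Suc n)"
    unfolding \<phi>1_def by (intro relative_diff \<phi>)
  moreover have "b_dual \<phi>1 rs = 0" if rs: "rs \<in> words A (Suc (Suc n))" for rs
  proof -
    have "b_dual \<phi>1 rs = b_dual \<phi> rs - b_dual (on_words A (Suc n) (b_dual \<psi>1)) rs"
      by (simp add: \<phi>1_def b_dual_def right_diff_distrib sum_subtractf)
    then show ?thesis
      using closed[OF rs] by (simp add: b_dual_on_words[OF rs] b_dual_b_dual)
  qed
  moreover have "\<phi>1 rs = 0" if "rs \<in> words A (Suc n)" "rs ! 0 * p = rs ! 0" for rs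
    using that \<psi>1(2) by (simp add: \<phi>1_def)
  ultimately obtain \<psi>2 where \<psi>2: "\<psi>2 \<in> relative_maps n" "\<And>rs. rs \<in> words A (Suc n) \<Longrightarrow> b_dual \<psi>2 rs = \<phi>1 rs"
    using b_column_exact_right by blast
  have "b_dual (\<lambda>rs. \<psi>1 rs + \<psi>2 rs) rs = \<phi> rs" if "rs \<in> words A (Suc n)" for rs
    using \<psi>2(2)[OF that] that by (simp add: b_dual_def distrib_left sum.distrib \<phi>1_def)
  then show ?thesis
    using relative_add[OF \<psi>1(1) \<psi>2(1)] by blast
qed

lemma column_exact:
  assumes \<phi>: "\<phi> \<in> relative_maps (Suc n)"
    and closed: "\<And>rs. rs \<in> words A (Suc (Suc n)) \<Longrightarrow> vert_dual i \<phi> rs = 0"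
  shows "\<exists>\<psi>\<in>relative_maps n. \<forall>rs\<in>words A (Suc n). vert_dual i \<psi> rs = \<phi> rs"
proof (cases "even i")
  case True
  then show ?thesis
    using b_column_exact[OF \<phi>] closed by (simp add: vert_dual_def)
next
  case False
  then obtain \<psi> where \<psi>: "\<psi> \<in> relative_maps n" "\<And>rs. rs \<in> words A (Suc n) \<Longrightarrow> bprime_dual \<psi> rs = \<phi> rs"
    using bprime_column_exact[OF \<phi>] closed by (auto simp: vert_dual_def)
  then have "\<forall>rs\<in>words A (Suc n). vert_dual i (\<lambda>rs. - \<psi> rs) rs = \<phi> rs"
    using False by (simp add: vert_dual_def bprime_dual_def sum_negf)
  then show ?thesis
    using relative_uminus[OF \<psi>(1)] by blast
qed

end

section \<open>Cohomology of triangular algebras\<close>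

fun coboundary_maps ::
    "('k::field \<Rightarrow> 'a::ring \<Rightarrow> 'a) \<Rightarrow> 'a set \<Rightarrow> nat \<Rightarrow> (nat \<Rightarrow> 'a list \<Rightarrow> 'k) set" where
  "coboundary_maps scale A 0 = {0}"
| "coboundary_maps scale A (Suc n) = total_diff A n ` cochains scale A n"

definition cocycle_maps ::
    "('k::field \<Rightarrow> 'a::ring \<Rightarrow> 'a) \<Rightarrow> 'a set \<Rightarrow> nat \<Rightarrow> (nat \<Rightarrow> 'a list \<Rightarrow> 'k) set" where
  "cocycle_maps scale A n = {c \<in> cochains scale A n. total_diff A n c = 0}"

text \<open>Only the letters are tested: the condition on the length is inherited from
  \<open>c\<close>, which vanishes on words of the wrong length.\<close>

definition pullback :: "'a set \<Rightarrow> ('a \<Rightarrow> 'b) \<Rightarrow> (nat \<Rightarrow> 'b list \<Rightarrow> 'k::zero) \<Rightarrow> nat \<Rightarrow> 'a list \<Rightarrow> 'k" where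
  "pullback A f c i rs = (if set rs \<subseteq> A then c i (map f rs) else 0)"

text \<open>Units need not be preserved. Neither the inclusion of a corner nor x \<mapsto> p x as a
  map from A to A preserves them in general, and the differentials involve products and rotations
  only.\<close>

definition algebra_hom ::
    "('k \<Rightarrow> 'a::ring \<Rightarrow> 'a) \<Rightarrow> 'a set \<Rightarrow> 'a set \<Rightarrow> ('a \<Rightarrow> 'a) \<Rightarrow> bool" where
  "algebra_hom scale A B f \<longleftrightarrow> linear_on A scale B scale f \<and> (\<forall>x\<in>A. \<forall>y\<in>A. f (x * y) = f x * f y)"

lemma vert_dual_diff: "vert_dual p (\<lambda>rs. \<phi> rs - \<psi> rs) rs = vert_dual p \<phi> rs - vert_dual p \<psi> rs"
  by (simp add: vert_dual_def b_dual_def bprime_dual_def right_diff_distrib sum_subtractf)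

lemma total_diff_add: "total_diff A n (c + d) = total_diff A n c + total_diff A n d"
proof (intro ext)
  fix p and rs :: "'a list"
  have "rs \<noteq> []" if "rs \<in> words A (Suc m)" for m
    using that by (auto simp: words_def)
  then show "total_diff A n (c + d) p rs = (total_diff A n c + total_diff A n d) p rs"
    by (auto simp: total_diff_def plus_fun_def vert_dual_add hor_dual_add)
qed

lemma total_diff_cmult: "total_diff A n (\<lambda>p rs. a * c p rs) = (\<lambda>p rs. a * total_diff A n c p rs)"
proof (intro ext)
  fix p and rs :: "'a list"
  have "rs \<noteq> []" if "rs \<in> words A (Suc m)" for m
    using that by (auto simp: words_def)
  then show "total_diff A n (\<lambda>p rs. a * c p rs) p rs = a * total_diff A n c p rs"
    by (auto simp: total_diff_def vert_dual_cmult hor_dual_cmult distrib_left)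
qed

lemma cochains_add: "c \<in> cochains scale A n \<Longrightarrow> d \<in> cochains scale A n \<Longrightarrow> c + d \<in> cochains scale A n"
  by (simp add: cochains_def multilinear_maps_def plus_fun_def zero_fun_def multilinear_on_add)

lemma cochains_cmult: "c \<in> cochains scale A n \<Longrightarrow> (\<lambda>p rs. a * c p rs) \<in> cochains scale A n"
  by (simp add: cochains_def multilinear_maps_def zero_fun_def multilinear_on_cmult)

lemma cochains_zero: "0 \<in> cochains scale A n"
  by (simp add: cochains_def multilinear_maps_def multilinear_on_def)

lemma coboundary_maps_add:
  assumes "c \<in> coboundary_maps scale A n" "d \<in> coboundary_maps scale A n"
  shows "c + d \<in> coboundary_maps scale A n"
  using assms by (cases n) (auto simp: total_diff_add[symmetric] intro: imageI cochains_add)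

lemma coboundary_maps_cmult:
  "c \<in> coboundary_maps scale A n \<Longrightarrow> (\<lambda>p rs. a * c p rs) \<in> coboundary_maps scale A n"
  by (cases n) (auto simp: total_diff_cmult[symmetric] zero_fun_def intro: imageI cochains_cmult)

lemma coboundary_maps_diff:
  assumes "c \<in> coboundary_maps scale A n" "d \<in> coboundary_maps scale A n"
  shows "c - d \<in> coboundary_maps scale A n"
  using coboundary_maps_add[OF assms(1) coboundary_maps_cmult[OF assms(2), of "- 1"]]
  by (simp add: plus_fun_def fun_diff_def)

lemma algebra_hom_in: "algebra_hom scale A B f \<Longrightarrow> x \<in> A \<Longrightarrow> f x \<in> B"
  by (simp add: algebra_hom_def linear_on_def)

lemma algebra_hom_mono: "algebra_hom scale A B f \<Longrightarrow> A' \<subseteq> A \<Longrightarrow> (\<And>x. x \<in> A' \<Longrightarrow> f x \<in> B') \<Longrightarrow> algebra_hom scale A' B' f"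
  by (auto simp: algebra_hom_def linear_on_def subset_iff)

lemma pullback_pullback:
  assumes "\<And>x. x \<in> A \<Longrightarrow> f x \<in> B"
  shows "pullback A f (pullback B g c) = pullback A (\<lambda>x. g (f x)) c"
  using assms by (intro ext) (auto simp: pullback_def comp_def subset_iff)

lemma pullback_cong: "(\<And>x. x \<in> A \<Longrightarrow> f x = g x) \<Longrightarrow> pullback A f c = pullback A g c"
  by (intro ext) (auto simp: pullback_def subset_iff intro!: arg_cong[where f = "c _"])

lemma pullback_add: "pullback A f (c + d) = pullback A f c + (pullback A f d :: _ \<Rightarrow> _ \<Rightarrow> 'k::ab_group_add)"
  by (intro ext) (simp add: pullback_def plus_fun_def)

lemma pullback_diff: "pullback A f (c - d) = pullback A f c - (pullback A f d :: _ \<Rightarrow> _ \<Rightarrow> 'k::ab_group_add)"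
  by (intro ext) (simp add: pullback_def fun_diff_def)

lemma pullback_cmult: "pullback A f (\<lambda>p rs. a * c p rs) = (\<lambda>p rs. a * pullback A f c p rs :: 'k::field)"
  by (intro ext) (simp add: pullback_def)

lemma pullback_0: "pullback A f 0 = 0"
  by (intro ext) (simp add: pullback_def)

lemma pullback_id: "c \<in> cochains scale A n \<Longrightarrow> pullback A (\<lambda>x. x) c = c"
proof (intro ext)
  fix p rs assume c: "c \<in> cochains scale A n"
  show "pullback A (\<lambda>x. x) c p rs = c p rs"
  proof (cases "p \<le> n")
    case True
    then show ?thesis
      using c by (auto simp: pullback_def cochains_def multilinear_maps_def words_def)
  qed (use c in \<open>simp add: pullback_def cochains_def\<close>)
qed

section \<open>Functoriality of multilinear cochains\<close>

context unital_algebra begin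

lemma pullback_cochains:
  assumes f: "algebra_hom scale A B f" and c: "c \<in> cochains scale B n"
  shows "pullback A f c \<in> cochains scale A n"
proof -
  have "pullback A f c i \<in> multilinear_maps scale A (Suc (n - i))" if "i \<le> n" for i
  proof -
    have ci: "c i \<in> multilinear_maps scale B (Suc (n - i))"
      using c that by (simp add: cochains_def)
    have "multilinear_on scale A (Suc (n - i)) (\<lambda>rs. c i (map f rs))"
      using ci f
      by (intro multilinear_on_compI[where B = B and m' = "Suc (n - i)"] slotwise_linear_map)
        (auto simp: multilinear_maps_def algebra_hom_def)
    then have "multilinear_on scale A (Suc (n - i)) (pullback A f c i)"
      by (rule multilinear_on_cong[THEN iffD1, rotated -1])
        (auto simp: pullback_def words_def carrier_add carrier_scale)
    moreover have "pullback A f c i rs = 0" if "rs \<notin> words A (Suc (n - i))" for rs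
    proof (cases "set rs \<subseteq> A")
      case True
      then have "map f rs \<notin> words B (Suc (n - i))"
        using that by (auto simp: words_def)
      then show ?thesis
        using ci by (simp add: pullback_def multilinear_maps_def)
    qed (simp add: pullback_def)
    ultimately show ?thesis
      by (simp add: multilinear_maps_def)
  qed
  moreover have "pullback A f c i = 0" if "n < i" for i
    using c that by (intro ext) (simp add: pullback_def cochains_def)
  ultimately show ?thesis
    by (simp add: cochains_def)
qed

lemma total_diff_pullback:
  assumes f: "algebra_hom scale A B f"
  shows "total_diff A n (pullback A f c) = pullback A f (total_diff B n c)"
proof (intro ext)
  fix i rs
  have hom: "\<And>x y. x \<in> A \<Longrightarrow> y \<in> A \<Longrightarrow> f (x * y) = f x * f y" and closed: "\<And>x. x \<in> A \<Longrightarrow> f x \<in> B"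
    using f by (auto simp: algebra_hom_def linear_on_def)
  show "total_diff A n (pullback A f c) i rs = pullback A f (total_diff B n c) i rs"
  proof (cases "i \<le> Suc n \<and> rs \<in> words A (Suc (Suc n - i))")
    case True
    then have i: "i \<le> Suc n" and rs: "rs \<in> words A (Suc (Suc n - i))" and ne: "rs \<noteq> []"
      by (auto simp: words_def)
    have sub: "set rs \<subseteq> A" and fw: "map f rs \<in> words B (Suc (Suc n - i))"
      using rs closed by (auto simp: words_def)
    have vert: "vert_dual i (pullback A f c i) rs = vert_dual i (c i) (map f rs)" if "i \<le> n"
    proof -
      have "pullback A f c i (face j rs) = c i (face j (map f rs))" if "j < length rs" for j
      proof -
        have "j < Suc (Suc n - i)" "2 \<le> Suc (Suc n - i)"
          using that rs \<open>i \<le> n\<close> by (auto simp: words_def)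
        then have "face j rs \<in> words A (Suc n - i)" "map f (face j rs) = face j (map f rs)"
          using face_words[OF rs mult_closed] map_face[OF rs hom] by auto
        then show ?thesis
          by (simp add: pullback_def words_def)
      qed
      then show ?thesis
        by (simp add: vert_dual_def b_dual_def bprime_dual_def)
    qed
    have rot_map: "(rot ^^ k) (map f rs) = map f ((rot ^^ k) rs)" for k
    proof (induction k)
      case (Suc k)
      have "(rot ^^ k) rs \<noteq> []"
        using ne length_funpow_rot by (metis length_0_conv)
      then show ?case
        using Suc by (simp add: map_rot)
    qed simp
    have "pullback A f c l ((rot ^^ k) rs) = c l ((rot ^^ k) (map f rs))" for k l
      using funpow_rot_words[OF rs, of k] by (simp add: pullback_def words_def rot_map)
    from this this[of _ 1] sub ne have hor: "hor_dual l (pullback A f c l) rs = hor_dual l (c l) (map f rs)" for l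
      by (simp add: hor_dual_def t_dual_def N_dual_def funpow_t_dual pullback_def)
    show ?thesis
      using i rs fw sub vert hor by (simp add: total_diff_def pullback_def[of A f "total_diff B n c"])
  next
    case False
    then show ?thesis
      by (auto simp: total_diff_def pullback_def words_def)
  qed
qed

lemma pullback_coboundary:
  assumes f: "algebra_hom scale A B f" and c: "c \<in> coboundary_maps scale B n"
  shows "pullback A f c \<in> coboundary_maps scale A n"
  using c pullback_cochains[OF f]
  by (cases n) (auto simp: pullback_0 total_diff_pullback[OF f, symmetric])

lemma pullback_cocycle:
  assumes f: "algebra_hom scale A B f" and c: "c \<in> cocycle_maps scale B n"
  shows "pullback A f c \<in> cocycle_maps scale A n"
  using c pullback_cochains[OF f] by (simp add: cocycle_maps_def total_diff_pullback[OF f] pullback_0)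

end

section \<open>The staircase, and detection of coboundaries on the two corners\<close>

context triangular_algebra begin

text \<open>The usual argument for a first quadrant bicomplex with exact columns; the cochain \<open>a\<close> is
  built one column at a time.\<close>

lemma relative_cocycle_exact:
  assumes c: "\<And>i. i \<le> n \<Longrightarrow> c i \<in> relative_maps (Suc (n - i))" and c0: "\<And>i. n < i \<Longrightarrow> c i = 0"
    and closed: "total_diff A n c = 0"
  shows "c \<in> coboundary_maps scale A n"
proof -
  \<comment> \<open>\<open>h a i\<close> is what column i - 1 of \<open>a\<close> contributes to
    column i. The equation to be solved in column i is v(a_i) + \<open>h a i\<close> = c_i, with v
    the vertical map.\<close>
  define h where "h a i rs = (if i = 0 then 0 else hor_dual (i - 1) (a (i - 1)) rs)"
    for a :: "nat \<Rightarrow> 'a list \<Rightarrow> 'k" and i rs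
  have ne: "rs \<noteq> []" if "rs \<in> words A (Suc m)" for rs :: "'a list" and m
    using that by (auto simp: words_def)
  have "\<exists>a. \<forall>i<j. a i \<in> relative_maps (n - i) \<and> (\<forall>rs\<in>words A (Suc (n - i)). vert_dual i (a i) rs + h a i rs = c i rs)"
    if "j \<le> Suc n" for j
    using that
  proof (induction j)
    case (Suc j)
    then obtain a where a: "\<And>i. i < j \<Longrightarrow> a i \<in> relative_maps (n - i)"
      "\<And>i rs. i < j \<Longrightarrow> rs \<in> words A (Suc (n - i)) \<Longrightarrow> vert_dual i (a i) rs + h a i rs = c i rs"
      by (meson Suc_leD)
    have jn: "j \<le> n"
      using Suc.prems by simp
    define \<phi> where "\<phi> rs = c j rs - on_words A (Suc (n - j)) (h a j) rs" for rs
    have "on_words A (Suc (n - j)) (h a j) \<in> relative_maps (Suc (n - j))"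
    proof (cases j)
      case 0
      then have "on_words A (Suc (n - j)) (h a j) = (\<lambda>rs. 0)"
        by (auto simp: h_def on_words_def)
      then show ?thesis
        using relative_zero by simp
    next
      case (Suc i)
      then have "h a j = hor_dual i (a i)" "a i \<in> relative_maps (Suc (n - j))"
        using a(1)[of i] jn by (auto simp: h_def Suc_diff_Suc)
      then show ?thesis
        by (simp add: hor_relative)
    qed
    then have \<phi>: "\<phi> \<in> relative_maps (Suc (n - j))"
      unfolding \<phi>_def by (intro relative_diff c jn)
    \<comment> \<open>Closedness of c gives v(c_j) = -h(c_{j-1}), and c_{j-1} = v(a_{j-1}) +
      h(a_{j-2}) by the previous column. Now h h = 0 and h v = -v h yield v(c_j) = v(h(a_{j-1})), so
      the remainder \<phi> is closed.\<close>
    have "vert_dual j \<phi> rs = 0" if rs: "rs \<in> words A (Suc (Suc (n - j)))" for rs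
    proof -
      have "vert_dual j \<phi> rs = vert_dual j (\<lambda>rs. c j rs - h a j rs) rs"
        using rs by (intro vert_dual_cong) (auto simp: \<phi>_def)
      also have "\<dots> = vert_dual j (c j) rs - vert_dual j (h a j) rs"
        by (rule vert_dual_diff)
      finally have 1: "vert_dual j \<phi> rs = vert_dual j (c j) rs - vert_dual j (h a j) rs" .
      have 2: "vert_dual j (c j) rs + (if 1 \<le> j then hor_dual (j - 1) (c (j - 1)) rs else 0) = 0"
        using fun_cong[OF fun_cong[OF closed, of j], of rs] jn rs
        by (simp add: total_diff_def Suc_diff_le split: if_splits)
      show ?thesis
      proof (cases j)
        case 0
        then show ?thesis
          using 1 2 by (simp add: h_def vert_dual_def b_dual_def)
      next
        case (Suc i)
        have i: "i < j" "Suc (n - i) = Suc (Suc (n - j))"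
          using Suc jn by auto
        have "hor_dual i (c i) rs = hor_dual i (\<lambda>rs. vert_dual i (a i) rs + h a i rs) rs"
          using rs a(2)[OF i(1)] i(2) by (intro hor_dual_cong[OF rs]) auto
        also have "\<dots> = hor_dual i (vert_dual i (a i)) rs + hor_dual i (h a i) rs"
          by (rule hor_dual_add[OF ne[OF rs]])
        also have "hor_dual i (h a i) rs = 0"
        proof (cases i)
          case 0
          then show ?thesis
            by (simp add: h_def hor_dual_def t_dual_def)
        next
          case (Suc l)
          then have "h a i = hor_dual l (a l)"
            by (auto simp: h_def)
          then show ?thesis
            using Suc hor_hor_dual[OF ne[OF rs]] by simp
        qed
        also have "hor_dual i (vert_dual i (a i)) rs = - vert_dual j (h a j) rs"
        proof -
          have "h a j = hor_dual i (a i)"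
            using Suc by (auto simp: h_def)
          then show ?thesis
            using Suc hor_vert_dual[of rs i "a i"] length_words[OF rs] by simp
        qed
        finally show ?thesis
          using 1 2 Suc by simp
      qed
    qed
    from column_exact[OF \<phi> this] obtain \<psi> where
      \<psi>: "\<psi> \<in> relative_maps (n - j)" "\<And>rs. rs \<in> words A (Suc (n - j)) \<Longrightarrow> vert_dual j \<psi> rs = \<phi> rs"
      by blast
    have h_upd: "h (a(j := \<psi>)) i = h a i" if "i \<le> j" for i
      using that by (auto simp: h_def fun_eq_iff)
    show ?case
    proof (intro exI[of _ "a(j := \<psi>)"] allI impI)
      fix i assume "i < Suc j"
      then consider "i = j" | "i < j"
        by linarith
      then show "(a(j := \<psi>)) i \<in> relative_maps (n - i) \<and>
          (\<forall>rs\<in>words A (Suc (n - i)). vert_dual i ((a(j := \<psi>)) i) rs + h (a(j := \<psi>)) i rs = c i rs)"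
        using a \<psi> h_upd by cases (auto simp: \<phi>_def)
    qed
  qed simp
  from this[of "Suc n"] obtain a where a: "\<And>i. i \<le> n \<Longrightarrow> a i \<in> relative_maps (n - i)"
      "\<And>i rs. i \<le> n \<Longrightarrow> rs \<in> words A (Suc (n - i)) \<Longrightarrow> vert_dual i (a i) rs + h a i rs = c i rs"
    by (auto simp: less_Suc_eq_le)
  \<comment> \<open>Column n of c lives on words of length 1, hence \<open>a n\<close> on the empty
    word, where relative maps vanish. So columns 0 to n - 1 of \<open>a\<close> alone bound c, and
    they form a cochain of degree n - 1.\<close>
  have a_n: "vert_dual n (a n) rs = 0" for rs
    using relative_maps_0[of "a n"] a(1)[of n] by (simp add: vert_dual_def b_dual_def bprime_dual_def)
  have c_out: "c i rs = 0" if "i \<le> n" "rs \<notin> words A (Suc (n - i))" for i rs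
    using relative_mapsD(2)[OF c] that by blast
  show ?thesis
  proof (cases n)
    case 0
    have "c i rs = 0" for i rs
      using c0[of i] c_out[of i rs] a(2)[of i rs] a_n[of rs] 0 by (cases "i = 0"; cases "rs \<in> words A 1") (auto simp: h_def)
    then show ?thesis
      using 0 by (auto simp: fun_eq_iff)
  next
    case (Suc m)
    define a' where "a' i = (if i \<le> m then a i else 0)" for i
    have "a i \<in> multilinear_maps scale A (Suc (m - i))" if "i \<le> m" for i
      using a(1)[of i] that Suc by (simp add: relative_maps_def Suc_diff_le)
    then have "a' \<in> cochains scale A m"
      by (simp add: cochains_def a'_def)
    moreover have "total_diff A m a' = c"
    proof (intro ext)
      fix i rs
      show "total_diff A m a' i rs = c i rs"
      proof (cases "i \<le> n \<and> rs \<in> words A (Suc (n - i))")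
        case True
        then show ?thesis
          using a(2)[of i rs] a_n[of rs] Suc by (cases "i = n") (auto simp: total_diff_def a'_def h_def)
      next
        case False
        then show ?thesis
          using c0[of i] c_out[of i rs] Suc by (cases "i \<le> n") (auto simp: total_diff_def)
      qed
    qed
    ultimately show ?thesis
      using Suc by auto
  qed
qed

lemma p_algebra_hom: "algebra_hom scale A (corner A p p) ((*) p)"
proof -
  have "p * x \<in> corner A p p" if "x \<in> A" for x
    unfolding corner_def using that p_mult_p[OF that] by (auto simp: mult.assoc intro!: exI[of _ x])
  then show ?thesis
    using p_mult_hom linear_on_mult_left[OF p_in] by (simp add: algebra_hom_def linear_on_def)
qed

lemma q_algebra_hom: "algebra_hom scale A (corner A q q) (\<lambda>x. x * q)"
proof -
  have "x * q \<in> corner A q q" if "x \<in> A" for x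
    unfolding corner_def using that q_mult_q[OF that] by (auto simp: mult.assoc intro!: exI[of _ x])
  then show ?thesis
    using q_mult_hom linear_on_mult_right[OF q_in] by (simp add: algebra_hom_def linear_on_def)
qed

text \<open>Pulling the two corner restrictions of c back along the projections gives
  \<open>cp\<close> and \<open>cq\<close>, which are coboundaries by hypothesis. The difference d =
  c - cp - cq vanishes on the words of either corner, so the staircase applies to it.\<close>

lemma coboundary_if_corner_coboundaries:
  assumes c: "c \<in> cocycle_maps scale A n"
    and P: "pullback (corner A p p) (\<lambda>x. x) c \<in> coboundary_maps scale (corner A p p) n"
    and Q: "pullback (corner A q q) (\<lambda>x. x) c \<in> coboundary_maps scale (corner A q q) n"
  shows "c \<in> coboundary_maps scale A n"
proof -
  define cp where "cp = pullback A ((*) p) c"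
  define cq where "cq = pullback A (\<lambda>x. x * q) c"
  have homs: "algebra_hom scale A A ((*) p)" "algebra_hom scale A A (\<lambda>x. x * q)"
    using algebra_hom_mono[OF p_algebra_hom, of A A] algebra_hom_mono[OF q_algebra_hom, of A A]
      p_in q_in by (auto simp: mult_closed)
  have cc: "c \<in> cochains scale A n" and dc: "total_diff A n c = 0"
    using c by (auto simp: cocycle_maps_def)
  have cpq: "cp \<in> cochains scale A n" "cq \<in> cochains scale A n"
    unfolding cp_def cq_def using homs cc by (auto intro: pullback_cochains)
  have dpq: "total_diff A n cp = 0" "total_diff A n cq = 0"
    unfolding cp_def cq_def by (simp_all add: total_diff_pullback[OF homs(1)] total_diff_pullback[OF homs(2)] dc pullback_0)
  have "cp = pullback A ((*) p) (pullback (corner A p p) (\<lambda>x. x) c)"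
    unfolding cp_def using algebra_hom_in[OF p_algebra_hom] by (subst pullback_pullback) auto
  then have Bp: "cp \<in> coboundary_maps scale A n"
    using pullback_coboundary[OF p_algebra_hom P] by simp
  have "cq = pullback A (\<lambda>x. x * q) (pullback (corner A q q) (\<lambda>x. x) c)"
    unfolding cq_def using algebra_hom_in[OF q_algebra_hom] by (subst pullback_pullback) auto
  then have Bq: "cq \<in> coboundary_maps scale A n"
    using pullback_coboundary[OF q_algebra_hom Q] by simp
  define d where "d i rs = c i rs - (cp i rs + cq i rs)" for i rs
  have d_eq: "d + (cp + cq) = c"
    by (intro ext) (simp add: d_def plus_fun_def)
  have "total_diff A n d + (total_diff A n cp + total_diff A n cq) = total_diff A n c"
    by (simp only: total_diff_add[symmetric] d_eq)
  then have dd: "total_diff A n d = 0"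
    using dpq dc by simp
  have "d \<in> coboundary_maps scale A n"
  proof (rule relative_cocycle_exact[OF _ _ dd])
    fix i assume "n < i"
    then show "d i = 0"
      using cc cpq by (intro ext) (simp add: d_def cochains_def)
  next
    fix i assume i: "i \<le> n"
    have m: "c i \<in> multilinear_maps scale A (Suc (n - i))" "cp i \<in> multilinear_maps scale A (Suc (n - i))"
      "cq i \<in> multilinear_maps scale A (Suc (n - i))"
      using cc cpq i by (auto simp: cochains_def)
    have "d i \<in> multilinear_maps scale A (Suc (n - i))"
      using m unfolding d_def multilinear_maps_def by (auto intro!: multilinear_on_diff multilinear_on_add)
    moreover have "d i (map ((*) p) rs) = 0 \<and> d i (map (\<lambda>x. x * q) rs) = 0" if rs: "rs \<in> words A (Suc (n - i))" for rs
    proof -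
      have sub: "set (map ((*) p) rs) \<subseteq> A" "set (map (\<lambda>x. x * q) rs) \<subseteq> A"
        using map_p_words[OF rs] map_q_words[OF rs] by (simp_all add: words_def)
      have idem: "map ((*) p) (map ((*) p) rs) = map ((*) p) rs" "map (\<lambda>x. x * q) (map (\<lambda>x. x * q) rs) = map (\<lambda>x. x * q) rs"
        using rs by (simp_all add: idem_simps)
      \<comment> \<open>The two projections compose to x \<mapsto> p x q = 0, so \<open>cq\<close>
        vanishes on words in \<open>p A p\<close> and \<open>cp\<close> on words in
        \<open>q A q\<close>. There is always a letter to be killed, as the word length is a
        successor.\<close>
      have "c i (map (\<lambda>x. x * q) (map ((*) p) rs)) = 0"
        by (rule multilinear_zero_entry[of _ _ _ 0])
          (use m rs map_q_words[OF map_p_words[OF rs]] in \<open>auto simp: multilinear_maps_def words_nth p_mult_q mult.assoc\<close>)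
      moreover have "c i (map ((*) p) (map (\<lambda>x. x * q) rs)) = 0"
        by (rule multilinear_zero_entry[of _ _ _ 0])
          (use m rs map_p_words[OF map_q_words[OF rs]] in \<open>auto simp: multilinear_maps_def words_nth p_mult_q mult.assoc\<close>)
      ultimately show ?thesis
        using sub idem by (simp add: d_def cp_def cq_def pullback_def del: map_map)
    qed
    ultimately show "d i \<in> relative_maps (Suc (n - i))"
      by (simp add: relative_maps_def)
  qed
  then have "d + (cp + cq) \<in> coboundary_maps scale A n"
    using Bp Bq by (intro coboundary_maps_add)
  then show ?thesis
    by (simp add: d_eq)
qed

end

section \<open>The universal property of tensor powers, phrased with functionals\<close>

section \<open>Functionals on tensor powers as multilinear maps\<close>

definition free_eval :: "('x \<Rightarrow> 'k::field) \<Rightarrow> ('x \<Rightarrow>\<^sub>0 'k) \<Rightarrow> 'k" where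
  "free_eval \<phi> x = (\<Sum>i\<in>Poly_Mapping.keys x. Poly_Mapping.lookup x i * \<phi> i)"

lemma free_eval_superset:
  assumes "finite S" "Poly_Mapping.keys x \<subseteq> S"
  shows "free_eval \<phi> x = (\<Sum>i\<in>S. Poly_Mapping.lookup x i * \<phi> i)"
  unfolding free_eval_def using assms by (intro sum.mono_neutral_left) (auto simp: in_keys_iff)

lemma free_eval_add: "free_eval \<phi> (x + y) = free_eval \<phi> x + free_eval \<phi> y"
proof -
  let ?S = "Poly_Mapping.keys x \<union> Poly_Mapping.keys y"
  have "free_eval \<phi> z = (\<Sum>i\<in>?S. Poly_Mapping.lookup z i * \<phi> i)" if "z \<in> {x, y, x + y}" for z
    using that Poly_Mapping.keys_add[of x y] by (intro free_eval_superset) auto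
  then show ?thesis
    by (simp add: lookup_add distrib_right sum.distrib)
qed

lemma free_eval_fscale: "free_eval \<phi> (fscale c x) = c * free_eval \<phi> x"
proof -
  have "Poly_Mapping.keys (fscale c x) \<subseteq> Poly_Mapping.keys x"
    by (auto simp: in_keys_iff)
  then show ?thesis
    by (simp add: free_eval_superset[OF finite_keys] sum_distrib_left mult.assoc free_eval_def[of \<phi> x])
qed

lemma free_eval_0 [simp]: "free_eval \<phi> 0 = 0"
  by (simp add: free_eval_def)

lemma free_eval_uminus: "free_eval \<phi> (- x) = - free_eval \<phi> x"
  using free_eval_add[of \<phi> x "- x"] by (simp add: eq_neg_iff_add_eq_0 add.commute)

lemma free_eval_diff: "free_eval \<phi> (x - y) = free_eval \<phi> x - free_eval \<phi> y"
  using free_eval_add[of \<phi> x "- y"] by (simp add: free_eval_uminus)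

lemma free_eval_sum: "free_eval \<phi> (\<Sum>i\<in>I. x i) = (\<Sum>i\<in>I. free_eval \<phi> (x i))"
  by (induction I rule: infinite_finite_induct) (auto simp: free_eval_add)

lemma free_eval_single [simp]: "free_eval \<phi> (Poly_Mapping.single i c) = c * \<phi> i"
  by (auto simp: free_eval_def)

lemma free_eval_lin_ext: "free_eval \<phi> (lin_ext G x) = free_eval (\<lambda>i. free_eval \<phi> (G i)) x"
  by (simp add: lin_ext_def free_eval_sum free_eval_fscale) (simp add: free_eval_def)

lemma free_eval_cong: "(\<And>i. i \<in> Poly_Mapping.keys x \<Longrightarrow> \<phi> i = \<psi> i) \<Longrightarrow> free_eval \<phi> x = free_eval \<psi> x"
  by (simp add: free_eval_def)

lemma free_eval_add_fun: "free_eval (\<lambda>i. \<phi> i + \<psi> i) x = free_eval \<phi> x + free_eval \<psi> x"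
  by (simp add: free_eval_def distrib_left sum.distrib)

lemma free_eval_cmult_fun: "free_eval (\<lambda>i. c * \<phi> i) x = c * free_eval \<phi> x"
  by (simp add: free_eval_def sum_distrib_left mult.left_commute)

lemma free_eval_diff_fun: "free_eval (\<lambda>i. \<phi> i - \<psi> i) x = free_eval \<phi> x - free_eval \<psi> x"
  by (simp add: free_eval_def right_diff_distrib sum_subtractf)

lemma free_eval_uminus_fun: "free_eval (\<lambda>i. - \<phi> i) x = - free_eval \<phi> x"
  by (simp add: free_eval_def sum_negf)

lemma free_eval_sum_fun: "free_eval (\<lambda>i. \<Sum>j\<in>J. \<phi> j i) x = (\<Sum>j\<in>J. free_eval (\<phi> j) x)"
  by (simp add: free_eval_def sum_distrib_left) (rule sum.swap)

lemma free_eval_eqI: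
  fixes x y :: "'x \<Rightarrow>\<^sub>0 'k::field"
  assumes "\<And>\<phi>. free_eval \<phi> x = free_eval \<phi> y"
  shows "x = y"
proof (rule poly_mapping_eqI)
  fix i
  have "free_eval (\<lambda>j. if j = i then 1 else 0) z = Poly_Mapping.lookup z i" for z :: "'x \<Rightarrow>\<^sub>0 'k"
    by (auto simp: free_eval_def in_keys_iff if_distrib cong: if_cong)
  then show "Poly_Mapping.lookup x i = Poly_Mapping.lookup y i"
    using assms by metis
qed

lemma poly_mapping_decomposition:
  fixes x :: "'x \<Rightarrow>\<^sub>0 'k::field"
  shows "x = (\<Sum>i\<in>Poly_Mapping.keys x. fscale (Poly_Mapping.lookup x i) (Poly_Mapping.single i 1))"
  by (rule free_eval_eqI) (simp add: free_eval_sum free_eval_fscale, simp add: free_eval_def)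

lemma lin_ext_add: "lin_ext G (x + y) = lin_ext G x + lin_ext G y"
  by (rule free_eval_eqI) (simp add: free_eval_lin_ext free_eval_add)

lemma free_on_iff: "x \<in> free_on A m \<longleftrightarrow> Poly_Mapping.keys x \<subseteq> words A m"
  by (auto simp: free_on_def words_def)

lemma subspace_free_on: "fscale.subspace (free_on A m :: ('a list \<Rightarrow>\<^sub>0 'k::field) set)"
proof (rule fscale.subspaceI)
  show "x + y \<in> free_on A m" if "x \<in> free_on A m" "y \<in> free_on A m" for x y :: "'a list \<Rightarrow>\<^sub>0 'k"
    using that Poly_Mapping.keys_add[of x y] by (auto simp: free_on_iff)
  show "fscale c x \<in> free_on A m" if "x \<in> free_on A m" for c and x :: "'a list \<Rightarrow>\<^sub>0 'k"
    using that by (auto simp: free_on_iff in_keys_iff subset_iff)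
qed (simp add: free_on_def)

lemma single_free_on: "rs \<in> words A m \<Longrightarrow> Poly_Mapping.single rs c \<in> free_on A m"
  by (simp add: free_on_iff)

lemma lin_ext_free_on:
  assumes "x \<in> free_on A m'" "\<And>rs. rs \<in> words A m' \<Longrightarrow> G rs \<in> free_on A m"
  shows "lin_ext G x \<in> free_on A m"
  unfolding lin_ext_def using assms
  by (intro fscale.subspace_sum[OF subspace_free_on] fscale.subspace_scale[OF subspace_free_on])
    (auto simp: free_on_iff subset_iff)

lemma subspace_tensor_rels: "fscale.subspace (tensor_rels scale A m)"
  by (simp add: tensor_rels_def fscale.subspace_span)

text \<open>A basis of W stays independent when x is added, so a linear functional can be 1 at x and
  0 on W. Every functional on the free space is \<open>free_eval\<close> of its values on single
  words.\<close>

lemma functional_separating: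
  fixes x :: "'x \<Rightarrow>\<^sub>0 'k::field"
  assumes W: "fscale.subspace W" and x: "x \<notin> W"
  shows "\<exists>\<phi>. free_eval \<phi> x = 1 \<and> (\<forall>w\<in>W. free_eval \<phi> w = 0)"
proof -
  interpret vector_space_pair "fscale :: 'k \<Rightarrow> ('x \<Rightarrow>\<^sub>0 'k) \<Rightarrow> _" "(*) :: 'k \<Rightarrow> 'k \<Rightarrow> 'k"
    by unfold_locales (auto simp: algebra_simps)
  obtain B where B: "B \<subseteq> W" "fscale.independent B" "W \<subseteq> fscale.span B"
    using fscale.maximal_independent_subset by blast
  have sB: "fscale.span B = W"
    using B fscale.span_minimal[OF B(1) W] by blast
  then have "fscale.independent (insert x B)"
    using fscale.independent_insertI B x by blast
  from linear_independent_extend[OF this, of "\<lambda>y. if y = x then 1 else 0"]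
  obtain g where g: "Vector_Spaces.linear fscale (*) g" "\<forall>y\<in>insert x B. g y = (if y = x then 1 else 0)"
    by blast
  then interpret g: Vector_Spaces.linear fscale "(*)" g
    by simp
  have gw: "g w = 0" if "w \<in> W" for w
  proof (rule linear_eq_0_on_span[OF g(1)])
    show "g y = 0" if "y \<in> B" for y
      using g(2) that B x by auto
  qed (use that sB in simp)
  have "free_eval (\<lambda>i. g (Poly_Mapping.single i 1)) x' = g x'" for x'
    unfolding free_eval_def by (subst (3) poly_mapping_decomposition) (simp only: g.sum g.scale)
  moreover have "g x = 1"
    using g(2) by simp
  ultimately show ?thesis
    using gw by (intro exI[of _ "\<lambda>i. g (Poly_Mapping.single i 1)"]) simp
qed

text \<open>A representative of the coset is chosen arbitrarily; for multilinear \<phi> the value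
  does not depend on it (\<open>dual_of_map_coset\<close>).\<close>

definition dual_of_map ::
    "('k::field \<Rightarrow> 'a::ring \<Rightarrow> 'a) \<Rightarrow> 'a set \<Rightarrow> nat \<Rightarrow> ('a list \<Rightarrow> 'k) \<Rightarrow> ('a list \<Rightarrow>\<^sub>0 'k) set \<Rightarrow> 'k" where
  "dual_of_map scale A m \<phi> X = (if X \<in> tensor_power scale A m
     then free_eval \<phi> (SOME x. x \<in> free_on A m \<and> x +o tensor_rels scale A m = X) else 0)"

lemma list_insert_words:
  assumes "set xs \<subseteq> A" "set ys \<subseteq> A" "length xs + 1 + length ys = m" "z \<in> A"
  shows "xs @ z # ys \<in> words A m" "length xs < m" "xs @ x # ys = (xs @ z # ys)[length xs := x]"
  using assms by (auto simp: words_def)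

lemma list_update_split:
  assumes "rs \<in> words A m" "k < m"
  shows "rs[k := x] = take k rs @ x # drop (Suc k) rs" "set (take k rs) \<subseteq> A" "set (drop (Suc k) rs) \<subseteq> A"
    "length (take k rs) + 1 + length (drop (Suc k) rs) = m"
  using assms by (auto simp: words_def upd_conv_take_nth_drop dest: in_set_takeD in_set_dropD)

lemma free_eval_tensor_rels:
  assumes \<phi>: "multilinear_on scale A m \<phi>" and w: "w \<in> tensor_rels scale A m"
  shows "free_eval \<phi> w = 0"
  using w unfolding tensor_rels_def
proof (induction rule: fscale.span_induct)
  case base
  show ?case
    by (rule fscale.subspaceI) (auto simp: free_eval_add free_eval_fscale)
next
  case (step w)
  then show ?case
  proof (elim UnE CollectE exE conjE)
    fix xs x y ys
    assume *: "w = Poly_Mapping.single (xs @ (x + y) # ys) 1 - Poly_Mapping.single (xs @ x # ys) 1 - Poly_Mapping.single (xs @ y # ys) 1"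
      "set xs \<subseteq> A" "x \<in> A" "y \<in> A" "set ys \<subseteq> A" "length xs + 1 + length ys = m"
    note l = list_insert_words[OF *(2,5,6,3)]
    have "\<phi> (xs @ (x + y) # ys) = \<phi> (xs @ x # ys) + \<phi> (xs @ y # ys)"
      using \<phi> l(1,2) *(3,4) unfolding l(3)[of "x + y"] l(3)[of y] multilinear_on_def
      by (metis l(3) list_update_overwrite)
    then show ?thesis
      by (simp add: *(1) free_eval_diff)
  next
    fix xs c x ys
    assume *: "w = Poly_Mapping.single (xs @ scale c x # ys) 1 - Poly_Mapping.single (xs @ x # ys) c"
      "set xs \<subseteq> A" "x \<in> A" "set ys \<subseteq> A" "length xs + 1 + length ys = m"
    note l = list_insert_words[OF *(2,4,5,3)]
    have "\<phi> (xs @ scale c x # ys) = c * \<phi> (xs @ x # ys)"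
      using \<phi> l(1,2) *(3) unfolding l(3)[of "scale c x"] multilinear_on_def
      by (metis l(3) list_update_overwrite)
    then show ?thesis
      by (simp add: *(1) free_eval_diff)
  qed
qed

text \<open>The converse of \<open>free_eval_tensor_rels\<close>: the generators of the relations
  spell out the conditions of multilinearity one by one.\<close>

lemma multilinear_on_if_vanishing:
  assumes van: "\<And>w. w \<in> tensor_rels scale A m \<Longrightarrow> free_eval \<phi> w = 0"
  shows "multilinear_on scale A m \<phi>"
  unfolding multilinear_on_def
proof (intro ballI allI impI conjI)
  fix rs k x y assume rs: "rs \<in> words A m" "k < m" and xy: "x \<in> A" "y \<in> A"
  note l = list_update_split[OF rs]
  have "Poly_Mapping.single (rs[k := x + y]) 1 - Poly_Mapping.single (rs[k := x]) 1
      - Poly_Mapping.single (rs[k := y]) 1 \<in> tensor_rels scale A m"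
    unfolding tensor_rels_def l(1) using l xy by (intro fscale.span_base) blast
  from van[OF this] show "\<phi> (rs[k := x + y]) = \<phi> (rs[k := x]) + \<phi> (rs[k := y])"
    by (simp add: free_eval_diff diff_eq_eq add.commute)
next
  fix rs k c x assume rs: "rs \<in> words A m" "k < m" and x: "x \<in> A"
  note l = list_update_split[OF rs]
  have "Poly_Mapping.single (rs[k := scale c x]) 1 - Poly_Mapping.single (rs[k := x]) c \<in> tensor_rels scale A m"
    unfolding tensor_rels_def l(1) using l x by (intro fscale.span_base) blast
  from van[OF this] show "\<phi> (rs[k := scale c x]) = c * \<phi> (rs[k := x])"
    by (simp add: free_eval_diff)
qed

lemma tensor_power_coset: "x \<in> free_on A m \<Longrightarrow> x +o tensor_rels scale A m \<in> tensor_power scale A m"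
  by (simp add: tensor_power_def quot_space_def)

lemma tensor_powerE:
  assumes "X \<in> tensor_power scale A m"
  obtains x where "x \<in> free_on A m" "X = x +o tensor_rels scale A m"
  using assms by (auto simp: tensor_power_def quot_space_def)

lemma dual_of_map_coset:
  assumes \<phi>: "multilinear_on scale A m \<phi>" and x: "x \<in> free_on A m"
  shows "dual_of_map scale A m \<phi> (x +o tensor_rels scale A m) = free_eval \<phi> x"
proof -
  let ?W = "tensor_rels scale A m"
  define y where "y = (SOME y. y \<in> free_on A m \<and> y +o ?W = x +o ?W)"
  have "y \<in> free_on A m \<and> y +o ?W = x +o ?W"
    unfolding y_def by (rule someI[of _ x]) (simp add: x)
  then have "y - x \<in> ?W"
    using fscale.coset_eq_iff[OF subspace_tensor_rels] by blast
  then have "free_eval \<phi> y = free_eval \<phi> x"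
    using free_eval_tensor_rels[OF \<phi>, of "y - x"] by (simp add: free_eval_diff)
  then show ?thesis
    using x by (simp add: dual_of_map_def tensor_power_coset flip: y_def)
qed

lemma dual_of_map_outside: "X \<notin> tensor_power scale A m \<Longrightarrow> dual_of_map scale A m \<phi> X = 0"
  by (simp add: dual_of_map_def)

lemma dual_of_map_add:
  assumes "multilinear_on scale A m \<phi>" "multilinear_on scale A m \<psi>"
  shows "dual_of_map scale A m (\<lambda>rs. \<phi> rs + \<psi> rs) = dual_of_map scale A m \<phi> + dual_of_map scale A m \<psi>"
proof
  fix X
  show "dual_of_map scale A m (\<lambda>rs. \<phi> rs + \<psi> rs) X = (dual_of_map scale A m \<phi> + dual_of_map scale A m \<psi>) X"
    by (simp add: dual_of_map_def plus_fun_def free_eval_add_fun)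
qed

lemma dual_of_map_cmult: "dual_of_map scale A m (\<lambda>rs. c * \<phi> rs) X = c * dual_of_map scale A m \<phi> X"
  by (simp add: dual_of_map_def free_eval_cmult_fun)

lemma dual_of_map_in_dual:
  assumes \<phi>: "multilinear_on scale A m \<phi>"
  shows "dual_of_map scale A m \<phi> \<in> dual_space (tensor_power scale A m) (tensor_scale scale A m)"
proof -
  let ?W = "tensor_rels scale A m"
  have "dual_of_map scale A m \<phi> (X + Y) = dual_of_map scale A m \<phi> X + dual_of_map scale A m \<phi> Y"
    if "X \<in> tensor_power scale A m" "Y \<in> tensor_power scale A m" for X Y
    using that
    by (auto elim!: tensor_powerE simp: fscale.coset_plus[OF subspace_tensor_rels] dual_of_map_coset[OF \<phi>]
        free_eval_add fscale.subspace_add[OF subspace_free_on])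
  moreover have "dual_of_map scale A m \<phi> (tensor_scale scale A m c X) = c * dual_of_map scale A m \<phi> X"
    if "X \<in> tensor_power scale A m" for X c
    using that
    by (auto elim!: tensor_powerE simp: tensor_scale_def fscale.quot_scale_coset[OF subspace_tensor_rels]
        dual_of_map_coset[OF \<phi>] free_eval_fscale fscale.subspace_scale[OF subspace_free_on])
  ultimately show ?thesis
    by (simp add: dual_space_def linear_on_def dual_of_map_outside)
qed

lemma dual_of_map_inj:
  assumes "\<phi> \<in> multilinear_maps scale A m" "\<psi> \<in> multilinear_maps scale A m"
    and eq: "dual_of_map scale A m \<phi> = dual_of_map scale A m \<psi>"
  shows "\<phi> = \<psi>"
proof
  fix rs
  show "\<phi> rs = \<psi> rs"
  proof (cases "rs \<in> words A m")
    case True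
    have "dual_of_map scale A m \<chi> (Poly_Mapping.single rs 1 +o tensor_rels scale A m) = \<chi> rs"
      if "\<chi> \<in> multilinear_maps scale A m" for \<chi>
      using that by (simp add: multilinear_maps_def dual_of_map_coset[OF _ single_free_on[OF True]])
    then show ?thesis
      using assms by metis
  qed (use assms in \<open>simp add: multilinear_maps_def\<close>)
qed

section \<open>Multilinear maps as the full dual of the tensor power, and transposes of
  operators\<close>

context unital_algebra begin

lemma tensor_rels_subset_free_on: "tensor_rels scale A m \<subseteq> free_on A m"
  unfolding tensor_rels_def
  by (rule fscale.span_minimal)
    (auto intro!: fscale.subspace_diff[OF subspace_free_on] single_free_on
      simp: words_def carrier_add carrier_scale subspace_free_on)

text \<open>The multilinear map is read off from the classes of single words. It kills the relations
  because they represent the zero class.\<close>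

lemma dual_of_map_surj:
  assumes f: "f \<in> dual_space (tensor_power scale A m) (tensor_scale scale A m)"
  shows "\<exists>\<phi>\<in>multilinear_maps scale A m. dual_of_map scale A m \<phi> = f"
proof -
  let ?W = "tensor_rels scale A m"
  define \<psi> where "\<psi> rs = f (Poly_Mapping.single rs 1 +o ?W)" for rs
  have f_add: "f ((x + y) +o ?W) = f (x +o ?W) + f (y +o ?W)" if "x \<in> free_on A m" "y \<in> free_on A m" for x y
  proof -
    have "f ((x +o ?W) + (y +o ?W)) = f (x +o ?W) + f (y +o ?W)"
      using f that tensor_power_coset unfolding dual_space_def linear_on_def by blast
    then show ?thesis
      by (simp add: fscale.coset_plus[OF subspace_tensor_rels])
  qed
  have f_scale: "f (fscale c x +o ?W) = c * f (x +o ?W)" if "x \<in> free_on A m" for c x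
  proof -
    have "f (tensor_scale scale A m c (x +o ?W)) = c * f (x +o ?W)"
      using f that tensor_power_coset unfolding dual_space_def linear_on_def by blast
    then show ?thesis
      by (simp add: tensor_scale_def fscale.quot_scale_coset[OF subspace_tensor_rels])
  qed
  have zero: "f (0 +o ?W) = 0"
    using f_scale[of 0 0] by (simp add: fscale.subspace_0[OF subspace_free_on])
  \<comment> \<open>f is known to be linear on the carrier only, so linearity is carried through the
    sum by an induction that stays among formal sums of words over A.\<close>
  have "f ((\<Sum>i\<in>I. fscale (c i) (Poly_Mapping.single i 1)) +o ?W) = (\<Sum>i\<in>I. c i * \<psi> i)"
    if "finite I" "I \<subseteq> words A m" for I c
    using that
  proof (induction I rule: finite_induct)
    case (insert i I)
    let ?s = "\<Sum>i\<in>I. fscale (c i) (Poly_Mapping.single i 1)"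
    have s: "Poly_Mapping.single i 1 \<in> free_on A m" "?s \<in> free_on A m"
      using insert.prems
      by (auto intro!: single_free_on fscale.subspace_sum[OF subspace_free_on] fscale.subspace_scale[OF subspace_free_on])
    have "f ((fscale (c i) (Poly_Mapping.single i 1) + ?s) +o ?W) = c i * \<psi> i + f (?s +o ?W)"
      unfolding \<psi>_def f_scale[OF s(1), symmetric] using s
      by (intro f_add fscale.subspace_scale[OF subspace_free_on])
    then show ?case
      using insert by simp
  qed (simp only: sum.empty zero)
  then have f_eval: "f (x +o ?W) = free_eval \<psi> x" if "x \<in> free_on A m" for x
    unfolding free_eval_def using that
    by (subst poly_mapping_decomposition) (simp only: free_on_iff finite_keys)
  have "free_eval \<psi> w = 0" if "w \<in> ?W" for w
  proof -
    have "w +o ?W = 0 +o ?W"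
      using that by (subst fscale.coset_eq_iff[OF subspace_tensor_rels]) simp
    then show ?thesis
      using f_eval[of w] that tensor_rels_subset_free_on zero by auto
  qed
  then have \<psi>: "multilinear_on scale A m \<psi>"
    by (rule multilinear_on_if_vanishing)
  have "dual_of_map scale A m (on_words A m \<psi>) = f"
  proof
    fix X
    show "dual_of_map scale A m (on_words A m \<psi>) X = f X"
    proof (cases "X \<in> tensor_power scale A m")
      case True
      then obtain x where x: "x \<in> free_on A m" "X = x +o ?W"
        by (rule tensor_powerE)
      have "free_eval (on_words A m \<psi>) x = free_eval \<psi> x"
        using x(1) by (intro free_eval_cong) (auto simp: free_on_iff)
      then show ?thesis
        using on_words_multilinear[OF \<psi>] x f_eval by (simp add: dual_of_map_coset multilinear_maps_def)
    next
      case False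
      then show ?thesis
        using f by (simp add: dual_of_map_outside dual_space_def)
    qed
  qed
  then show ?thesis
    using on_words_multilinear[OF \<psi>] by blast
qed

text \<open>\<open>D\<close> is the transpose of the operator \<open>F\<close> on formal sums. The
  hypothesis \<open>eval\<close> is limited to words of length m' because the formula for b is
  correct from length 2 on. All differentials of the dual bicomplex are instances.\<close>

lemma dual_map_dual_of_map:
  assumes F: "\<And>x. x \<in> free_on A m' \<Longrightarrow> F x \<in> free_on A m"
    and F_add: "\<And>x y. F (x + y) = F x + F y"
    and eval: "\<And>\<phi> x. x \<in> free_on A m' \<Longrightarrow> free_eval \<phi> (F x) = free_eval (D \<phi>) x"
    and D: "\<And>\<phi>. multilinear_on scale A m \<phi> \<Longrightarrow> multilinear_on scale A m' (D \<phi>)"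
    and \<phi>: "multilinear_on scale A m \<phi>"
  shows "dual_map (tensor_power scale A m') (quot_map (tensor_rels scale A m) F) (dual_of_map scale A m \<phi>)
    = dual_of_map scale A m' (on_words A m' (D \<phi>))"
proof
  let ?W = "tensor_rels scale A m" and ?W' = "tensor_rels scale A m'"
  text \<open>\<open>F\<close> respects the tensor relations because functionals separate points and \<open>D\<close>
    preserves multilinearity.\<close>
  have FW: "F ` ?W' \<subseteq> ?W"
  proof (rule image_subsetI, rule ccontr)
    fix w assume w: "w \<in> ?W'" "F w \<notin> ?W"
    obtain \<psi> where \<psi>: "free_eval \<psi> (F w) = 1" "\<forall>v\<in>?W. free_eval \<psi> v = 0"
      using functional_separating[OF subspace_tensor_rels w(2)] by blast
    have "multilinear_on scale A m \<psi>"
      using \<psi>(2) by (intro multilinear_on_if_vanishing) blast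
    then have "free_eval (D \<psi>) w = 0"
      using D w(1) free_eval_tensor_rels by blast
    then show False
      using \<psi>(1) eval[of w \<psi>] w(1) tensor_rels_subset_free_on by auto
  qed
  fix X
  show "dual_map (tensor_power scale A m') (quot_map ?W F) (dual_of_map scale A m \<phi>) X
    = dual_of_map scale A m' (on_words A m' (D \<phi>)) X"
  proof (cases "X \<in> tensor_power scale A m'")
    case True
    then obtain x where x: "x \<in> free_on A m'" "X = x +o ?W'"
      by (rule tensor_powerE)
    have "quot_map ?W F X = F x +o ?W"
      unfolding x(2) by (rule fscale.quot_map_coset[OF subspace_tensor_rels subspace_tensor_rels F_add FW])
    moreover have "free_eval (on_words A m' (D \<phi>)) x = free_eval (D \<phi>) x"
      using x(1) by (intro free_eval_cong) (auto simp: free_on_iff)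
    ultimately show ?thesis
      using True x F D[OF \<phi>, THEN on_words_multilinear] eval
      by (simp add: dual_map_def dual_of_map_coset \<phi> multilinear_maps_def)
  qed (simp add: dual_map_def dual_of_map_outside)
qed

end

section \<open>The total complex\<close>

global_interpretation tot: vector_space Tot_scale
  by unfold_locales (auto simp: Tot_scale_def fun_eq_iff plus_fun_def algebra_simps)

definition tot_of_cochain ::
    "('k::field \<Rightarrow> 'a::ring \<Rightarrow> 'a) \<Rightarrow> 'a set \<Rightarrow> nat \<Rightarrow> (nat \<Rightarrow> 'a list \<Rightarrow> 'k) \<Rightarrow>
       nat \<Rightarrow> ('a list \<Rightarrow>\<^sub>0 'k) set \<Rightarrow> 'k" where
  "tot_of_cochain scale A n c i = (if i \<le> n then dual_of_map scale A (Suc (n - i)) (c i) else 0)"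

lemma free_eval_uminus_lin_ext: "free_eval \<phi> (- lin_ext G x) = free_eval (\<lambda>i. - free_eval \<phi> (G i)) x"
  by (simp add: free_eval_uminus free_eval_lin_ext free_eval_uminus_fun)

lemma free_eval_bprime_gen: "free_eval \<phi> (bprime_gen rs) = bprime_dual \<phi> rs"
  unfolding bprime_gen_def bprime_dual_def free_eval_sum free_eval_single
  by (intro sum.cong refl) (simp add: inner_face_eq[symmetric])

lemma free_eval_b_gen:
  assumes "2 \<le> length rs"
  shows "free_eval \<phi> (b_gen rs) = b_dual \<phi> rs"
proof -
  obtain n where "length rs = Suc (Suc n)"
    using assms by (metis add_2_eq_Suc le_Suc_ex)
  then show ?thesis
    by (simp add: b_gen_def free_eval_add free_eval_bprime_gen cyclic_face_eq[OF assms] bprime_dual_def b_dual_def)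
qed

lemma free_eval_t_gen: "free_eval \<phi> (t_gen rs) = t_dual \<phi> rs"
  by (simp add: t_gen_def t_dual_def rot_def)

lemma free_eval_funpow_t: "free_eval \<phi> ((lin_ext t_gen ^^ i) x) = free_eval ((t_dual ^^ i) \<phi>) x"
proof (induction i arbitrary: \<phi>)
  case (Suc i)
  have "free_eval \<phi> ((lin_ext t_gen ^^ Suc i) x) = free_eval (t_dual \<phi>) ((lin_ext t_gen ^^ i) x)"
    by (simp add: free_eval_lin_ext free_eval_t_gen)
  then show ?case
    unfolding Suc.IH by (simp add: funpow_swap1)
qed simp

context unital_algebra begin

lemma bprime_gen_free_on:
  assumes "rs \<in> words A (Suc (Suc q))"
  shows "bprime_gen rs \<in> free_on A (Suc q)"
  unfolding bprime_gen_def
proof (rule fscale.subspace_sum[OF subspace_free_on])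
  fix j assume "j \<in> {..<length rs - 1}"
  then have "Suc j < length rs"
    by auto
  then show "Poly_Mapping.single (take j rs @ (rs ! j * rs ! Suc j) # drop (j + 2) rs) ((- 1) ^ j) \<in> free_on A (Suc q)"
    unfolding inner_face_eq[OF \<open>Suc j < length rs\<close>]
    using assms by (intro single_free_on face_words[OF assms mult_closed]) (auto simp: words_def)
qed

lemma b_gen_free_on:
  assumes "rs \<in> words A (Suc (Suc q))"
  shows "b_gen rs \<in> free_on A (Suc q)"
proof -
  have "2 \<le> length rs"
    using assms by (simp add: words_def)
  then show ?thesis
    unfolding b_gen_def cyclic_face_eq[OF \<open>2 \<le> length rs\<close>] using assms
    by (intro fscale.subspace_add[OF subspace_free_on] bprime_gen_free_on single_free_on
        face_words[OF assms mult_closed]) (auto simp: words_def)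
qed

lemma t_gen_free_on: "rs \<in> words A (Suc q) \<Longrightarrow> t_gen rs \<in> free_on A (Suc q)"
  using rot_words[of rs A "Suc q"] by (simp add: t_gen_def rot_def single_free_on)

lemma multilinear_on_vert_dual:
  "multilinear_on scale A (Suc q) \<phi> \<Longrightarrow> multilinear_on scale A (Suc (Suc q)) (vert_dual i \<phi>)"
  unfolding vert_dual_def
  by (cases "even i") (auto intro: multilinear_on_b_dual multilinear_on_uminus multilinear_on_bprime_dual)

lemma multilinear_on_hor_dual:
  "multilinear_on scale A (Suc q) \<phi> \<Longrightarrow> multilinear_on scale A (Suc q) (hor_dual i \<phi>)"
  unfolding hor_dual_def
  by (cases "even i") (auto intro: multilinear_on_diff multilinear_on_t_dual multilinear_on_N_dual)

lemma DCC_vert_dual_of_map: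
  assumes "multilinear_on scale A (Suc q) \<phi>"
  shows "DCC_vert scale A i q (dual_of_map scale A (Suc q) \<phi>)
    = dual_of_map scale A (Suc (Suc q)) (on_words A (Suc (Suc q)) (vert_dual i \<phi>))"
proof -
  have "dual_map (tensor_power scale A (Suc (Suc q))) (quot_map (tensor_rels scale A (Suc q))
      (if even i then lin_ext b_gen else (\<lambda>x. - lin_ext bprime_gen x))) (dual_of_map scale A (Suc q) \<phi>)
    = dual_of_map scale A (Suc (Suc q)) (on_words A (Suc (Suc q)) (vert_dual i \<phi>))"
  proof (rule dual_map_dual_of_map[OF _ _ _ multilinear_on_vert_dual assms])
    fix x :: "'a list \<Rightarrow>\<^sub>0 'k" and \<phi> :: "'a list \<Rightarrow> 'k"
    assume x: "x \<in> free_on A (Suc (Suc q))"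
    show "(if even i then lin_ext b_gen else (\<lambda>x. - lin_ext bprime_gen x)) x \<in> free_on A (Suc q)"
      using x by (auto intro!: lin_ext_free_on[OF x] b_gen_free_on bprime_gen_free_on fscale.subspace_neg[OF subspace_free_on])
    show "free_eval \<phi> ((if even i then lin_ext b_gen else (\<lambda>x. - lin_ext bprime_gen x)) x) = free_eval (vert_dual i \<phi>) x"
    proof (cases "even i")
      case True
      have "free_eval (\<lambda>rs. free_eval \<phi> (b_gen rs)) x = free_eval (vert_dual i \<phi>) x"
        using x True by (intro free_eval_cong) (auto simp: free_on_iff vert_dual_def words_def intro!: free_eval_b_gen)
      then show ?thesis
        using True by (simp add: free_eval_lin_ext)
    next
      case False
      then show ?thesis
        by (simp add: free_eval_uminus_lin_ext free_eval_bprime_gen vert_dual_def[abs_def])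
    qed
  qed (simp add: lin_ext_add)
  then show ?thesis
    by (simp add: DCC_vert_def CC_def CC_vert_def)
qed

lemma DCC_hor_dual_of_map:
  assumes "multilinear_on scale A (Suc q) \<phi>"
  shows "DCC_hor scale A i q (dual_of_map scale A (Suc q) \<phi>)
    = dual_of_map scale A (Suc q) (on_words A (Suc q) (hor_dual i \<phi>))"
proof -
  let ?F = "if odd (Suc i) then (\<lambda>x. x - lin_ext t_gen x) else (\<lambda>x. \<Sum>i\<le>q. (lin_ext t_gen ^^ i) x)"
  have t_pow: "(lin_ext t_gen ^^ j) x \<in> free_on A (Suc q)" if "x \<in> free_on A (Suc q)" for j and x :: "'a list \<Rightarrow>\<^sub>0 'k"
    using that by (induction j) (auto intro: lin_ext_free_on t_gen_free_on)
  have t_pow_add: "(lin_ext t_gen ^^ j) (x + y) = (lin_ext t_gen ^^ j) x + (lin_ext t_gen ^^ j) y" for j and x y :: "'a list \<Rightarrow>\<^sub>0 'k"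
    by (induction j) (auto simp: lin_ext_add)
  have "dual_map (tensor_power scale A (Suc q)) (quot_map (tensor_rels scale A (Suc q)) ?F) (dual_of_map scale A (Suc q) \<phi>)
    = dual_of_map scale A (Suc q) (on_words A (Suc q) (hor_dual i \<phi>))"
  proof (rule dual_map_dual_of_map[OF _ _ _ multilinear_on_hor_dual assms])
    fix x :: "'a list \<Rightarrow>\<^sub>0 'k" and \<phi> :: "'a list \<Rightarrow> 'k"
    assume x: "x \<in> free_on A (Suc q)"
    show "?F x \<in> free_on A (Suc q)"
      using x t_pow[OF x] lin_ext_free_on[OF x t_gen_free_on]
      by (auto intro!: fscale.subspace_diff[OF subspace_free_on] fscale.subspace_sum[OF subspace_free_on])
    show "free_eval \<phi> (?F x) = free_eval (hor_dual i \<phi>) x"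
    proof (cases "even i")
      case True
      then show ?thesis
        by (simp add: free_eval_diff free_eval_lin_ext free_eval_t_gen hor_dual_def[abs_def] free_eval_diff_fun)
    next
      case False
      have "free_eval (\<lambda>rs. \<Sum>j\<le>q. (t_dual ^^ j) \<phi> rs) x = free_eval (hor_dual i \<phi>) x"
        using x False
        by (intro free_eval_cong) (auto simp: free_on_iff hor_dual_def N_dual_def words_def lessThan_Suc_atMost)
      then show ?thesis
        using False by (simp add: free_eval_sum free_eval_funpow_t free_eval_sum_fun)
    qed
  qed (simp add: lin_ext_add t_pow_add sum.distrib)
  then show ?thesis
    by (simp add: DCC_hor_def CC_def CC_hor_def)
qed

text \<open>The vertical and the horizontal part are normalised separately, since additivity of
  \<open>dual_of_map\<close> requires each of them to be multilinear.\<close>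

lemma total_diff_eq_on_words:
  assumes "i \<le> Suc n"
  shows "total_diff A n c i = (\<lambda>rs.
    on_words A (Suc (Suc n - i)) (if i \<le> n then vert_dual i (c i) else (\<lambda>rs. 0)) rs +
    on_words A (Suc (Suc n - i)) (if 1 \<le> i then hor_dual (i - 1) (c (i - 1)) else (\<lambda>rs. 0)) rs)"
  using assms by (auto simp: total_diff_def on_words_def fun_eq_iff)

lemma multilinear_on_zero: "multilinear_on scale A m (\<lambda>rs. 0)"
  by (simp add: multilinear_on_def)

lemma multilinear_on_vert_part:
  assumes "c \<in> cochains scale A n"
  shows "multilinear_on scale A (Suc (Suc n - i)) (if i \<le> n then vert_dual i (c i) else (\<lambda>rs. 0))"
  using assms by (auto simp: Suc_diff_le multilinear_on_zero cochains_def multilinear_maps_def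
      intro!: multilinear_on_vert_dual)

lemma multilinear_on_hor_part:
  assumes "c \<in> cochains scale A n" "i \<le> Suc n"
  shows "multilinear_on scale A (Suc (Suc n - i)) (if 1 \<le> i then hor_dual (i - 1) (c (i - 1)) else (\<lambda>rs. 0))"
  using assms by (cases i) (auto simp: multilinear_on_zero cochains_def multilinear_maps_def intro!: multilinear_on_hor_dual)

lemma total_diff_cochains:
  assumes c: "c \<in> cochains scale A n"
  shows "total_diff A n c \<in> cochains scale A (Suc n)"
proof -
  have "total_diff A n c i \<in> multilinear_maps scale A (Suc (Suc n - i))" if "i \<le> Suc n" for i
    using on_words_multilinear[OF multilinear_on_vert_part[OF c, of i]]
      on_words_multilinear[OF multilinear_on_hor_part[OF c that]]
    unfolding total_diff_eq_on_words[OF that] multilinear_maps_def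
    by (auto intro: multilinear_on_add)
  moreover have "total_diff A n c i = 0" if "Suc n < i" for i
    using that by (intro ext) (simp add: total_diff_def)
  ultimately show ?thesis
    by (simp add: cochains_def)
qed

lemma coboundary_maps_subset: "coboundary_maps scale A n \<subseteq> cochains scale A n"
  by (cases n) (auto intro: cochains_zero total_diff_cochains)

text \<open>With \<open>Tot_eq\<close> and \<open>inj_on_tot_of_cochain\<close> this makes
  \<open>tot_of_cochain\<close> an isomorphism of complexes, through which cocycles and coboundaries
  are transported.\<close>

lemma Tot_diff_tot_of_cochain:
  assumes c: "c \<in> cochains scale A n"
  shows "Tot_diff scale A n (tot_of_cochain scale A n c) = tot_of_cochain scale A (Suc n) (total_diff A n c)"
proof
  fix i
  have ml: "multilinear_on scale A (Suc (n - i)) (c i)" if "i \<le> n" for i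
    using c that by (simp add: cochains_def multilinear_maps_def)
  have zero: "dual_of_map scale A m (on_words A m (\<lambda>rs. 0)) = 0" for m
    by (intro ext) (simp add: dual_of_map_def on_words_def free_eval_def)
  show "Tot_diff scale A n (tot_of_cochain scale A n c) i = tot_of_cochain scale A (Suc n) (total_diff A n c) i"
  proof (cases "i \<le> Suc n")
    case True
    have "tot_of_cochain scale A (Suc n) (total_diff A n c) i =
      dual_of_map scale A (Suc (Suc n - i)) (on_words A (Suc (Suc n - i)) (if i \<le> n then vert_dual i (c i) else (\<lambda>rs. 0))) +
      dual_of_map scale A (Suc (Suc n - i)) (on_words A (Suc (Suc n - i)) (if 1 \<le> i then hor_dual (i - 1) (c (i - 1)) else (\<lambda>rs. 0)))"
      using True on_words_multilinear[OF multilinear_on_vert_part[OF c, of i]]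
        on_words_multilinear[OF multilinear_on_hor_part[OF c True]]
      by (simp add: tot_of_cochain_def total_diff_eq_on_words[OF True] multilinear_maps_def
          dual_of_map_add del: on_words_apply split del: if_split)
    moreover have "(if i \<le> n then DCC_vert scale A i (n - i) (tot_of_cochain scale A n c i) else 0)
      = dual_of_map scale A (Suc (Suc n - i)) (on_words A (Suc (Suc n - i)) (if i \<le> n then vert_dual i (c i) else (\<lambda>rs. 0)))"
      using ml by (simp add: tot_of_cochain_def DCC_vert_dual_of_map Suc_diff_le zero)
    moreover have "(if 1 \<le> i \<and> i \<le> n + 1 then DCC_hor scale A (i - 1) (n - (i - 1)) (tot_of_cochain scale A n c (i - 1)) else 0)
      = dual_of_map scale A (Suc (Suc n - i)) (on_words A (Suc (Suc n - i)) (if 1 \<le> i then hor_dual (i - 1) (c (i - 1)) else (\<lambda>rs. 0)))"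
      using ml True by (cases i) (simp_all add: tot_of_cochain_def DCC_hor_dual_of_map zero)
    ultimately show ?thesis
      unfolding Tot_diff_def by simp
  qed (simp add: Tot_diff_def tot_of_cochain_def)
qed

lemma Tot_eq: "Tot scale A n = tot_of_cochain scale A n ` cochains scale A n"
proof (intro equalityI subsetI)
  fix x assume x: "x \<in> Tot scale A n"
  have "\<exists>\<phi>\<in>multilinear_maps scale A (Suc (n - i)). dual_of_map scale A (Suc (n - i)) \<phi> = x i" if "i \<le> n" for i
    using x that by (intro dual_of_map_surj) (simp add: Tot_def DCC_def CC_def)
  then obtain c where c: "\<And>i. i \<le> n \<Longrightarrow> c i \<in> multilinear_maps scale A (Suc (n - i))"
      "\<And>i. i \<le> n \<Longrightarrow> dual_of_map scale A (Suc (n - i)) (c i) = x i"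
    by metis
  define c' where "c' i = (if i \<le> n then c i else 0)" for i
  have "c' \<in> cochains scale A n"
    using c(1) by (simp add: cochains_def c'_def)
  moreover have "tot_of_cochain scale A n c' = x"
    using c(2) x by (intro ext) (simp add: tot_of_cochain_def c'_def Tot_def)
  ultimately show "x \<in> tot_of_cochain scale A n ` cochains scale A n"
    by blast
next
  fix x assume "x \<in> tot_of_cochain scale A n ` cochains scale A n"
  then show "x \<in> Tot scale A n"
    by (auto simp: Tot_def DCC_def CC_def tot_of_cochain_def cochains_def multilinear_maps_def
        intro!: dual_of_map_in_dual)
qed

end

lemma inj_on_tot_of_cochain: "inj_on (tot_of_cochain scale A n) (cochains scale A n)"
proof (rule inj_onI, rule ext)
  fix c d i
  assume c: "c \<in> cochains scale A n" and d: "d \<in> cochains scale A n"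
    and eq: "tot_of_cochain scale A n c = tot_of_cochain scale A n d"
  show "c i = d i"
  proof (cases "i \<le> n")
    case True
    then show ?thesis
      using c d fun_cong[OF eq, of i]
      by (intro dual_of_map_inj[of _ scale A "Suc (n - i)"]) (auto simp: cochains_def tot_of_cochain_def)
  qed (use c d in \<open>simp add: cochains_def\<close>)
qed

lemma tot_of_cochain_add:
  assumes "c \<in> cochains scale A n" "d \<in> cochains scale A n"
  shows "tot_of_cochain scale A n (c + d) = tot_of_cochain scale A n c + tot_of_cochain scale A n d"
proof
  fix i
  have "c i + d i = (\<lambda>rs. c i rs + d i rs)"
    by (simp add: plus_fun_def)
  then show "tot_of_cochain scale A n (c + d) i = (tot_of_cochain scale A n c + tot_of_cochain scale A n d) i"
    using assms by (auto simp: tot_of_cochain_def cochains_def multilinear_maps_def dual_of_map_add)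
qed

lemma tot_of_cochain_cmult:
  "tot_of_cochain scale A n (\<lambda>i rs. a * c i rs) = Tot_scale a (tot_of_cochain scale A n c)"
  by (intro ext) (simp add: tot_of_cochain_def Tot_scale_def dual_of_map_cmult)

lemma tot_of_cochain_0: "tot_of_cochain scale A n 0 = 0"
  using tot_of_cochain_cmult[of scale A n 0 0]
  by (simp add: zero_fun_def Tot_scale_def)

lemma tot_of_cochain_diff:
  assumes "c \<in> cochains scale A n" "d \<in> cochains scale A n"
  shows "tot_of_cochain scale A n (c - d) = tot_of_cochain scale A n c - tot_of_cochain scale A n d"
proof -
  have "(c - d) + d = c"
    by simp
  moreover have "c - d = c + (\<lambda>p rs. - 1 * d p rs)"
    by (intro ext) simp
  then have "c - d \<in> cochains scale A n"
    using cochains_add[OF assms(1) cochains_cmult[OF assms(2)]] by metis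
  ultimately show ?thesis
    using tot_of_cochain_add[of "c - d" scale A n d] assms(2) by (simp add: eq_diff_eq)
qed

section \<open>Cocycles and coboundaries of the total complex through multilinear maps\<close>

context unital_algebra begin

lemma cocycles_eq: "cocycles scale A n = tot_of_cochain scale A n ` cocycle_maps scale A n"
proof -
  have "tot_of_cochain scale A (Suc n) (total_diff A n c) = 0 \<longleftrightarrow> total_diff A n c = 0" if "c \<in> cochains scale A n" for c
    using inj_onD[OF inj_on_tot_of_cochain _ total_diff_cochains[OF that] cochains_zero] tot_of_cochain_0 by metis
  then show ?thesis
    by (auto simp: cocycles_def cocycle_maps_def Tot_eq Tot_diff_tot_of_cochain tot_of_cochain_0)
qed

lemma coboundaries_eq: "coboundaries scale A n = tot_of_cochain scale A n ` coboundary_maps scale A n"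
proof (cases n)
  case (Suc m)
  then show ?thesis
    by (auto simp: Tot_eq Tot_diff_tot_of_cochain image_iff)
qed (simp add: tot_of_cochain_0)

lemma tot_of_cochain_in_coboundaries_iff:
  assumes "c \<in> cochains scale A n"
  shows "tot_of_cochain scale A n c \<in> coboundaries scale A n \<longleftrightarrow> c \<in> coboundary_maps scale A n"
  unfolding coboundaries_eq
  using inj_on_image_mem_iff[OF inj_on_tot_of_cochain assms coboundary_maps_subset] .

lemma cocycle_maps_add:
  "c \<in> cocycle_maps scale A n \<Longrightarrow> d \<in> cocycle_maps scale A n \<Longrightarrow> c + d \<in> cocycle_maps scale A n"
  by (simp add: cocycle_maps_def cochains_add total_diff_add)

lemma cocycle_maps_cmult: "c \<in> cocycle_maps scale A n \<Longrightarrow> (\<lambda>p rs. a * c p rs) \<in> cocycle_maps scale A n"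
  by (simp add: cocycle_maps_def cochains_cmult total_diff_cmult zero_fun_def)

lemma cocycle_maps_diff:
  assumes "c \<in> cocycle_maps scale A n" "d \<in> cocycle_maps scale A n"
  shows "c - d \<in> cocycle_maps scale A n"
  using cocycle_maps_add[OF assms(1) cocycle_maps_cmult[OF assms(2), of "- 1"]]
  by (simp add: plus_fun_def fun_diff_def)

lemma subspace_tot_image:
  assumes "S \<subseteq> cochains scale A n" "0 \<in> S" "\<And>c d. c \<in> S \<Longrightarrow> d \<in> S \<Longrightarrow> c + d \<in> S"
    "\<And>c a. c \<in> S \<Longrightarrow> (\<lambda>p rs. a * c p rs) \<in> S"
  shows "tot.subspace (tot_of_cochain scale A n ` S)"
proof (rule tot.subspaceI)
  show "0 \<in> tot_of_cochain scale A n ` S"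
    using assms(2) tot_of_cochain_0 by (metis image_eqI)
  show "x + y \<in> tot_of_cochain scale A n ` S" if xy: "x \<in> tot_of_cochain scale A n ` S" "y \<in> tot_of_cochain scale A n ` S" for x y
  proof -
    obtain c d where "c \<in> S" "d \<in> S" "x = tot_of_cochain scale A n c" "y = tot_of_cochain scale A n d"
      using xy by blast
    then have "x + y = tot_of_cochain scale A n (c + d)" "c + d \<in> S"
      using assms(1,3) by (auto simp: tot_of_cochain_add subset_iff)
    then show ?thesis
      by blast
  qed
  show "Tot_scale a x \<in> tot_of_cochain scale A n ` S" if x: "x \<in> tot_of_cochain scale A n ` S" for a x
    using x assms(4) by (auto simp: tot_of_cochain_cmult[symmetric])
qed

lemma coboundary_maps_0: "0 \<in> coboundary_maps scale A n"
proof (cases n)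
  case (Suc m)
  have "total_diff A m 0 = 0"
    using total_diff_add[of A m 0 0] by simp
  then show ?thesis
    using Suc cochains_zero by (auto simp: image_iff intro!: bexI[of _ 0])
qed simp

lemma subspace_coboundaries: "tot.subspace (coboundaries scale A n)"
  unfolding coboundaries_eq
  by (intro subspace_tot_image coboundary_maps_subset coboundary_maps_0 coboundary_maps_add coboundary_maps_cmult)

lemma subspace_cocycles: "tot.subspace (cocycles scale A n)"
proof -
  have "total_diff A n 0 = 0"
    using total_diff_add[of A n 0 0] by simp
  then show ?thesis
    unfolding cocycles_eq
    by (intro subspace_tot_image cocycle_maps_add cocycle_maps_cmult) (auto simp: cocycle_maps_def cochains_zero)
qed

end

text \<open>Conjugates \<open>pullback\<close> by the identification with multilinear cochains.
  Outside the image of \<open>tot_of_cochain\<close> the inverse is arbitrary, so the lemmas on it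
  are restricted to cocycles and coboundaries.\<close>

definition tot_pullback ::
    "('k::field \<Rightarrow> 'a::ring \<Rightarrow> 'a) \<Rightarrow> 'a set \<Rightarrow> 'a set \<Rightarrow> ('a \<Rightarrow> 'a) \<Rightarrow> nat \<Rightarrow>
       (nat \<Rightarrow> ('a list \<Rightarrow>\<^sub>0 'k) set \<Rightarrow> 'k) \<Rightarrow> nat \<Rightarrow> ('a list \<Rightarrow>\<^sub>0 'k) set \<Rightarrow> 'k" where
  "tot_pullback scale A B f n x =
     tot_of_cochain scale A n (pullback A f (inv_into (cochains scale B n) (tot_of_cochain scale B n) x))"

lemma tot_pullback_tot_of_cochain:
  "c \<in> cochains scale B n \<Longrightarrow>
     tot_pullback scale A B f n (tot_of_cochain scale B n c) = tot_of_cochain scale A n (pullback A f c)"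
  by (simp add: tot_pullback_def inv_into_f_f[OF inj_on_tot_of_cochain])

locale algebra_hom_pair = A: unital_algebra scale A u + B: unital_algebra scale B v
  for scale :: "'k::field \<Rightarrow> 'a::ring \<Rightarrow> 'a" and A u B v +
  fixes f :: "'a \<Rightarrow> 'a"
  assumes hom: "algebra_hom scale A B f"
begin

lemma tot_pullback_add:
  assumes "x \<in> cocycles scale B n" "y \<in> cocycles scale B n \<or> y \<in> coboundaries scale B n"
  shows "tot_pullback scale A B f n (x + y) = tot_pullback scale A B f n x + tot_pullback scale A B f n y"
proof -
  obtain c d where c: "c \<in> cochains scale B n" "x = tot_of_cochain scale B n c"
    and d: "d \<in> cochains scale B n" "y = tot_of_cochain scale B n d"
    using assms B.coboundary_maps_subset by (auto simp: B.cocycles_eq B.coboundaries_eq cocycle_maps_def)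
  have "tot_pullback scale A B f n (tot_of_cochain scale B n (c + d))
      = tot_of_cochain scale A n (pullback A f c + pullback A f d)"
    using c(1) d(1) by (simp only: tot_pullback_tot_of_cochain cochains_add pullback_add)
  then show ?thesis
    using c d A.pullback_cochains[OF hom] by (simp add: tot_pullback_tot_of_cochain tot_of_cochain_add)
qed

lemma linear_on_tot_pullback:
  "linear_on (cocycles scale B n) Tot_scale (cocycles scale A n) Tot_scale (tot_pullback scale A B f n)"
proof -
  have "tot_pullback scale A B f n x \<in> cocycles scale A n" if "x \<in> cocycles scale B n" for x
    using that A.pullback_cocycle[OF hom]
    by (auto simp: A.cocycles_eq B.cocycles_eq cocycle_maps_def tot_pullback_tot_of_cochain)
  moreover have "tot_pullback scale A B f n (Tot_scale a x) = Tot_scale a (tot_pullback scale A B f n x)"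
    if "x \<in> cocycles scale B n" for a x
    using that
    by (auto simp: B.cocycles_eq cocycle_maps_def tot_pullback_tot_of_cochain cochains_cmult pullback_cmult
        simp flip: tot_of_cochain_cmult)
  ultimately show ?thesis
    using tot_pullback_add by (simp add: linear_on_def)
qed

lemma tot_pullback_coboundaries:
  "tot_pullback scale A B f n ` coboundaries scale B n \<subseteq> coboundaries scale A n"
  using B.coboundary_maps_subset A.pullback_coboundary[OF hom]
  by (auto simp: A.coboundaries_eq B.coboundaries_eq subset_iff tot_pullback_tot_of_cochain)

end

section \<open>The long exact sequence\<close>

text \<open>Cochains live on words with at least one letter, so a zero letter appears. This removes
  the cross terms when cocycles on P and A2 are glued.\<close>

lemma (in unital_algebra) pullback_zero_map:
  assumes B: "unital_algebra scale B v" and c: "c \<in> cochains scale B n"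
  shows "pullback A (\<lambda>x. 0) c = 0"
proof (intro ext)
  fix i rs
  show "pullback A (\<lambda>x. 0) c i rs = 0 i rs"
  proof (cases "i \<le> n \<and> map (\<lambda>x. 0) rs \<in> words B (Suc (n - i))")
    case True
    then have "multilinear_on scale B (Suc (n - i)) (c i)"
      using c by (simp add: cochains_def multilinear_maps_def)
    moreover have "map (\<lambda>x. 0 :: 'a) rs ! 0 = 0"
      using True by (auto simp: words_def)
    ultimately have "c i (map (\<lambda>x. 0) rs) = 0"
      using True unital_algebra.multilinear_zero_entry[OF B, of "Suc (n - i)" "c i" _ 0] by blast
    then show ?thesis
      by (simp add: pullback_def)
  next
    case False
    then show ?thesis
      using c by (cases "i \<le> n") (auto simp: pullback_def cochains_def multilinear_maps_def)
  qed
qed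

lemma algebra_hom_inclusion: "A \<subseteq> B \<Longrightarrow> algebra_hom scale A B (\<lambda>x. x)"
  by (auto simp: algebra_hom_def linear_on_def)

theorem theorem3p8:
  fixes scale :: "'k::field \<Rightarrow> 'a::ring \<Rightarrow> 'a"
    and R A1 A2 C :: "'a set"
    and u e e1' e2' e1 e2 :: 'a
  assumes "unital_algebra scale R u"
    and "oriented R u e e1' e2'"
    and "e1 = e1' + e" and "e2 = e2' + e"
    and "A1 = corner R e1 e1" and "A2 = corner R e2 e2" and "C = corner R e e"
  shows "\<exists>f g \<delta>.
    (\<forall>n. linear_on (HC scale R n) (HC_scale scale R n)
           (HC scale A1 n \<times> HC scale A2 n) (pair_scale (HC_scale scale A1 n) (HC_scale scale A2 n))
           (f n)) \<and>
    (\<forall>n. linear_on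
           (HC scale A1 n \<times> HC scale A2 n) (pair_scale (HC_scale scale A1 n) (HC_scale scale A2 n))
           (HC scale C n) (HC_scale scale C n)
           (g n)) \<and>
    (\<forall>n. linear_on (HC scale C n) (HC_scale scale C n)
           (HC scale R (n + 1)) (HC_scale scale R (n + 1))
           (\<delta> n)) \<and>
    inj_on (f 0) (HC scale R 0) \<and>
    (\<forall>n. f n ` HC scale R n = {z \<in> HC scale A1 n \<times> HC scale A2 n. g n z = HC_zero scale C n}) \<and>
    (\<forall>n. g n ` (HC scale A1 n \<times> HC scale A2 n) =
           {z \<in> HC scale C n. \<delta> n z = HC_zero scale R (n + 1)}) \<and>
    (\<forall>n. \<delta> n ` HC scale C n =
           {z \<in> HC scale R (n + 1). f (n + 1) z = (HC_zero scale A1 (n + 1), HC_zero scale A2 (n + 1))})"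
proof -
  interpret R: unital_algebra scale R u
    by fact
  define P where "P = corner R e1' e1'"
  have in_R: "e \<in> R" "e1' \<in> R" "e2' \<in> R"
    and idem: "e * e = e" "e1' * e1' = e1'" "e2' * e2' = e2'"
    and orth: "e * e1' = 0" "e1' * e = 0" "e * e2' = 0" "e2' * e = 0" "e1' * e2' = 0" "e2' * e1' = 0"
    and u: "u = e1' + e + e2'"
    and or: "corner R e1' e2' = {0}" "corner R e2' e1' = {0}"
      "corner R e e1' = {0} \<or> corner R e1' e = {0}"
    using assms(2) unfolding oriented_def by auto
  have e2: "e1' * e2 = 0" "e2 * e1' = 0" "e2 * e2 = e2" "e2 \<in> R" "e * e2 = e" "e2 * e = e"
    using idem orth in_R by (auto simp: assms(4) distrib_left distrib_right R.carrier_add)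
  have e1: "e1 * e1 = e1" "e1 \<in> R" "e1 * e1' = e1'" "e1' * e1 = e1'" "e * e1 = e" "e1 * e = e"
    using idem orth in_R by (auto simp: assms(3) distrib_left distrib_right R.carrier_add)
  have corner_0: "f * x * g = 0" if "corner R f g = {0}" "x \<in> R" for f g x
    using that by (auto simp: corner_def)
  text \<open>In each of the three cases \<open>R\<close> is triangular with respect to \<open>e1'\<close> and \<open>e2\<close>, in one of
    the two orders.\<close>
  have tri: "(\<forall>x\<in>R. e1' * x * e2 = 0 \<and> e1' * x * e = 0) \<or> (\<forall>x\<in>R. e2 * x * e1' = 0 \<and> e * x * e1' = 0)"
    using or corner_0 by (auto simp: assms(4) distrib_left distrib_right)
  have memI: "x \<in> corner R f f" if "x \<in> R" "f * x = x" "x * f = x" for x f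
    using that unfolding corner_def by (metis (mono_tags, lifting) mem_Collect_eq)
  have memD: "x \<in> R" "f * x = x" "x * f = x" if "x \<in> corner R f f" "f \<in> R" "f * f = f" for x f
    using that unfolding corner_def by (auto simp: R.mult_closed mult.assoc) (metis mult.assoc)
  interpret A1: unital_algebra scale A1 e1
    unfolding assms(5) using e1 by (intro R.unital_algebra_corner)
  interpret A2: unital_algebra scale A2 e2
    unfolding assms(6) using e2 by (intro R.unital_algebra_corner)
  interpret C: unital_algebra scale C e
    unfolding assms(7) using in_R idem by (intro R.unital_algebra_corner)
  interpret P: unital_algebra scale P e1'
    unfolding P_def using in_R idem by (intro R.unital_algebra_corner)
  note A1D = memD[of _ e1, folded assms(5), OF _ e1(2,1)]
    and A2D = memD[of _ e2, folded assms(6), OF _ e2(4,3)]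
    and CD = memD[of _ e, folded assms(7), OF _ in_R(1) idem(1)]
    and PD = memD[of _ e1', folded P_def, OF _ in_R(2) idem(2)]
  have sub: "A1 \<subseteq> R" "A2 \<subseteq> R" "C \<subseteq> R" "P \<subseteq> R"
    using A1D A2D CD PD by auto
  have C1: "C \<subseteq> A1" and C2: "C \<subseteq> A2" and P1: "P \<subseteq> A1"
  proof -
    have "e1 * x = x \<and> x * e1 = x \<and> e2 * x = x \<and> x * e2 = x" if "x \<in> C" for x
      using CD[OF that] e1 e2 by (metis mult.assoc)
    then show "C \<subseteq> A1" "C \<subseteq> A2"
      unfolding assms(5,6) using CD by (auto intro!: memI)
    have "e1 * x = x \<and> x * e1 = x" if "x \<in> P" for x
      using PD[OF that] e1 by (metis mult.assoc)
    then show "P \<subseteq> A1"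
      unfolding assms(5) using PD by (auto intro!: memI)
  qed
  have in_A1: "e1' \<in> A1" "e \<in> A1"
    unfolding assms(5) using e1 in_R by (auto intro!: memI)
  have corners: "corner A1 e1' e1' = P" "corner A1 e e = C"
  proof -
    \<comment> \<open>Both e1' and e are absorbed by e1, so the two corners of A1 are already
      corners of R.\<close>
    have "e1' * (e1 * x * e1) * e1' = e1' * x * e1'" "e * (e1 * x * e1) * e = e * x * e" for x
      using e1 by (metis mult.assoc)+
    then have "corner A1 e1' e1' = {e1' * x * e1' | x. x \<in> R}" "corner A1 e e = {e * x * e | x. x \<in> R}"
      unfolding corner_def assms(5) by (auto, metis+)
    then show "corner A1 e1' e1' = P" "corner A1 e e = C"
      by (auto simp: P_def assms(7) corner_def)
  qed
  \<comment> \<open>What the two triangular orders have in common. The projections onto P and A2 are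
    x \<mapsto> e1' x and x \<mapsto> x e2 in one order, x \<mapsto> x e1' and x \<mapsto> e2 x in
    the other. The rest of the proof uses only the properties listed here.\<close>
  obtain \<pi>P \<pi>2 where hom_P: "algebra_hom scale R P \<pi>P" and hom_2: "algebra_hom scale R A2 \<pi>2"
    and on_P: "\<And>x. x \<in> P \<Longrightarrow> \<pi>P x = x \<and> \<pi>2 x = 0"
    and on_A2: "\<And>x. x \<in> A2 \<Longrightarrow> \<pi>2 x = x \<and> \<pi>P x = 0"
    and on_A1: "\<And>x. x \<in> A1 \<Longrightarrow> \<pi>2 x \<in> C"
    and exact_R: "\<And>n c. c \<in> cocycle_maps scale R n \<Longrightarrow> pullback P (\<lambda>x. x) c \<in> coboundary_maps scale P n \<Longrightarrow>
      pullback A2 (\<lambda>x. x) c \<in> coboundary_maps scale A2 n \<Longrightarrow> c \<in> coboundary_maps scale R n"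
    and exact_A1: "\<And>n c. c \<in> cocycle_maps scale A1 n \<Longrightarrow> pullback P (\<lambda>x. x) c \<in> coboundary_maps scale P n \<Longrightarrow>
      pullback C (\<lambda>x. x) c \<in> coboundary_maps scale C n \<Longrightarrow> c \<in> coboundary_maps scale A1 n"
  proof -
    have ann: "e2 * x = 0 \<and> x * e2 = 0" if "x \<in> P" for x
      using PD[OF that] e2 by (metis mult.assoc mult_zero_left mult_zero_right)
    have ann': "e1' * x = 0 \<and> x * e1' = 0" if "x \<in> A2" for x
      using A2D[OF that] e2 by (metis mult.assoc mult_zero_left mult_zero_right)
    \<comment> \<open>On A1 the idempotent e2 acts as e, because e1 e2 = e = e2 e1. Hence the
      projection of R onto A2 restricts to the projection of A1 onto C.\<close>
    have red: "e2 * x = e * x \<and> x * e2 = x * e" if "x \<in> A1" for x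
    proof -
      have "e2 * e1 = e" "e1 * e2 = e"
        using idem orth by (simp_all add: assms(3,4) distrib_left distrib_right)
      then show ?thesis
        using A1D[OF that] by (metis mult.assoc)
    qed
    show thesis
      using tri
    proof
      assume t: "\<forall>x\<in>R. e1' * x * e2 = 0 \<and> e1' * x * e = 0"
      interpret TR: triangular_algebra scale R u e1' e2
        using in_R e2 idem t by unfold_locales (auto simp: u assms(4) add.assoc)
      interpret TA: triangular_algebra scale A1 e1 e1' e
        using in_A1 idem orth t sub by unfold_locales (auto simp: assms(3))
      have "x * e2 \<in> C" if "x \<in> A1" for x
        using TA.q_algebra_hom algebra_hom_in red that by (fastforce simp: corners)
      then show thesis
        using TR.p_algebra_hom TR.q_algebra_hom PD A2D ann ann'
          TR.coboundary_if_corner_coboundaries TA.coboundary_if_corner_coboundaries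
        by (intro that[of "(*) e1'" "\<lambda>x. x * e2"]) (auto simp: corners simp flip: P_def assms(6))
    next
      assume t: "\<forall>x\<in>R. e2 * x * e1' = 0 \<and> e * x * e1' = 0"
      interpret TR: triangular_algebra scale R u e2 e1'
        using in_R e2 idem t by unfold_locales (auto simp: u assms(4) add_ac)
      interpret TA: triangular_algebra scale A1 e1 e e1'
        using in_A1 idem orth t sub by unfold_locales (auto simp: assms(3) add_ac)
      have "e2 * x \<in> C" if "x \<in> A1" for x
        using TA.p_algebra_hom algebra_hom_in red that by (fastforce simp: corners)
      then show thesis
        using TR.p_algebra_hom TR.q_algebra_hom PD A2D ann ann'
          TR.coboundary_if_corner_coboundaries TA.coboundary_if_corner_coboundaries
        by (intro that[of "\<lambda>x. x * e1'" "(*) e2"]) (auto simp: corners simp flip: P_def assms(6))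
    qed
  qed
  interpret r1: algebra_hom_pair scale A1 e1 R u "\<lambda>x. x"
    using sub by unfold_locales (simp add: algebra_hom_inclusion)
  interpret r2: algebra_hom_pair scale A2 e2 R u "\<lambda>x. x"
    using sub by unfold_locales (simp add: algebra_hom_inclusion)
  interpret s1: algebra_hom_pair scale C e A1 e1 "\<lambda>x. x"
    using C1 by unfold_locales (simp add: algebra_hom_inclusion)
  interpret s2: algebra_hom_pair scale C e A2 e2 "\<lambda>x. x"
    using C2 by unfold_locales (simp add: algebra_hom_inclusion)
  have restrict: "pullback A' (\<lambda>x. x) (pullback B f c) = pullback A' f c"
    if "A' \<subseteq> B" for A' B f and c :: "nat \<Rightarrow> 'a list \<Rightarrow> 'k"
    using that by (subst pullback_pullback) auto
  \<comment> \<open>The projection onto P is regarded as a map into A1, so that cochains on A1 can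
    be pulled back to R.\<close>
  have hom_R1: "algebra_hom scale R A1 \<pi>P"
    using algebra_hom_mono[OF hom_P subset_refl] algebra_hom_in[OF hom_P] P1 by blast
  have hom_1C: "algebra_hom scale A1 C \<pi>2"
    using algebra_hom_mono[OF hom_2 sub(1)] on_A1 by blast
  note eq_defs = R.cocycles_eq A1.cocycles_eq A2.cocycles_eq C.cocycles_eq
  have cocycle_cochain: "c \<in> cochains scale A' n" if "c \<in> cocycle_maps scale A' n" for c A' n
    using that by (simp add: cocycle_maps_def)
  note tpb = tot_pullback_tot_of_cochain[OF cocycle_cochain]
  show ?thesis
    unfolding HC_def HC_scale_def HC_zero_def
  proof (rule tot.exact_sequence_of_lifts[where
        ?r1.0 = "tot_pullback scale A1 R (\<lambda>x. x)" and ?r2.0 = "tot_pullback scale A2 R (\<lambda>x. x)" and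
        ?s1.0 = "tot_pullback scale C A1 (\<lambda>x. x)" and ?s2.0 = "tot_pullback scale C A2 (\<lambda>x. x)"])
    fix n z assume "z \<in> cocycles scale R n"
    then obtain c where c: "c \<in> cocycle_maps scale R n" "z = tot_of_cochain scale R n c"
      by (auto simp: eq_defs)
    note pc = A1.pullback_cocycle[OF r1.hom c(1)] A2.pullback_cocycle[OF r2.hom c(1)]
    show "tot_pullback scale C A1 (\<lambda>x. x) n (tot_pullback scale A1 R (\<lambda>x. x) n z)
        = tot_pullback scale C A2 (\<lambda>x. x) n (tot_pullback scale A2 R (\<lambda>x. x) n z)"
      using c pc by (simp add: tpb restrict[OF C1] restrict[OF C2])
    assume "tot_pullback scale A1 R (\<lambda>x. x) n z \<in> coboundaries scale A1 n"
      and z2: "tot_pullback scale A2 R (\<lambda>x. x) n z \<in> coboundaries scale A2 n"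
    then have "pullback A1 (\<lambda>x. x) c \<in> coboundary_maps scale A1 n"
      using c pc by (simp add: tpb A1.tot_of_cochain_in_coboundaries_iff cocycle_cochain)
    \<comment> \<open>As P lies in A1, a coboundary on A1 restricts to one on P; P and A2 together
      detect coboundaries on R.\<close>
    from P.pullback_coboundary[OF algebra_hom_inclusion[OF P1] this]
    have "pullback P (\<lambda>x. x) c \<in> coboundary_maps scale P n"
      by (simp add: restrict[OF P1])
    moreover have "pullback A2 (\<lambda>x. x) c \<in> coboundary_maps scale A2 n"
      using z2 c pc by (simp add: tpb A2.tot_of_cochain_in_coboundaries_iff cocycle_cochain)
    ultimately show "z \<in> coboundaries scale R n"
      using exact_R[OF c(1)] c by (simp add: R.tot_of_cochain_in_coboundaries_iff cocycle_cochain)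
  next
    fix n y w assume "y \<in> cocycles scale A1 n" "w \<in> cocycles scale A2 n"
      and diff: "tot_pullback scale C A1 (\<lambda>x. x) n y - tot_pullback scale C A2 (\<lambda>x. x) n w \<in> coboundaries scale C n"
    then obtain c d where c: "c \<in> cocycle_maps scale A1 n" "y = tot_of_cochain scale A1 n c"
      and d: "d \<in> cocycle_maps scale A2 n" "w = tot_of_cochain scale A2 n d"
      by (auto simp: eq_defs)
    note cd = C.pullback_cocycle[OF s1.hom c(1)] C.pullback_cocycle[OF s2.hom d(1)]
    have diff': "pullback C (\<lambda>x. x) c - pullback C (\<lambda>x. x) d \<in> coboundary_maps scale C n"
      using diff c d cd C.cocycle_maps_diff[OF cd]
      by (simp add: tpb C.tot_of_cochain_in_coboundaries_iff cocycle_cochain flip: tot_of_cochain_diff)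
    \<comment> \<open>The glued cocycle takes c on the P side and d on the A2 side. The cross terms
      vanish, so it restricts to d on A2, to d on C, and to the restriction of c on P.\<close>
    define b where "b = pullback R \<pi>P c + pullback R \<pi>2 d"
    have b: "b \<in> cocycle_maps scale R n"
      unfolding b_def by (intro R.cocycle_maps_add R.pullback_cocycle[OF hom_R1] R.pullback_cocycle[OF hom_2] c d)
    have b_on: "pullback A' (\<lambda>x. x) b = pullback A' \<pi>P c + pullback A' \<pi>2 d" if "A' \<subseteq> R" for A'
      by (simp add: b_def pullback_add restrict[OF that])
    have "pullback A2 \<pi>P c = 0"
      using on_A2 A2.pullback_zero_map[OF A1.unital_algebra_axioms cocycle_cochain[OF c(1)]] by (simp cong: pullback_cong)
    moreover have "pullback A2 \<pi>2 d = d"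
      using on_A2 pullback_id[OF cocycle_cochain[OF d(1)]] by (simp cong: pullback_cong)
    ultimately have b2: "pullback A2 (\<lambda>x. x) b = d"
      by (simp add: b_on[OF sub(2)])
    have "pullback C \<pi>P c = 0" "pullback C \<pi>2 d = pullback C (\<lambda>x. x) d"
      using on_A2 C2 C.pullback_zero_map[OF A1.unital_algebra_axioms cocycle_cochain[OF c(1)]]
      by (simp_all add: subset_iff cong: pullback_cong)
    then have bC: "pullback C (\<lambda>x. x) b = pullback C (\<lambda>x. x) d"
      by (simp add: b_on[OF sub(3)])
    have "pullback P \<pi>P c = pullback P (\<lambda>x. x) c" "pullback P \<pi>2 d = 0"
      using on_P P.pullback_zero_map[OF A2.unital_algebra_axioms cocycle_cochain[OF d(1)]] by (simp_all cong: pullback_cong)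
    then have bP: "pullback P (\<lambda>x. x) b = pullback P (\<lambda>x. x) c"
      by (simp add: b_on[OF sub(4)])
    \<comment> \<open>On A1 the glued cocycle need not equal c. The difference is 0 on P and a
      coboundary on C, by the assumed agreement of c and d there, so \<open>exact_A1\<close> makes
      it a coboundary.\<close>
    define a where "a = pullback A1 (\<lambda>x. x) b - c"
    have a: "a \<in> cocycle_maps scale A1 n"
      unfolding a_def by (intro A1.cocycle_maps_diff A1.pullback_cocycle[OF r1.hom] b c)
    have "a \<in> coboundary_maps scale A1 n"
    proof (rule exact_A1[OF a])
      show "pullback P (\<lambda>x. x) a \<in> coboundary_maps scale P n"
        by (simp add: a_def pullback_diff restrict[OF P1] bP P.coboundary_maps_0)
      have "pullback C (\<lambda>x. x) a = 0 - (pullback C (\<lambda>x. x) c - pullback C (\<lambda>x. x) d)"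
        by (simp add: a_def pullback_diff restrict[OF C1] bC)
      then show "pullback C (\<lambda>x. x) a \<in> coboundary_maps scale C n"
        using coboundary_maps_diff[OF C.coboundary_maps_0 diff'] by simp
    qed
    then have "tot_pullback scale A1 R (\<lambda>x. x) n (tot_of_cochain scale R n b) - y \<in> coboundaries scale A1 n"
      using b c a A1.pullback_cocycle[OF r1.hom b]
      by (simp add: tpb A1.tot_of_cochain_in_coboundaries_iff cocycle_cochain a_def flip: tot_of_cochain_diff)
    moreover have "tot_pullback scale A2 R (\<lambda>x. x) n (tot_of_cochain scale R n b) - w \<in> coboundaries scale A2 n"
      using b d tot.subspace_0[OF A2.subspace_coboundaries] by (simp add: tpb b2)
    ultimately show "\<exists>z\<in>cocycles scale R n. tot_pullback scale A1 R (\<lambda>x. x) n z - y \<in> coboundaries scale A1 n \<and>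
        tot_pullback scale A2 R (\<lambda>x. x) n z - w \<in> coboundaries scale A2 n"
      using b by (auto simp: eq_defs)
  next
    fix n x assume "x \<in> cocycles scale C n"
    then obtain c where c: "c \<in> cocycle_maps scale C n" "x = tot_of_cochain scale C n c"
      by (auto simp: eq_defs)
    \<comment> \<open>The projection of A1 onto C is the identity on C, so pulling back along it
      gives a preimage on the nose and not merely up to coboundaries.\<close>
    note lift = A1.pullback_cocycle[OF hom_1C c(1)]
    have "pullback C \<pi>2 c = c"
      using on_A2 C2 pullback_id[OF cocycle_cochain[OF c(1)]] by (simp add: subset_iff cong: pullback_cong)
    then have "tot_pullback scale C A1 (\<lambda>x. x) n (tot_of_cochain scale A1 n (pullback A1 \<pi>2 c)) = x"
      using c lift by (simp add: tpb restrict[OF C1])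
    then show "\<exists>y\<in>cocycles scale A1 n. tot_pullback scale C A1 (\<lambda>x. x) n y - x \<in> coboundaries scale C n"
      using lift tot.subspace_0[OF C.subspace_coboundaries] unfolding eq_defs by force
  qed (simp_all add: R.subspace_cocycles A1.subspace_cocycles A2.subspace_cocycles C.subspace_cocycles
      R.subspace_coboundaries A1.subspace_coboundaries A2.subspace_coboundaries C.subspace_coboundaries
      r1.linear_on_tot_pullback r2.linear_on_tot_pullback s1.linear_on_tot_pullback s2.linear_on_tot_pullback
      r1.tot_pullback_coboundaries r2.tot_pullback_coboundaries s1.tot_pullback_coboundaries
      s2.tot_pullback_coboundaries r1.tot_pullback_add r2.tot_pullback_add s1.tot_pullback_add s2.tot_pullback_add)
qed

end
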